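(* There exist constants $A>0$ and $t_0>0$ such that for all $s=\sigma+it$ with $t>t_0$ and $1-\sigma\ge A\,t^{2/5}\log t$, $$\mathcal{R}(s)=-\chi(s)\eta^{s-1}e^{-\pi i\eta^2}\frac{\sqrt2\,e^{3\pi i/8}\sin\pi\eta}{2\cos 2\pi\eta}(1+U)\quad\text{with } |U|<1.$$
   Context: $\mathcal{R}(s)=\int_{0\swarrow 1}\frac{x^{-s}e^{\pi i x^2}}{e^{\pi i x}-e^{-\pi i x}}\,dx$ (Riemann's auxiliary function), where $0\swarrow1$ is a straight line of direction $e^{-3\pi i/4}$ crossing the real axis in $(0,1)$ and $x^{-s}$ is the principal branch. $\chi(s)=\pi^{s-1/2}\Gamma(\frac{1-s}{2})/\Gamma(\frac s2)$. $\eta:=\sqrt{(s-1)/(2\pi i)}$ with $-\pi/4<\arg\eta<3\pi/4$; $\eta^{s-1}$ is the principal power. *)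

theory Defs
  imports "HOL-Analysis.Analysis"
begin

definition omega_dir :: complex where
  "omega_dir = exp (- 3 * pi * \<i> / 4)"

definition R_integrand :: "complex \<Rightarrow> complex \<Rightarrow> complex" where
  "R_integrand s x = x powr (- s) * exp (pi * \<i> * x\<^sup>2) /
                     (exp (pi * \<i> * x) - exp (- pi * \<i> * x))"

text \<open>Riemann's auxiliary function: integral along the straight line through 1/2
  (a point of (0,1)) with direction e^{-3 pi i/4}, parametrised by
  x = 1/2 + u * omega_dir, u from -infinity to +infinity.\<close>
definition riemann_R :: "complex \<Rightarrow> complex" where
  "riemann_R s = integral UNIV (\<lambda>u::real. R_integrand s (1/2 + of_real u * omega_dir) * omega_dir)"

definition chi :: "complex \<Rightarrow> complex" where
  "chi s = of_real pi powr (s - 1/2) * Gamma ((1 - s) / 2) / Gamma (s / 2)"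

definition eta :: "complex \<Rightarrow> complex" where
  "eta s = (THE w. w\<^sup>2 = (s - 1) / (2 * pi * \<i>) \<and> - pi / 4 < Arg w \<and> Arg w < 3 * pi / 4)"

end

theory Submission
  imports Defs "HOL-Complex_Analysis.Complex_Analysis" "HOL-Probability.Probability" "HOL-Real_Asymp.Real_Asymp"
begin

text \<open>
  Moving the line to the origin and folding it gives
  \<open>R(s) = (1 - exp (\<pi> \<i> s)) \<integral> x powr (-s) * exp (\<pi> \<i> x\<^sup>2) * \<i> / (2 sin (\<pi> x))\<close> over the ray of direction
  \<open>exp (\<pi> \<i> / 4)\<close>. Expanding \<open>1 / sin\<close> into a geometric series yields Gaussian Mellin integrals with
  parameters \<open>m = k + 1/2\<close>. Writing \<open>x powr (-s)\<close> against a Gaussian as a Laplace transform turns each of them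
  into \<open>Gamma (1 - s)\<close> times \<open>\<integral> y powr (s - 1) * exp (- \<pi> \<i> y\<^sup>2 + 2 \<pi> \<i> m y)\<close>, over any line of direction
  \<open>exp (- \<pi> \<i> / 4)\<close> that passes above the origin, and the Gamma factors recombine exactly to \<open>\<chi>(s)\<close>; no
  Stirling formula is needed.

  Since the integrands have no poles, the line may depend on \<open>m\<close>. For \<open>m\<^sup>3 \<le> |\<eta>|\<close> the line through
  \<open>\<eta> + m / 2\<close> gives a Gaussian with relative error \<open>O(m\<^sup>3 / |\<eta>|)\<close>; for larger \<open>m\<close> the line through the exact
  saddle gives a bound decaying in \<open>m\<close>. The Gaussian values \<open>exp (\<pi> \<i> m\<^sup>2 / 2 + 2 \<pi> \<i> m \<eta>)\<close> sum to a multiple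
  of \<open>sin (\<pi> \<eta>) / cos (2 \<pi> \<eta>)\<close>. With \<open>Y = Im \<eta>\<close> this is at least of size \<open>Y\<close> for small \<open>Y\<close>, whereas the
  errors sum to \<open>O(1 / (|\<eta>| Y\<^sup>4))\<close>, so that \<open>Y\<close> has to exceed a multiple of \<open>|\<eta>| powr (-1/5)\<close>. This is the
  origin of the exponent \<open>2/5\<close>.
\<close>

section \<open>Gaussian and Gamma integrals\<close>

text \<open>The hypothesis is used three times. For large t it gives \<open>Re s \<le> -1\<close>,
  so that \<open>x powr (- s)\<close> cancels the pole of 1 / sin (pi x) at the origin and the line
  may be moved there. It puts \<open>\<eta>\<close> into the sector 0 < arg <= pi/4, on which the
  estimates of the logarithm rest. Finally 1 - sigma = 4 pi Re \<eta> Im \<eta> turns a lower bound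
  of order |\<eta>|^(4/5) for 1 - sigma into Im \<eta> >= K |\<eta>|^(-1/5). As long as 1 - sigma <=
  t, |\<eta>|^2 is comparable with t, so |\<eta>|^(4/5) is of order t^(2/5), and ln t absorbs K. The
  obstacle is uniformity: sigma may tend to minus infinity while t stays bounded, so Im \<eta>
  ranges from |\<eta>|^(-1/5) to arbitrarily large values. Hence all estimates are in terms of
  |\<eta>| and Im \<eta>, not of t. The bound |U| < 1 is won by comparing explicit constants, 1/3
  against 1 / (2 sqrt 2).\<close>

lemma cmod_powr_le:
  "cmod (x powr w) \<le> cmod x powr Re w * exp (pi * \<bar>Im w\<bar>)"
proof (cases "x = 0")
  case False
  have "\<bar>Im w * Im (Ln x)\<bar> \<le> \<bar>Im w\<bar> * pi"
    unfolding abs_mult using mpi_less_Im_Ln[OF False] Im_Ln_le_pi[OF False]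
    by (intro mult_left_mono) auto
  then have "- (Im w * Im (Ln x)) \<le> pi * \<bar>Im w\<bar>"
    by (simp add: mult.commute abs_le_iff)
  with False show ?thesis
    by (simp add: powr_def exp_diff exp_minus field_simps flip: exp_add)
qed auto

text \<open>With c = a + i b the exponent is pi a^2 - pi (b + r)^2 + 2 pi i a (b + r), so the
  integral is the characteristic function of the standard normal law at \<open>k * a\<close>, where
  \<open>k\<close> is sqrt (2 pi). Its value exp (- pi a^2) cancels the prefactor; no contour shift
  is involved.\<close>

lemma integral_exp_pi_shifted_square:
  fixes c :: complex
  shows "integrable lborel (\<lambda>r::real. exp (pi * (c + \<i> * r)\<^sup>2))"
    and "(LINT r::real|lborel. exp (pi * (c + \<i> * r)\<^sup>2)) = 1"
proof -
  define a b where "a = Re c" and "b = Im c"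
  have fourier: "(LINT x|lborel. std_normal_density x *\<^sub>R iexp (t * x)) = exp (- (t\<^sup>2) / 2)" for t
    using fun_cong[OF char_std_normal_distribution, of t] 
    unfolding char_def by (subst (asm) integral_density) auto
  have int: "integrable lborel (\<lambda>x. std_normal_density x *\<^sub>R iexp (t * x))" for t
    using integrable_std_normal_moment[of 0]
    by (rule Bochner_Integration.integrable_bound) auto
  define k where "k = sqrt (2 * pi)"
  have k: "k > 0" "k\<^sup>2 = 2 * pi" by (auto simp: k_def)
  have eq: "exp (pi * (c + \<i> * r)\<^sup>2) =
      exp (pi * a\<^sup>2) * k * (std_normal_density (k * b + k * r) *\<^sub>R iexp ((k * a) * (k * b + k * r)))" for r :: real
  proof -
    have "(c + \<i> * r)\<^sup>2 = of_real (a\<^sup>2 - (b + r)\<^sup>2) + \<i> * of_real (2 * a * (b + r))"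
      by (simp add: a_def b_def complex_eq_iff power2_eq_square algebra_simps)
    then have "pi * (c + \<i> * r)\<^sup>2 = of_real (pi * a\<^sup>2) + (of_real (- (pi * (b + r)\<^sup>2)) + \<i> * of_real (2 * pi * a * (b + r)))"
      by (simp only:) (simp add: algebra_simps)
    then have "exp (pi * (c + \<i> * r)\<^sup>2) = exp (of_real (pi * a\<^sup>2) + (of_real (- (pi * (b + r)\<^sup>2)) + \<i> * of_real (2 * pi * a * (b + r))))"
      by (simp only:)
    also have "\<dots> = of_real (exp (pi * a\<^sup>2)) * of_real (exp (- (pi * (b + r)\<^sup>2))) * iexp (2 * pi * a * (b + r))"
      by (simp only: exp_add exp_of_real mult.assoc)
    also have "exp (- (pi * (b + r)\<^sup>2)) = k * std_normal_density (k * b + k * r)"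
      using k by (simp add: std_normal_density_def power_mult_distrib flip: k_def distrib_left)
    also have "2 * pi * a * (b + r) = (k * a) * (k * b + k * r)"
      using k(2) by (simp add: power2_eq_square algebra_simps)
    finally show ?thesis by (simp add: scaleR_conv_of_real exp_of_real)
  qed
  have kn: "k \<noteq> 0" using k by simp
  have I: "integrable lborel (\<lambda>r. std_normal_density (k * b + k * r) *\<^sub>R iexp ((k * a) * (k * b + k * r)))"
    using lborel_integrable_real_affine[OF int[of "k * a"] kn, of "k * b"] by simp
  show "integrable lborel (\<lambda>r::real. exp (pi * (c + \<i> * r)\<^sup>2))"
    unfolding eq by (intro integrable_mult_right I)
  have "(LINT r|lborel. std_normal_density (k * b + k * r) *\<^sub>R iexp ((k * a) * (k * b + k * r))) =
     inverse k *\<^sub>R exp (- ((k * a)\<^sup>2) / 2)"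
    using lborel_integral_real_affine[OF kn, of "\<lambda>x. std_normal_density x *\<^sub>R iexp ((k * a) * x)" "k * b"] fourier[of "k * a"] k
    by (simp add: field_simps scaleR_conv_of_real)
  also have "- ((k * a)\<^sup>2) / 2 = - (pi * a\<^sup>2)" using k by (simp add: power_mult_distrib)
  finally have X: "(LINT r|lborel. std_normal_density (k * b + k * r) *\<^sub>R iexp ((k * a) * (k * b + k * r))) =
     complex_of_real (inverse k * exp (- (pi * a\<^sup>2)))" by (simp add: scaleR_conv_of_real)
  have "exp (pi * a\<^sup>2) * k * (inverse k * exp (- (pi * a\<^sup>2))) = 1" using kn by (simp add: exp_minus field_simps)
  then show "(LINT r::real|lborel. exp (pi * (c + \<i> * r)\<^sup>2)) = 1"
    unfolding eq integral_mult_right_zero X by (simp only: flip: of_real_mult) simp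
qed

text \<open>Primitives control gauge integrals over compact intervals, whereas Fubini and dominated
  convergence concern Lebesgue integrals; this passes from one to the other. The majorant is
  \<open>f\<close> itself on \<open>S\<close>.\<close>

lemma truncated_integral_limit:
  fixes f :: "real \<Rightarrow> complex"
  assumes f: "set_integrable lborel S f"
    and sub: "\<And>n. {a n..b n} \<subseteq> S"
    and ex: "\<And>x. x \<in> S \<Longrightarrow> eventually (\<lambda>n. x \<in> {a n..b n}) sequentially"
  shows "(\<lambda>n. integral {a n..b n} f) \<longlonglongrightarrow> (LINT x:S|lborel. f x)"
proof -
  have meas: "(\<lambda>x. indicat_real {a n..b n} x *\<^sub>R f x) \<in> borel_measurable lborel" for n
  proof -
    have "(\<lambda>x. indicat_real {a n..b n} x *\<^sub>R (indicat_real S x *\<^sub>R f x)) \<in> borel_measurable lborel"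
      using f unfolding set_integrable_def by measurable
    moreover have "(\<lambda>x. indicat_real {a n..b n} x *\<^sub>R (indicat_real S x *\<^sub>R f x)) = (\<lambda>x. indicat_real {a n..b n} x *\<^sub>R f x)"
      using sub[of n] by (auto simp: indicator_def fun_eq_iff)
    ultimately show ?thesis by (simp only:)
  qed
  have "set_integrable lborel {a n..b n} f" for n
    by (rule set_integrable_subset[OF f _ sub]) simp
  then have "integral {a n..b n} f = (LINT x:{a n..b n}|lborel. f x)" for n
    using set_borel_integral_eq_integral(2)[of "{a n..b n}" f] by simp
  moreover have "(\<lambda>n. LINT x:{a n..b n}|lborel. f x) \<longlonglongrightarrow> (LINT x:S|lborel. f x)"
    unfolding set_lebesgue_integral_def
  proof (rule integral_dominated_convergence)
    show "(\<lambda>x. indicat_real S x *\<^sub>R f x) \<in> borel_measurable lborel"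
      using f by (simp add: set_integrable_def)
    show "(\<lambda>x. indicat_real {a n..b n} x *\<^sub>R f x) \<in> borel_measurable lborel" for n by (rule meas)
    show "integrable lborel (\<lambda>x. norm (indicat_real S x *\<^sub>R f x))"
      using f unfolding set_integrable_def by (rule integrable_norm)
    show "AE x in lborel. (\<lambda>n. indicat_real {a n..b n} x *\<^sub>R f x) \<longlonglongrightarrow> indicat_real S x *\<^sub>R f x"
    proof (rule AE_I2)
      fix x
      have "eventually (\<lambda>n. indicat_real {a n..b n} x *\<^sub>R f x = indicat_real S x *\<^sub>R f x) sequentially"
      proof (cases "x \<in> S")
        case True
        from ex[OF this] show ?thesis by eventually_elim (use True in auto)
      next
        case False
        then have "x \<notin> {a n..b n}" for n using sub[of n] by blast
        with False show ?thesis by (auto simp: indicator_def)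
      qed
      then show "(\<lambda>n. indicat_real {a n..b n} x *\<^sub>R f x) \<longlonglongrightarrow> indicat_real S x *\<^sub>R f x"
        by (rule tendsto_eventually)
    qed
    show "AE x in lborel. norm (indicat_real {a n..b n} x *\<^sub>R f x) \<le> norm (indicat_real S x *\<^sub>R f x)" for n
      using sub[of n] by (intro AE_I2) (auto simp: indicator_def)
  qed
  ultimately show ?thesis by simp
qed

text \<open>Replaces Cauchy's theorem: holomorphic functions on convex domains have primitives, so
  moving a line reduces to comparing \<open>P\<close> at the end points.\<close>

lemma integral_line_primitive:
  fixes f P :: "complex \<Rightarrow> complex"
  assumes "a \<le> b"
    and "\<And>u. u \<in> {a..b} \<Longrightarrow> (P has_field_derivative f (z + of_real u * d)) (at (z + of_real u * d))"
  shows "integral {a..b} (\<lambda>u. f (z + of_real u * d) * d) = P (z + of_real b * d) - P (z + of_real a * d)"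
proof (rule integral_unique, rule fundamental_theorem_of_calculus[OF assms(1)])
  fix u assume u: "u \<in> {a..b}"
  have "((\<lambda>u. P (z + of_real u * d)) has_vector_derivative (d * f (z + of_real u * d))) (at u within {a..b})"
    by (rule field_vector_diff_chain_within[where g = P and f = "\<lambda>u. z + of_real u * d" and f' = d, unfolded o_def])
       (auto intro!: derivative_eq_intros has_field_derivative_at_within[OF assms(2)[OF u]])
  then show "((\<lambda>u. P (z + of_real u * d)) has_vector_derivative (f (z + of_real u * d) * d)) (at u within {a..b})"
    by (simp add: mult.commute)
qed

text \<open>Up to the factor \<open>c powr z\<close> this is the Gamma integral along the ray of
  direction \<open>c\<close>. The ray is rotated to the positive axis inside the right half plane: a
  primitive of the Gamma integrand takes nearly equal values at R c and R, both for R -> infinity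
  and for R -> 0.\<close>

lemma Gamma_integral_scaled:
  fixes z c :: complex
  assumes z: "Re z > 1" and c: "Re c > 0"
  shows "set_integrable lborel {0<..} (\<lambda>r::real. of_real r powr (z - 1) * exp (- (c * of_real r)))"
    and "(LINT r:{0<..}|lborel. of_real r powr (z - 1) * exp (- (c * of_real r))) = Gamma z * c powr (- z)"
proof -
  define f where "f c r = of_real r powr (z - 1) * exp (- (c * of_real r))" for c :: complex and r :: real
  have integ: "set_integrable lborel {0<..} (f c)" if "Re c > 0" for c
  proof -
    have abs: "(\<lambda>t. complex_of_real t powr (z - 1) / of_real (exp (Re c * t))) absolutely_integrable_on {0<..}"
      using z that by (intro absolutely_integrable_Gamma_integral) auto
    have "(\<lambda>x. indicator {0<..} x *\<^sub>R f c x) \<in> borel_measurable borel"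
      unfolding f_def
      by (intro borel_measurable_continuous_on_indicator continuous_intros) (auto simp: complex_nonpos_Reals_iff)
    then have m: "(\<lambda>x. indicator {0<..} x *\<^sub>R f c x) \<in> borel_measurable lborel" by simp
    have "integrable lebesgue (\<lambda>x. indicator {0<..} x *\<^sub>R f c x)"
      using abs unfolding set_integrable_def
      by (rule Bochner_Integration.integrable_bound)
         (use m in \<open>auto simp: f_def norm_mult norm_divide exp_minus field_simps measurable_completion\<close>)
    then show ?thesis
      using integrable_completion[OF m] by (simp add: set_integrable_def)
  qed
  define g where "g x = x powr (z - 1) * exp (- x)" for x :: complex
  let ?S = "{x. 0 < Re x}"
  have "g holomorphic_on ?S" unfolding g_def
    by (intro holomorphic_intros) (auto simp: complex_nonpos_Reals_iff)
  then obtain P where P: "\<And>x. x \<in> ?S \<Longrightarrow> (P has_field_derivative g x) (at x within ?S)"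
    using holomorphic_convex_primitive'[of ?S g] convex_halfspace_Re_gt open_halfspace_Re_gt by blast
  have P': "(P has_field_derivative g x) (at x)" if "0 < Re x" for x
    using P[of x] that at_within_open[OF _ open_halfspace_Re_gt[of 0], of x] by simp
  have gf: "g (0 + of_real u * c) * c = c powr z * f c u" if "u > 0" "Re c > 0" for u c
  proof -
    have "c \<noteq> 0" using that by auto
    then have "Ln (of_real u * c) = of_real (ln u) + Ln c" using that by (simp add: Ln_times_of_real Ln_of_real)
    then have "g (0 + of_real u * c) * exp (Ln c) = c powr z * f c u" using \<open>c \<noteq> 0\<close> that
      by (simp add: g_def f_def powr_def Ln_of_real mult_ac del: exp_Ln flip: exp_add) (simp add: algebra_simps del: exp_Ln)
    with \<open>c \<noteq> 0\<close> show ?thesis by simp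
  qed
  have trunc: "c powr z * integral {1 / (real n + 1)..real n + 1} (f c) =
      P (of_real (real n + 1) * c) - P (of_real (1 / (real n + 1)) * c)" if "Re c > 0" for c n
  proof -
    have le: "1 / (real n + 1) \<le> real n + 1" by (simp add: field_simps)
    have pos: "u > 0" if "u \<in> {1 / (real n + 1)..real n + 1}" for u
      using that less_le_trans[of 0 "1 / (real n + 1)" u] by auto
    have "integral {1 / (real n + 1)..real n + 1} (\<lambda>u. g (0 + of_real u * c) * c) = 
       P (0 + of_real (real n + 1) * c) - P (0 + of_real (1 / (real n + 1)) * c)"
      by (rule integral_line_primitive[OF le], rule P') (use that pos in auto)
    also have "integral {1 / (real n + 1)..real n + 1} (\<lambda>u. g (0 + of_real u * c) * c) =
      integral {1 / (real n + 1)..real n + 1} (\<lambda>u. c powr z * f c u)"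
      by (rule integral_cong) (use gf that pos in auto)
    finally show ?thesis by simp
  qed
  have lim: "(\<lambda>n. c powr z * integral {1 / (real n + 1)..real n + 1} (f c)) \<longlonglongrightarrow>
      c powr z * (LINT r:{0<..}|lborel. f c r)" if "Re c > 0" for c
  proof (intro tendsto_intros truncated_integral_limit integ that)
    show "{1 / (real n + 1)..real n + 1} \<subseteq> {0<..}" for n
      using less_le_trans[of 0 "1 / (real n + 1)"] by auto
    show "eventually (\<lambda>n. x \<in> {1 / (real n + 1)..real n + 1}) sequentially" if "x \<in> {0<..}" for x
    proof -
      have "eventually (\<lambda>n. 1 / (real n + 1) < x) sequentially" 
        by (rule order_tendstoD(2)[of _ 0]) (use that in \<open>auto, real_asymp\<close>)
      moreover have "eventually (\<lambda>n. real n + 1 \<ge> x) sequentially"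
        by real_asymp
      ultimately show ?thesis by eventually_elim auto
    qed
  qed
  \<comment> \<open>R and R c both lie in the convex set Re x >= R \<kappa>, |x| <= R M, where the
    modulus of the integrand has an explicit bound, so the mean value inequality applies to the
    segment between them.\<close>
  define \<kappa> M K where "\<kappa> = min 1 (Re c)" and "M = max 1 (cmod c)" and "K = exp (pi * \<bar>Im (z - 1)\<bar>)"
  have \<kappa>: "\<kappa> > 0" and M: "M > 0" using c by (auto simp: \<kappa>_def M_def)
  have K: "K > 0" by (simp add: K_def)
  have diff: "cmod (P (of_real R * c) - P (of_real R * 1)) \<le>
      ((R * M) powr (Re z - 1) * K * exp (- (R * \<kappa>))) * cmod (of_real R * c - of_real R * 1)" if "R > 0" for R
  proof (rule field_differentiable_bound[where S = "{x. R * \<kappa> \<le> Re x} \<inter> cball 0 (R * M)"])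
    show "convex ({x. R * \<kappa> \<le> Re x} \<inter> cball 0 (R * M))"
      by (intro convex_Int convex_cball convex_halfspace_Re_ge)
    show "(P has_field_derivative g x) (at x within {x. R * \<kappa> \<le> Re x} \<inter> cball 0 (R * M))"
      if "x \<in> {x. R * \<kappa> \<le> Re x} \<inter> cball 0 (R * M)" for x
    proof (rule has_field_derivative_at_within, rule P')
      have "R * \<kappa> > 0" "R * \<kappa> \<le> Re x" using that \<open>R > 0\<close> \<kappa> by auto
      then show "Re x > 0" by linarith
    qed
    show "cmod (g x) \<le> (R * M) powr (Re z - 1) * K * exp (- (R * \<kappa>))"
      if "x \<in> {x. R * \<kappa> \<le> Re x} \<inter> cball 0 (R * M)" for x
    proof -
      have "cmod (g x) = cmod (x powr (z - 1)) * exp (- Re x)" by (simp add: g_def norm_mult)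
      also have "\<dots> \<le> (cmod x powr Re (z - 1) * K) * exp (- (R * \<kappa>))"
        using that unfolding K_def by (intro mult_mono cmod_powr_le) auto
      also have "\<dots> \<le> ((R * M) powr Re (z - 1) * K) * exp (- (R * \<kappa>))"
        using that z K by (intro mult_right_mono powr_mono2) auto
      finally show ?thesis by simp
    qed
    show "of_real R * c \<in> {x. R * \<kappa> \<le> Re x} \<inter> cball 0 (R * M)"
      "of_real R * 1 \<in> {x. R * \<kappa> \<le> Re x} \<inter> cball 0 (R * M)"
      using that by (auto simp: \<kappa>_def M_def norm_mult)
  qed
  have diff': "cmod (P (of_real R * c) - P (of_real R * 1)) \<le>
      ((R * M) powr (Re z - 1) * K * exp (- (R * \<kappa>))) * (R * cmod (c - 1))" if "R > 0" for R
  proof -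
    have "cmod (of_real R * c - of_real R * 1) = R * cmod (c - 1)"
      using that norm_mult[of "of_real R" "c - 1"] by (simp add: algebra_simps)
    with diff[OF that] show ?thesis by (simp only:)
  qed
  define \<alpha> where "\<alpha> = Re z - 1"
  have \<alpha>: "\<alpha> > 0" using z by (simp add: \<alpha>_def)
  have "(\<lambda>n. P (of_real (real n + 1) * c) - P (of_real (real n + 1) * 1)) \<longlonglongrightarrow> 0"
  proof (rule Lim_null_comparison)
    show "eventually (\<lambda>n. cmod (P (of_real (real n + 1) * c) - P (of_real (real n + 1) * 1)) \<le>
      (((real n + 1) * M) powr \<alpha> * K * exp (- ((real n + 1) * \<kappa>))) * ((real n + 1) * cmod (c - 1))) sequentially"
      unfolding \<alpha>_def by (intro always_eventually allI diff') simp
    have "(\<lambda>n. (((real n + 1) * M) powr \<alpha> * exp (- ((real n + 1) * \<kappa>))) * (real n + 1)) \<longlonglongrightarrow> 0"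
      using \<alpha> \<kappa> M by real_asymp
    from tendsto_mult_right_zero[OF this, of "K * cmod (c - 1)"]
    show "(\<lambda>n. (((real n + 1) * M) powr \<alpha> * K * exp (- ((real n + 1) * \<kappa>))) * ((real n + 1) * cmod (c - 1))) \<longlonglongrightarrow> 0"
      by (simp add: mult_ac)
  qed
  \<comment> \<open>Near 0 the exponential does not help. Smallness comes from the length of the
    segment and from the power, whose exponent is positive because Re z > 1.\<close>
  moreover have "(\<lambda>n. P (of_real (1 / (real n + 1)) * c) - P (of_real (1 / (real n + 1)) * 1)) \<longlonglongrightarrow> 0"
  proof (rule Lim_null_comparison)
    show "eventually (\<lambda>n. cmod (P (of_real (1 / (real n + 1)) * c) - P (of_real (1 / (real n + 1)) * 1)) \<le>
      (((1 / (real n + 1)) * M) powr \<alpha> * K * exp (- ((1 / (real n + 1)) * \<kappa>))) * ((1 / (real n + 1)) * cmod (c - 1))) sequentially"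
      unfolding \<alpha>_def by (intro always_eventually allI diff') simp
    have "(\<lambda>n. (((1 / (real n + 1)) * M) powr \<alpha> * exp (- ((1 / (real n + 1)) * \<kappa>))) * (1 / (real n + 1))) \<longlonglongrightarrow> 0"
      using \<alpha> \<kappa> M by real_asymp
    from tendsto_mult_right_zero[OF this, of "K * cmod (c - 1)"]
    show "(\<lambda>n. (((1 / (real n + 1)) * M) powr \<alpha> * K * exp (- ((1 / (real n + 1)) * \<kappa>))) * ((1 / (real n + 1)) * cmod (c - 1))) \<longlonglongrightarrow> 0"
      by (simp add: mult_ac)
  qed
  ultimately have "(\<lambda>n. (P (of_real (real n + 1) * c) - P (of_real (1 / (real n + 1)) * c)) -
       (P (of_real (real n + 1) * 1) - P (of_real (1 / (real n + 1)) * 1))) \<longlonglongrightarrow> 0 - 0"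
    by (rule tendsto_diff[THEN tendsto_cong[THEN iffD1, rotated]]) (simp add: algebra_simps)
  moreover have "(\<lambda>n. (P (of_real (real n + 1) * c) - P (of_real (1 / (real n + 1)) * c)) -
       (P (of_real (real n + 1) * 1) - P (of_real (1 / (real n + 1)) * 1))) \<longlonglongrightarrow>
       c powr z * (LINT r:{0<..}|lborel. f c r) - 1 powr z * (LINT r:{0<..}|lborel. f 1 r)"
    using tendsto_diff[OF lim[OF c] lim[of 1]] unfolding trunc[OF c] trunc[of 1, simplified] by simp
  ultimately have "0 - 0 = c powr z * (LINT r:{0<..}|lborel. f c r) - 1 powr z * (LINT r:{0<..}|lborel. f 1 r)"
    by (rule LIMSEQ_unique)
  then have eq: "c powr z * (LINT r:{0<..}|lborel. f c r) = (LINT r:{0<..}|lborel. f 1 r)" by simp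
  have "(LINT r:{0<..}|lborel. f 1 r) = integral {0<..} (f 1)"
    by (rule set_borel_integral_eq_integral(2)[OF integ]) simp
  also have "\<dots> = Gamma z"
    using Gamma_integral_complex'[of z] z
    by (intro integral_unique) (simp add: f_def[abs_def] exp_minus field_simps exp_of_real)
  finally have "c powr z * (LINT r:{0<..}|lborel. f c r) = Gamma z" using eq by simp
  moreover have "c powr z \<noteq> 0" using c by auto
  ultimately show "(LINT r:{0<..}|lborel. of_real r powr (z - 1) * exp (- (c * of_real r))) = Gamma z * c powr (- z)"
    unfolding f_def[symmetric] by (simp add: powr_minus field_simps)
  show "set_integrable lborel {0<..} (\<lambda>r::real. of_real r powr (z - 1) * exp (- (c * of_real r)))"
    using integ[OF c] by (simp add: f_def[abs_def])
qed

section \<open>Mellin transforms of Gaussians as Bromwich integrals\<close>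

text \<open>An inverse Laplace integral along Re q = \<kappa>; with q = exp (- pi i / 4) y it is the
  integral over y of the overview. The abscissa is an argument because every positive value serves
  and each node later takes its own.\<close>

definition bromwich :: "complex \<Rightarrow> complex \<Rightarrow> real \<Rightarrow> complex" where
  "bromwich s \<mu> \<kappa> = (LINT r::real|lborel.
     exp ((s - 1) * Ln (of_real \<kappa> + \<i> * of_real r) + of_real pi * (of_real \<kappa> + \<i> * of_real r)\<^sup>2
          - 2 * of_real pi * \<mu> * (of_real \<kappa> + \<i> * of_real r)))"

definition gauss_mellin :: "complex \<Rightarrow> complex \<Rightarrow> complex" where
  "gauss_mellin s \<mu> = (LINT x:{0<..}|lborel.
     of_real x powr (- s) * exp (- (of_real pi * (of_real x)\<^sup>2) - 2 * of_real pi * \<mu> * of_real x))"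

text \<open>Fubini for x^(-s) exp (- 2 pi q x) exp (pi q^2 - 2 pi \<mu> q) with q = \<kappa> + i r.
  The integral over r is a shifted Gaussian and gives exp (- pi (x + \<mu>)^2) for every \<kappa>;
  the integral over x gives Gamma (1 - s) (2 pi q)^(s - 1), where Re s < 0 provides Re (1 - s) >
  1.\<close>

lemma gauss_mellin_eq_bromwich:
  fixes s \<mu> :: complex
  assumes s: "Re s < 0" and \<kappa>: "\<kappa> > 0"
  shows "gauss_mellin s \<mu> = exp (of_real pi * \<mu>\<^sup>2) * Gamma (1 - s) * of_real (2 * pi) powr (s - 1) * bromwich s \<mu> \<kappa>"
proof -
  define q where "q r = of_real \<kappa> + \<i> * of_real r" for r :: real
  define a where "a x = indicat_real {0<..} x *\<^sub>R (complex_of_real x powr (- s))" for x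
  define E where "E r = exp (of_real pi * (q r)\<^sup>2 - 2 * of_real pi * \<mu> * q r)" for r
  define F where "F x r = a x * exp (- (2 * of_real pi * q r * of_real x)) * E r" for x r
  have Reg: "Re (2 * of_real pi * q r) > 0" for r using \<kappa> by (simp add: q_def)
  have z: "Re (1 - s) > 1" using s by simp
  have [measurable]: "a \<in> borel_measurable borel"
    unfolding a_def by (intro borel_measurable_continuous_on_indicator continuous_intros) (auto simp: complex_nonpos_Reals_iff)
  have [measurable]: "q \<in> borel_measurable borel"
    unfolding q_def by (intro borel_measurable_continuous_onI continuous_intros)
  have [measurable]: "E \<in> borel_measurable borel"
    unfolding E_def q_def by (intro borel_measurable_continuous_onI continuous_intros)
  have sq: "of_real pi * (q r)\<^sup>2 - 2 * of_real pi * X * q r = of_real pi * ((of_real \<kappa> - X) + \<i> * of_real r)\<^sup>2 - of_real pi * X\<^sup>2" for r and X :: complex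
    by (simp add: q_def power2_eq_square algebra_simps)
  have gauss: "integrable lborel (\<lambda>r. exp (of_real pi * (q r)\<^sup>2 - 2 * of_real pi * X * q r))"
     "(LINT r|lborel. exp (of_real pi * (q r)\<^sup>2 - 2 * of_real pi * X * q r)) = exp (- (of_real pi * X\<^sup>2))" for X
    using integral_exp_pi_shifted_square[of "of_real \<kappa> - X"]
    unfolding sq exp_diff by (auto simp: exp_minus inverse_eq_divide)
  have Eint: "integrable lborel E" unfolding E_def[abs_def] by (rule gauss)
  have gam: "integrable lborel (\<lambda>x. a x * exp (- (2 * of_real pi * q r * of_real x)))"
     "(LINT x|lborel. a x * exp (- (2 * of_real pi * q r * of_real x))) = Gamma (1 - s) * (2 * of_real pi * q r) powr (s - 1)" for r
    using Gamma_integral_scaled[OF z Reg, of r]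
    unfolding set_integrable_def set_lebesgue_integral_def a_def by simp_all
  \<comment> \<open>The modulus of exp (- 2 pi q x) depends on Re q = \<kappa> only, so the modulus
    of \<open>F\<close> is a function of x times a function of r.\<close>
  have nF: "norm (F x r) = norm (a x * exp (- (2 * of_real pi * q 0 * of_real x))) * norm (E r)" for x r
    by (simp add: F_def norm_mult q_def)
  have Fint: "integrable (lborel \<Otimes>\<^sub>M lborel) (case_prod F)"
  proof (rule lborel_pair.Fubini_integrable)
    show "case_prod F \<in> borel_measurable (lborel \<Otimes>\<^sub>M lborel)"
      unfolding F_def by measurable
    show "integrable lborel (\<lambda>x. LINT y|lborel. norm (case_prod F (x, y)))"
      unfolding split nF integral_mult_right_zero by (intro integrable_mult_left integrable_norm gam)
    have "integrable lborel (\<lambda>r. F x r)" for x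
    proof (rule Bochner_Integration.integrable_bound)
      show "integrable lborel (\<lambda>r. norm (a x * exp (- (2 * of_real pi * q 0 * of_real x))) * norm (E r))"
        by (intro integrable_mult_right integrable_norm Eint)
      show "(\<lambda>r. F x r) \<in> borel_measurable lborel" unfolding F_def by measurable
      show "AE r in lborel. norm (F x r) \<le> norm (norm (a x * exp (- (2 * of_real pi * q 0 * of_real x))) * norm (E r))"
        unfolding nF by simp
    qed
    then show "AE x in lborel. integrable lborel (\<lambda>y. case_prod F (x, y))" by simp
  qed
  have inner: "(LINT r|lborel. F x r) = exp (- (of_real pi * \<mu>\<^sup>2)) * (a x * exp (- (of_real pi * (of_real x)\<^sup>2) - 2 * of_real pi * \<mu> * of_real x))" for x
  proof -
    have "F x r = a x * exp (of_real pi * (q r)\<^sup>2 - 2 * of_real pi * (of_real x + \<mu>) * q r)" for r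
      unfolding F_def E_def mult.assoc exp_add[symmetric] by (simp add: algebra_simps)
    then have "(LINT r|lborel. F x r) = a x * exp (- (of_real pi * (of_real x + \<mu>)\<^sup>2))"
      by (simp add: gauss)
    also have "exp (- (of_real pi * (of_real x + \<mu>)\<^sup>2)) = exp (- (of_real pi * \<mu>\<^sup>2)) * exp (- (of_real pi * (of_real x)\<^sup>2) - 2 * of_real pi * \<mu> * of_real x)"
      unfolding exp_add[symmetric] by (simp add: power2_eq_square algebra_simps)
    finally show ?thesis by simp
  qed
  have "exp (- (of_real pi * \<mu>\<^sup>2)) * gauss_mellin s \<mu> = (LINT x|lborel. LINT r|lborel. F x r)"
    unfolding inner integral_mult_right_zero by (simp add: gauss_mellin_def set_lebesgue_integral_def a_def)
  also have "\<dots> = (LINT r|lborel. LINT x|lborel. F x r)"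
    by (rule lborel_pair.Fubini_integral[OF Fint, symmetric])
  also have "\<dots> = (LINT r|lborel. Gamma (1 - s) * of_real (2 * pi) powr (s - 1) * (exp ((s - 1) * Ln (q r) + of_real pi * (q r)\<^sup>2 - 2 * of_real pi * \<mu> * q r)))"
  proof (rule Bochner_Integration.integral_cong[OF refl])
    fix r
    have "q r \<noteq> 0" using Reg[of r] by auto
    then have "(2 * of_real pi * q r) powr (s - 1) = of_real (2 * pi) powr (s - 1) * exp ((s - 1) * Ln (q r))"
      using Ln_times_of_real[of "2 * pi" "q r"] by (simp add: powr_def Ln_of_real[of "2 * pi"] distrib_left exp_add)
    then show "(LINT x|lborel. F x r) = Gamma (1 - s) * of_real (2 * pi) powr (s - 1) * (exp ((s - 1) * Ln (q r) + of_real pi * (q r)\<^sup>2 - 2 * of_real pi * \<mu> * q r))"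
      by (simp add: F_def gam E_def exp_add exp_diff)
  qed
  also have "\<dots> = Gamma (1 - s) * of_real (2 * pi) powr (s - 1) * bromwich s \<mu> \<kappa>"
    by (simp add: bromwich_def q_def)
  finally have "exp (- (of_real pi * \<mu>\<^sup>2)) * gauss_mellin s \<mu> = Gamma (1 - s) * of_real (2 * pi) powr (s - 1) * bromwich s \<mu> \<kappa>" .
  then show ?thesis by (simp add: exp_minus field_simps)
qed

text \<open>After expanding the fraction by Gamma (1 - s/2) the numerator falls under the
  duplication formula and the denominator under the reflection formula; Im s nonzero keeps the
  arguments off the poles. The factor 1 - exp (pi i s) is the one that folding the line at the
  origin produces.\<close>

lemma chi_eq:
  assumes "Im s \<noteq> 0"
  shows "chi s = of_real (2 * pi) powr (s - 1) * Gamma (1 - s) * \<i> * exp (- (pi * \<i> * s / 2)) * (1 - exp (pi * \<i> * s))"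
proof -
  have nn: "z \<notin> \<int>\<^sub>\<le>\<^sub>0" if "Im z \<noteq> 0" for z :: complex
    using that by (auto elim!: nonpos_Ints_cases)
  have dup: "Gamma ((1 - s) / 2) * Gamma (1 - s / 2) = exp (s * of_real (ln 2)) * sqrt pi * Gamma (1 - s)"
  proof -
    have e: "(1 - s) / 2 + 1 / 2 = 1 - s / 2" "2 * ((1 - s) / 2) = 1 - s" 
      by (simp_all add: field_simps)
    have "(1 - s) / 2 \<notin> \<int>\<^sub>\<le>\<^sub>0" "1 - s / 2 \<notin> \<int>\<^sub>\<le>\<^sub>0" using assms by (intro nn; simp)+
    from Gamma_legendre_duplication[of "(1 - s) / 2", unfolded e, OF this] 
    show ?thesis by simp
  qed
  have nz: "Gamma (1 - s / 2) \<noteq> 0" "Gamma (s / 2) \<noteq> 0"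
    using assms nn[of "1 - s / 2"] nn[of "s / 2"] by (auto simp: Gamma_eq_zero_iff)
  have refl: "Gamma (s / 2) * Gamma (1 - s / 2) = pi / sin (pi * (s / 2))"
    by (rule Gamma_reflection_complex)
  then have sn: "sin (pi * (s / 2)) \<noteq> 0" using nz by auto
  have "chi s = of_real pi powr (s - 1 / 2) * (Gamma ((1 - s) / 2) * Gamma (1 - s / 2)) / (Gamma (s / 2) * Gamma (1 - s / 2))"
    using nz by (simp add: chi_def)
  also have "\<dots> = of_real pi powr (s - 1 / 2) * (exp (s * of_real (ln 2)) * sqrt pi * Gamma (1 - s)) * sin (pi * (s / 2)) / pi"
    unfolding dup refl using sn by simp
  also have "complex_of_real (sqrt pi) = of_real pi powr (1 / 2)"
    using powr_of_real[of pi "1/2"] by (simp add: powr_half_sqrt)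
  also have "of_real pi powr (s - 1 / 2) * (exp (s * of_real (ln 2)) * of_real pi powr (1 / 2) * Gamma (1 - s)) * sin (pi * (s / 2)) / pi
     = of_real (2 * pi) powr (s - 1) * Gamma (1 - s) * (2 * sin (pi * (s / 2)))"
  proof -
    have "complex_of_real (2 * pi) powr (s - 1) = of_real 2 powr (s - 1) * of_real pi powr (s - 1)"
      using powr_times_real[of "of_real 2" "of_real pi" "s - 1"] by simp
    also have "complex_of_real 2 powr (s - 1) = of_real 2 powr s / 2" by (simp add: powr_diff)
    also have "complex_of_real 2 powr s = exp (s * of_real (ln 2))"
      using Ln_of_real[of 2] by (simp add: powr_def)
    also have "of_real pi powr (s - 1) = complex_of_real pi powr s / pi" by (simp add: powr_diff)
    also have "complex_of_real pi powr s = of_real pi powr (s - 1 / 2) * of_real pi powr (1 / 2)"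
      by (simp flip: powr_add)
    finally have "of_real (2 * pi) powr (s - 1) =
      exp (s * of_real (ln 2)) / 2 * (of_real pi powr (s - 1 / 2) * of_real pi powr (1 / 2) / complex_of_real pi)" .
    then show ?thesis by (simp only:) simp
  qed
  also have "2 * sin (pi * (s / 2)) = \<i> * exp (- (pi * \<i> * s / 2)) * (1 - exp (pi * \<i> * s))"
  proof -
    have "exp (pi * \<i> * s) = exp (pi * \<i> * s / 2) * exp (pi * \<i> * s / 2)" by (simp add: mult_ac flip: exp_add)
    then show ?thesis by (simp only:) (simp add: sin_exp_eq exp_minus field_simps)
  qed
  finally show ?thesis by (simp add: mult_ac)
qed

section \<open>The integral through the origin\<close>

text \<open>Jordan's inequality: by concavity the sine lies above its chord on [0, pi/2].\<close>

lemma sin_pi_ge_double: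
  fixes y :: real
  assumes "0 \<le> y" "y \<le> 1 / 2"
  shows "sin (pi * y) \<ge> 2 * y"
proof -
  have "convex_on {0..pi} (\<lambda>x. - sin x)"
    by (rule f''_ge0_imp_convex[where f' = "\<lambda>x. - cos x" and f'' = sin])
       (auto intro!: derivative_eq_intros sin_ge_zero)
  from convex_onD[OF this, of "2 * y" 0 "pi / 2"] assms show ?thesis
    by (simp add: mult.commute)
qed

lemma cmod_sin_squared:
  "(cmod (sin z))\<^sup>2 = (sin (Re z))\<^sup>2 + (sinh (Im z))\<^sup>2"
proof -
  have "cos (2 * Re z) = 1 - 2 * (sin (Re z))\<^sup>2" by (simp add: cos_double_sin)
  moreover have "(sinh (Im z))\<^sup>2 = (exp (2 * Im z) + inverse (exp (2 * Im z)) - 2) / 4"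
    by (simp add: sinh_def power2_eq_square field_simps exp_minus flip: exp_add)
  ultimately show ?thesis unfolding norm_sin_squared by simp
qed

lemma abs_le_abs_sinh: "\<bar>x\<bar> \<le> \<bar>sinh (x::real)\<bar>"
  using real_le_abs_sinh[of x] by (simp add: sinh_def exp_minus)

text \<open>The strip lies between the lines of direction \<open>omega_dir\<close> through 0 and
  1/2, and its only zero of sin (pi x) is 0. If |Im x| <= 1/4, then Re x <= 3/4 stays clear of the
  zero 1, and real and imaginary parts are compared separately. Otherwise |Re x| <= 3 |Im x| and
  sinh alone suffices.\<close>

lemma cmod_sin_pi_ge:
  fixes x :: complex
  assumes "0 \<le> Re x - Im x" "Re x - Im x \<le> 1 / 2"
  shows "cmod (sin (pi * x)) \<ge> cmod x / 2"
proof (cases "\<bar>Im x\<bar> \<le> 1 / 4")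
  case True
  define y where "y = Re x"
  have "\<bar>sin (pi * y)\<bar> \<ge> \<bar>y\<bar> / 2"
  proof -
    consider "0 \<le> y" "y \<le> 1/2" | "y < 0" "- y \<le> 1/2" | "1/2 \<le> y" "y \<le> 3/4"
      using True assms unfolding y_def by linarith
    then show ?thesis
    proof cases
      case 1 then show ?thesis using sin_pi_ge_double[of y] by simp
    next
      case 2 then show ?thesis using sin_pi_ge_double[of "- y"] by simp
    next
      case 3
      have "sin (pi * y) = sin (pi * (1 - y))" by (simp add: right_diff_distrib sin_diff)
      then show ?thesis using 3 sin_pi_ge_double[of "1 - y"] by simp
    qed
  qed
  then have "(\<bar>y\<bar> / 2)\<^sup>2 \<le> (sin (pi * y))\<^sup>2" by (simp flip: abs_le_square_iff)
  moreover have "\<bar>Im x / 2\<bar> \<le> \<bar>sinh (pi * Im x)\<bar>"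
  proof -
    have "\<bar>Im x / 2\<bar> \<le> pi * \<bar>Im x\<bar>" using pi_gt3 by (simp add: mult_right_mono[of "1/2" pi, simplified])
    also have "\<dots> \<le> \<bar>sinh (pi * Im x)\<bar>" using abs_le_abs_sinh[of "pi * Im x"] by (simp add: abs_mult)
    finally show ?thesis .
  qed
  then have "(Im x / 2)\<^sup>2 \<le> (sinh (pi * Im x))\<^sup>2" by (simp only: abs_le_square_iff)
  ultimately have "(cmod x / 2)\<^sup>2 \<le> (cmod (sin (pi * x)))\<^sup>2"
    unfolding cmod_sin_squared by (simp add: y_def cmod_power2 power_divide)
  then show ?thesis by (rule power2_le_imp_le) simp
next
  case False
  have "cmod x \<le> \<bar>Re x\<bar> + \<bar>Im x\<bar>" by (rule cmod_le)
  also have "\<dots> \<le> 4 * \<bar>Im x\<bar>" using False assms by linarith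
  finally have "cmod x / 2 \<le> 2 * \<bar>Im x\<bar>" by simp
  also have "\<dots> \<le> pi * \<bar>Im x\<bar>" using pi_gt3 by (intro mult_right_mono) auto
  also have "\<dots> \<le> \<bar>sinh (pi * Im x)\<bar>" using abs_le_abs_sinh[of "pi * Im x"] by (simp add: abs_mult)
  also have "\<dots> \<le> cmod (sin (pi * x))"
  proof (rule power2_le_imp_le)
    show "\<bar>sinh (pi * Im x)\<bar>\<^sup>2 \<le> (cmod (sin (pi * x)))\<^sup>2" unfolding cmod_sin_squared by simp
  qed simp
  finally show ?thesis .
qed

lemma R_integrand_eq:
  fixes s x :: complex
  shows "R_integrand s x = x powr (- s) * exp (pi * \<i> * x\<^sup>2) / (2 * \<i> * sin (pi * x))"
proof -
  have "exp (pi * \<i> * x) - exp (- pi * \<i> * x) = 2 * \<i> * sin (pi * x)"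
    by (simp add: sin_exp_eq field_simps)
  then show ?thesis unfolding R_integrand_def by simp
qed

text \<open>The majorant is uniform up to the edge of the strip through 0: since - Re s >= 1, one
  factor |x| pays for 1 / sin (pi x), and the remaining power is at most exponential in |Im x|,
  which the Gaussian absorbs. At x = 0 the integrand is 0, being a quotient by 0.\<close>

lemma cmod_R_integrand_le:
  fixes s x :: complex
  assumes s: "Re s \<le> -1" and x: "0 \<le> Re x - Im x" "Re x - Im x \<le> 1 / 2"
  shows "cmod (R_integrand s x) \<le> exp (pi * \<bar>Im s\<bar> + (3 - Re s)\<^sup>2 / 2) * exp (- 4 * (Im x)\<^sup>2)"
proof (cases "x = 0")
  case False
  define v where "v = \<bar>Im x\<bar>"
  define b where "b = - Re s - 1"
  have b: "b \<ge> 0" using s by (simp add: b_def)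
  have "cmod x \<le> \<bar>Re x\<bar> + \<bar>Im x\<bar>" by (rule cmod_le)
  also have "\<dots> \<le> 1 + 2 * v" using x by (auto simp: v_def)
  finally have xv: "cmod x \<le> 1 + 2 * v" .
  have "cmod x powr b \<le> (1 + 2 * v) powr b" using xv b by (intro powr_mono2) auto
  also have "\<dots> \<le> exp (2 * v) powr b" using b by (intro powr_mono2) (auto simp: v_def)
  also have "\<dots> = exp (2 * b * v)" by (simp add: powr_def)
  finally have xb: "cmod x powr b \<le> exp (2 * b * v)" .
  have sn: "cmod x \<le> 2 * cmod (sin (pi * x))" using cmod_sin_pi_ge[OF x] by simp
  have sn0: "cmod (sin (pi * x)) > 0"
    using sn False by (smt (verit) zero_less_norm_iff norm_ge_zero)
  have re: "Re (pi * \<i> * x\<^sup>2) \<le> - 2 * pi * v\<^sup>2 + pi * v"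
  proof -
    have "Re (pi * \<i> * x\<^sup>2) = - 2 * pi * (Re x * Im x)" by (simp add: power2_eq_square)
    also have "\<dots> = - 2 * pi * v\<^sup>2 + 2 * pi * ((Re x - Im x) * (- Im x))"
      by (simp add: v_def power2_eq_square algebra_simps)
    also have "(Re x - Im x) * (- Im x) \<le> (1 / 2) * v"
    proof -
      have "(Re x - Im x) * (- Im x) \<le> (Re x - Im x) * v"
        using x by (intro mult_left_mono) (auto simp: v_def)
      also have "\<dots> \<le> (1 / 2) * v" using x by (intro mult_right_mono) (auto simp: v_def)
      finally show ?thesis .
    qed
    finally show ?thesis by simp
  qed
  have "cmod (R_integrand s x) = cmod (x powr (- s)) * exp (Re (pi * \<i> * x\<^sup>2)) / (2 * cmod (sin (pi * x)))"
    by (simp add: R_integrand_eq norm_mult norm_divide)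
  also have "\<dots> \<le> (cmod x powr Re (- s) * exp (pi * \<bar>Im (- s)\<bar>)) * exp (- 2 * pi * v\<^sup>2 + pi * v) / cmod x"
    using sn False re by (intro frac_le mult_mono cmod_powr_le) auto
  also have "\<dots> = cmod x powr b * exp (pi * \<bar>Im s\<bar>) * exp (- 2 * pi * v\<^sup>2 + pi * v)"
  proof -
    have "cmod x powr Re (- s) = cmod x powr b * cmod x"
      using False powr_add[of "cmod x" b 1] by (simp add: b_def)
    then show ?thesis using False by simp
  qed
  also have "\<dots> \<le> exp (2 * b * v) * exp (pi * \<bar>Im s\<bar>) * exp (- 2 * pi * v\<^sup>2 + pi * v)"
    by (intro mult_right_mono xb) auto
  also have "\<dots> = exp (pi * \<bar>Im s\<bar> + (2 * b * v - 2 * pi * v\<^sup>2 + pi * v))"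
    by (simp flip: exp_add)
  also have "\<dots> \<le> exp (pi * \<bar>Im s\<bar> + (3 - Re s)\<^sup>2 / 2 - 4 * v\<^sup>2)"
  proof -
    have "pi * v \<le> 4 * v" using pi_less_4 by (intro mult_right_mono) (auto simp: v_def)
    moreover have "3 * v\<^sup>2 \<le> pi * v\<^sup>2" using pi_gt3 by (intro mult_right_mono) auto
    \<comment> \<open>This square bounds 2 (b + 2) v - 2 v^2 by (b + 2)^2 / 2, once pi has been
      replaced by 4 in the linear and by 3 in the quadratic term.\<close>
    moreover have "0 \<le> (2 * v - (b + 2))\<^sup>2" by simp
    moreover have "(b + 2)\<^sup>2 \<le> (b + 4)\<^sup>2" using b by (intro power_mono) auto
    ultimately have "2 * b * v - 2 * pi * v\<^sup>2 + pi * v \<le> (b + 4)\<^sup>2 / 2 - 4 * v\<^sup>2"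
      by (simp add: power2_eq_square algebra_simps)
    moreover have "b + 4 = 3 - Re s" by (simp add: b_def)
    ultimately show ?thesis by simp
  qed
  also have "\<dots> = exp (pi * \<bar>Im s\<bar> + (3 - Re s)\<^sup>2 / 2) * exp (- 4 * (Im x)\<^sup>2)"
    by (simp add: v_def flip: exp_add)
  finally show ?thesis .
qed (simp add: R_integrand_def)

lemma integrable_exp_neg_square:
  fixes c :: real
  assumes "c > 0"
  shows "integrable lborel (\<lambda>r. exp (- (c * r\<^sup>2)))"
proof -
  have "integrable lborel (\<lambda>r. norm (exp (pi * (0 + \<i> * of_real r)\<^sup>2)))"
    by (intro integrable_norm integral_exp_pi_shifted_square)
  then have "integrable lborel (\<lambda>r. exp (- (pi * r\<^sup>2)))"
    by (simp add: power2_eq_square)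
  from lborel_integrable_real_affine[OF this, of "sqrt (c / pi)" 0] assms show ?thesis
    by (simp add: power_mult_distrib)
qed

lemma omega_dir_eq: "omega_dir = Complex (- (sqrt 2 / 2)) (- (sqrt 2 / 2))"
proof -
  have "omega_dir = cis (pi / 4 - pi)" by (simp add: omega_dir_def cis_conv_exp field_simps)
  also have "\<dots> = Complex (- (sqrt 2 / 2)) (- (sqrt 2 / 2))"
  proof -
    have "cos (pi / 4 - pi) = - (sqrt 2 / 2)" unfolding cos_diff by (simp add: cos_45)
    moreover have "sin (pi / 4 - pi) = - (sqrt 2 / 2)" unfolding sin_diff by (simp add: sin_45)
    ultimately show ?thesis by (simp only: complex_eq_iff cis.sel complex.sel)
  qed
  finally show ?thesis .
qed

text \<open>Re x - Im x is constant in direction \<open>omega_dir\<close>, so it labels the parallel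
  lines by their crossing with the real axis.\<close>

lemma Re_Im_line:
  "Re (of_real a + of_real u * omega_dir) - Im (of_real a + of_real u * omega_dir) = a"
  "Im (of_real a + of_real u * omega_dir) = - (u * (sqrt 2 / 2))"
  by (simp_all add: omega_dir_eq)

lemma cmod_R_integrand_line_le:
  fixes s :: complex
  assumes "Re s \<le> -1" and "0 \<le> a" "a \<le> 1 / 2"
  shows "cmod (R_integrand s (of_real a + of_real u * omega_dir)) \<le>
    exp (pi * \<bar>Im s\<bar> + (3 - Re s)\<^sup>2 / 2) * exp (- (2 * u\<^sup>2))"
proof -
  have "4 * (Im (of_real a + of_real u * omega_dir))\<^sup>2 = 2 * u\<^sup>2"
    unfolding Re_Im_line by (simp add: power_mult_distrib power_divide)
  with cmod_R_integrand_le[OF assms(1), of "of_real a + of_real u * omega_dir", unfolded Re_Im_line(1), OF assms(2,3)]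
  show ?thesis by (simp only: mult_minus_left)
qed

lemma sin_pi_nonzero:
  fixes x :: complex
  assumes "x \<notin> \<int>"
  shows "sin (pi * x) \<noteq> 0"
proof
  assume "sin (pi * x) = 0"
  then obtain n :: int where "pi * x = of_real (n * pi)" by (auto simp: sin_eq_0)
  then have "x = of_int n" by (simp add: mult.commute)
  with assms show False by auto
qed

lemma isCont_R_integrand:
  assumes "x \<notin> \<real>\<^sub>\<le>\<^sub>0" "x \<notin> \<int>"
  shows "isCont (R_integrand s) x"
proof -
  have "sin (pi * x) \<noteq> 0" using assms by (intro sin_pi_nonzero)
  then show ?thesis unfolding R_integrand_eq[abs_def] using assms by (intro continuous_intros) auto
qed

text \<open>In the open strip 0 < Re x - Im x < 1 the integrand has a primitive, so truncated
  integrals over parallel lines differ by horizontal end segments only, and these are small like a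
  Gaussian. The line through 0 bounds the strip, out of reach of the primitive, and is attained by
  dominated convergence.\<close>

lemma riemann_R_through_origin:
  fixes s :: complex
  assumes s: "Re s \<le> -1"
  shows "integrable lborel (\<lambda>u. R_integrand s (of_real u * omega_dir) * omega_dir)"
    and "riemann_R s = (LINT u|lborel. R_integrand s (of_real u * omega_dir) * omega_dir)"
proof -
  define K where "K = exp (pi * \<bar>Im s\<bar> + (3 - Re s)\<^sup>2 / 2)"
  define f where "f a u = R_integrand s (of_real a + of_real u * omega_dir) * omega_dir" for a u :: real
  have w: "cmod omega_dir = 1" by (simp add: omega_dir_def)
  have bd: "cmod (f a u) \<le> K * exp (- (2 * u\<^sup>2))" if "0 \<le> a" "a \<le> 1/2" for a u
    unfolding f_def K_def using cmod_R_integrand_line_le[OF s that, of u] by (simp add: norm_mult w)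
  have Wint: "integrable lborel (\<lambda>u. K * exp (- (2 * u\<^sup>2)))"
    by (intro integrable_mult_right integrable_exp_neg_square) simp
  have notin: "x \<notin> \<real>\<^sub>\<le>\<^sub>0" "x \<notin> \<int>" if "0 < Re x - Im x" "Re x - Im x < 1" for x
    using that by (auto simp: complex_nonpos_Reals_iff elim!: Ints_cases)
  have notin0: "of_real u * omega_dir \<notin> \<real>\<^sub>\<le>\<^sub>0" "of_real u * omega_dir \<notin> \<int>" if "u \<noteq> 0" for u :: real
  proof -
    have "Im (of_real u * omega_dir) \<noteq> 0" using that by (simp add: omega_dir_eq)
    then show "of_real u * omega_dir \<notin> \<real>\<^sub>\<le>\<^sub>0" "of_real u * omega_dir \<notin> \<int>"
      by (auto simp: complex_nonpos_Reals_iff complex_is_Int_iff)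
  qed
  have cont: "continuous_on UNIV (f a)" if "0 < a" "a < 1" for a
  proof -
    have "isCont (\<lambda>u. R_integrand s (of_real a + of_real u * omega_dir)) u" for u
      by (rule isCont_o2[where g = "R_integrand s"])
         (intro continuous_intros isCont_R_integrand notin; use that in \<open>simp only: Re_Im_line(1)\<close>)+
    then show ?thesis unfolding f_def by (intro continuous_at_imp_continuous_on ballI continuous_intros)
  qed
  have meas: "f a \<in> borel_measurable lborel" if "0 < a" "a < 1" for a
    using borel_measurable_continuous_onI[OF cont[OF that]] by simp
  \<comment> \<open>At u = 0 this line meets the branch point. The value there is 0, so cutting the
    point out changes nothing.\<close>
  have meas0: "f 0 \<in> borel_measurable lborel"
  proof -
    have "(\<lambda>u. indicat_real (- {0}) u *\<^sub>R f 0 u) \<in> borel_measurable borel"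
    proof (rule borel_measurable_continuous_on_indicator)
      have "isCont (\<lambda>u. R_integrand s (of_real u * omega_dir)) u" if "u \<noteq> 0" for u
        by (rule isCont_o2[where g = "R_integrand s"])
           (intro continuous_intros isCont_R_integrand notin0 that)+
      then show "continuous_on (- {0}) (f 0)"
        unfolding f_def by (auto intro!: continuous_at_imp_continuous_on continuous_intros)
    qed auto
    moreover have "(\<lambda>u. indicat_real (- {0}) u *\<^sub>R f 0 u) = f 0"
      by (auto simp: fun_eq_iff indicator_def f_def R_integrand_def)
    ultimately show ?thesis by simp
  qed
  have int: "integrable lborel (f a)" if "0 \<le> a" "a \<le> 1 / 2" for a
  proof (rule Bochner_Integration.integrable_bound[OF Wint])
    show "f a \<in> borel_measurable lborel" using meas[of a] meas0 that by (cases "a = 0") auto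
    show "AE u in lborel. norm (f a u) \<le> norm (K * exp (- (2 * u\<^sup>2)))"
      using bd[OF that] by (auto simp: K_def)
  qed
  show "integrable lborel (\<lambda>u. R_integrand s (of_real u * omega_dir) * omega_dir)"
    using int[of 0] by (simp add: f_def[abs_def])
  let ?S = "{x. 0 < Re x - Im x} \<inter> {x. Re x - Im x < 1}"
  have S: "?S = {x. inner (Complex 1 (-1)) x > 0} \<inter> {x. inner (Complex 1 (-1)) x < 1}"
    by (simp add: inner_complex_def)
  have "open ?S" "convex ?S" unfolding S
    by (intro open_Int open_halfspace_gt open_halfspace_lt convex_Int convex_halfspace_gt convex_halfspace_lt)+
  moreover have "R_integrand s holomorphic_on ?S"
  proof -
    have "exp (pi * \<i> * x) - exp (- pi * \<i> * x) \<noteq> 0" if "x \<in> ?S" for x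
    proof -
      have "sin (pi * x) \<noteq> 0" using notin[of x] that by (intro sin_pi_nonzero) auto
      then show ?thesis by (simp add: sin_exp_eq mult_ac)
    qed
    then show ?thesis unfolding R_integrand_def[abs_def]
      using notin by (intro holomorphic_intros) auto
  qed
  ultimately obtain P where P: "\<And>x. x \<in> ?S \<Longrightarrow> (P has_field_derivative R_integrand s x) (at x within ?S)"
    using holomorphic_convex_primitive'[of ?S "R_integrand s"] by blast
  have P': "(P has_field_derivative R_integrand s x) (at x)" if "x \<in> ?S" for x
    using P[OF that] at_within_open[OF that \<open>open ?S\<close>] by simp
  have prim: "integral {- real n..real n} (f a) =
      P (of_real a + of_real (real n) * omega_dir) - P (of_real a + of_real (- real n) * omega_dir)"
    if "0 < a" "a < 1" for a n
    unfolding f_def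
  proof (rule integral_line_primitive)
    fix u
    show "(P has_field_derivative R_integrand s (of_real a + of_real u * omega_dir)) (at (of_real a + of_real u * omega_dir))"
      by (rule P') (use that in \<open>simp only: Re_Im_line(1) Int_iff mem_Collect_eq\<close>)
  qed simp
  \<comment> \<open>One sequence drives both limits, the line approaching 0 and the growing
    truncation. The summand 2 keeps it in (0, 1/2], where the majorant holds.\<close>
  define \<alpha> where "\<alpha> n = 1 / (real n + 2)" for n
  have \<alpha>: "0 < \<alpha> n" "\<alpha> n \<le> 1 / 2" for n by (auto simp: \<alpha>_def field_simps)
  have seg: "cmod (P (of_real a + of_real u * omega_dir) - P (of_real (1 / 2) + of_real u * omega_dir)) \<le> K * exp (- (2 * u\<^sup>2))"
    if "0 < a" "a \<le> 1 / 2" for a u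
  proof -
    have "cmod (P (of_real a + of_real u * omega_dir) - P (of_real (1 / 2) + of_real u * omega_dir)) \<le>
       (K * exp (- (2 * u\<^sup>2))) * cmod ((of_real a + of_real u * omega_dir) - (of_real (1 / 2) + of_real u * omega_dir))"
    proof (rule field_differentiable_bound[where S = "(\<lambda>b. of_real b + of_real u * omega_dir) ` {a..1/2}"])
      have "(\<lambda>b. of_real b + of_real u * omega_dir) ` {a..1/2} = (\<lambda>x. of_real u * omega_dir + x) ` (complex_of_real ` {a..1/2})"
        by (simp add: image_image add.commute)
      then show "convex ((\<lambda>b. of_real b + of_real u * omega_dir) ` {a..1/2})"
        by (simp only:) (intro convex_translation convex_linear_image bounded_linear.linear[OF bounded_linear_of_real] convex_real_interval)
      show "(P has_field_derivative R_integrand s x) (at x within (\<lambda>b. of_real b + of_real u * omega_dir) ` {a..1/2})"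
        if x: "x \<in> (\<lambda>b. of_real b + of_real u * omega_dir) ` {a..1/2}" for x
      proof -
        from x obtain b where b: "x = of_real b + of_real u * omega_dir" "a \<le> b" "b \<le> 1/2" by auto
        have "x \<in> ?S" unfolding b(1) Int_iff mem_Collect_eq Re_Im_line(1) using b \<open>0 < a\<close> by simp
        then show ?thesis by (rule has_field_derivative_at_within[OF P'])
      qed
      show "cmod (R_integrand s x) \<le> K * exp (- (2 * u\<^sup>2))"
        if x: "x \<in> (\<lambda>b. of_real b + of_real u * omega_dir) ` {a..1/2}" for x
        using x cmod_R_integrand_line_le[OF s] \<open>0 < a\<close> unfolding K_def by auto
    qed (rule imageI, use that in simp)+
    also have "cmod ((of_real a + of_real u * omega_dir) - (of_real (1 / 2) + of_real u * omega_dir)) = 1 / 2 - a"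
      unfolding add_diff_cancel_right of_real_diff[symmetric] norm_of_real using that by simp
    also have "(K * exp (- (2 * u\<^sup>2))) * (1 / 2 - a) \<le> (K * exp (- (2 * u\<^sup>2))) * 1"
      using that by (intro mult_left_mono) (auto simp: K_def)
    finally show ?thesis by simp
  qed
  have diff0: "(\<lambda>n. integral {- real n..real n} (f (\<alpha> n)) - integral {- real n..real n} (f (1/2))) \<longlonglongrightarrow> 0"
  proof (rule Lim_null_comparison)
    show "eventually (\<lambda>n. norm (integral {- real n..real n} (f (\<alpha> n)) - integral {- real n..real n} (f (1/2)))
       \<le> 2 * K * exp (- (2 * (real n)\<^sup>2))) sequentially"
    proof (intro always_eventually allI)
      fix n
      have a1: "\<alpha> n < 1" using \<alpha>[of n] by simp
      show "norm (integral {- real n..real n} (f (\<alpha> n)) - integral {- real n..real n} (f (1/2)))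
       \<le> 2 * K * exp (- (2 * (real n)\<^sup>2))"
        using norm_triangle_ineq4[of "P (of_real (\<alpha> n) + of_real (real n) * omega_dir) - P (of_real (1/2) + of_real (real n) * omega_dir)"
            "P (of_real (\<alpha> n) + of_real (- real n) * omega_dir) - P (of_real (1/2) + of_real (- real n) * omega_dir)"]
          seg[OF \<alpha>, of n "real n"] seg[OF \<alpha>, of n "- real n"]
        unfolding prim[OF \<alpha>(1) a1] prim[of "1/2", simplified] by (simp add: algebra_simps)
    qed
    have "(\<lambda>n. exp (- (2 * (real n)\<^sup>2))) \<longlonglongrightarrow> 0" by real_asymp
    from tendsto_mult_right_zero[OF this, of "2 * K"]
    show "(\<lambda>n. 2 * K * exp (- (2 * (real n)\<^sup>2))) \<longlonglongrightarrow> 0" by simp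
  qed
  have ev: "eventually (\<lambda>n. u \<in> {- real n..real n}) sequentially" for u
  proof -
    have "eventually (\<lambda>n. \<bar>u\<bar> \<le> real n) sequentially" by real_asymp
    then show ?thesis by eventually_elim auto
  qed
  have lim_half: "(\<lambda>n. integral {- real n..real n} (f (1/2))) \<longlonglongrightarrow> (LINT u:UNIV|lborel. f (1/2) u)"
    by (rule truncated_integral_limit) (use int[of "1/2"] ev in \<open>auto simp: set_integrable_def\<close>)
  have lim0: "(\<lambda>n. LINT u:{- real n..real n}|lborel. f (\<alpha> n) u) \<longlonglongrightarrow> (LINT u|lborel. f 0 u)"
    unfolding set_lebesgue_integral_def
  proof (rule integral_dominated_convergence[OF meas0 _ Wint])
    show "(\<lambda>u. indicat_real {- real n..real n} u *\<^sub>R f (\<alpha> n) u) \<in> borel_measurable lborel" for n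
    proof -
      have [measurable]: "f (\<alpha> n) \<in> borel_measurable lborel" using \<alpha>[of n] by (intro meas) auto
      show ?thesis by measurable
    qed
    show "AE u in lborel. (\<lambda>n. indicat_real {- real n..real n} u *\<^sub>R f (\<alpha> n) u) \<longlonglongrightarrow> f 0 u"
    proof -
      have "(\<lambda>n. indicat_real {- real n..real n} u *\<^sub>R f (\<alpha> n) u) \<longlonglongrightarrow> f 0 u" if "u \<noteq> 0" for u
      proof -
        have "\<alpha> \<longlonglongrightarrow> 0" unfolding \<alpha>_def by real_asymp
        then have "(\<lambda>n. of_real (\<alpha> n) + of_real u * omega_dir) \<longlonglongrightarrow> of_real 0 + of_real u * omega_dir"
          by (intro tendsto_intros)
        then have "(\<lambda>n. R_integrand s (of_real (\<alpha> n) + of_real u * omega_dir)) \<longlonglongrightarrow> R_integrand s (of_real 0 + of_real u * omega_dir)"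
          by (intro isCont_tendsto_compose[OF isCont_R_integrand]) (use notin0[OF that] in auto)
        then have *: "(\<lambda>n. f (\<alpha> n) u) \<longlonglongrightarrow> f 0 u" unfolding f_def by (intro tendsto_intros) simp
        show ?thesis
          by (rule Lim_transform_eventually[OF *], use ev[of u] in eventually_elim) auto
      qed
      moreover have "AE u in lborel. u \<noteq> (0::real)" by (rule AE_lborel_singleton)
      ultimately show ?thesis by (auto elim: eventually_mono)
    qed
    show "AE u in lborel. norm (indicat_real {- real n..real n} u *\<^sub>R f (\<alpha> n) u) \<le> K * exp (- (2 * u\<^sup>2))" for n
      using bd[of "\<alpha> n"] \<alpha>[of n] by (intro AE_I2) (auto simp: indicator_def K_def)
  qed
  have eqn: "(LINT u:{- real n..real n}|lborel. f (\<alpha> n) u) = integral {- real n..real n} (f (\<alpha> n))" for n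
  proof (rule set_borel_integral_eq_integral(2))
    show "set_integrable lborel {- real n..real n} (f (\<alpha> n))"
      unfolding set_integrable_def using int[of "\<alpha> n"] \<alpha>[of n] by (intro integrable_mult_indicator) auto
  qed
  have "(\<lambda>n. integral {- real n..real n} (f (\<alpha> n)) - integral {- real n..real n} (f (1/2))) \<longlonglongrightarrow>
      (LINT u|lborel. f 0 u) - (LINT u:UNIV|lborel. f (1/2) u)"
    by (rule tendsto_diff[OF lim0[unfolded eqn] lim_half])
  from LIMSEQ_unique[OF diff0 this] have "(LINT u|lborel. f 0 u) = (LINT u|lborel. f (1/2) u)"
    by (simp add: set_lebesgue_integral_def)
  also have "\<dots> = riemann_R s"
    using integral_lborel[OF int[of "1/2"], symmetric] by (simp add: riemann_R_def f_def[abs_def])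
  finally show "riemann_R s = (LINT u|lborel. R_integrand s (of_real u * omega_dir) * omega_dir)"
    by (simp add: f_def)
qed

section \<open>Geometric expansion over the half-integer nodes\<close>

definition node :: "nat \<Rightarrow> complex" where
  "node k = of_real (real k + 1 / 2) * cis (- pi / 4)"

lemma omega_dir_cis: "omega_dir = - cis (pi / 4)"
  by (simp add: omega_dir_eq complex_eq_iff cos_45 sin_45)

text \<open>The two half-lines have arguments pi/4 and - 3 pi/4 and the integrand is odd apart from
  the power, so they differ by the factor - exp (pi i s). On the ray w / (1 - w^2) is the sum of the
  w^(2k+1), and w^(2k+1) = exp (- 2 pi \<open>node k\<close> \<rho>) explains the nodes. The partial
  sums G (1 - w^(2n)) are dominated by 2 |G|, even near the origin, where |w| tends to 1.\<close>

lemma riemann_R_sums_gauss_mellin: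
  fixes s :: complex
  assumes s: "Re s \<le> -1"
  shows "\<exists>X. (\<lambda>k. gauss_mellin s (node k)) sums X \<and>
     riemann_R s = (1 - exp (pi * \<i> * s)) * exp (\<i> * pi * (1 - s) / 4) * X"
proof -
  define f where "f u = R_integrand s (of_real u * omega_dir) * omega_dir" for u :: real
  define w where "w \<rho> = exp (pi * \<i> * (of_real \<rho> * cis (pi / 4)))" for \<rho> :: real
  define h where "h k \<rho> = of_real \<rho> powr (- s) * exp (- (of_real pi * (of_real \<rho>)\<^sup>2) - 2 * of_real pi * node k * of_real \<rho>)"
    for k and \<rho> :: real
  define G where "G \<rho> = of_real \<rho> powr (- s) * exp (- (of_real pi * (of_real \<rho>)\<^sup>2)) * (w \<rho> / (1 - (w \<rho>)\<^sup>2))" for \<rho> :: real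
  have fint: "integrable lborel f" and Rf: "riemann_R s = (LINT u|lborel. f u)"
    unfolding f_def using riemann_R_through_origin[OF s] by auto
  have w1: "cmod (w \<rho>) < 1" if "\<rho> > 0" for \<rho>
    using that by (simp add: w_def sin_45)
  have w2: "(w \<rho>)\<^sup>2 \<noteq> 1" if "\<rho> > 0" for \<rho>
  proof
    assume "(w \<rho>)\<^sup>2 = 1"
    then have "cmod (w \<rho>) ^ 2 = 1" by (simp flip: norm_power)
    moreover have "cmod (w \<rho>) ^ 2 < 1" using w1[OF that] by (simp add: power_less_one_iff)
    ultimately show False by simp
  qed
  have cis2: "(cis (pi / 4))\<^sup>2 = \<i>" by (simp add: cis_mult power2_eq_square)
  have fneg: "f (- \<rho>) = exp (\<i> * pi * (1 - s) / 4) * G \<rho>"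
    and fpos: "f \<rho> = - exp (pi * \<i> * s) * (exp (\<i> * pi * (1 - s) / 4) * G \<rho>)" if "\<rho> > 0" for \<rho>
  proof -
    let ?c = "cis (pi / 4)"
    have Ln1: "Ln (of_real \<rho> * ?c) = of_real (ln \<rho>) + \<i> * (pi / 4)"
      using that by (simp add: Ln_times_of_real Ln_of_real cis_conv_exp)
    have Ln2: "Ln (of_real \<rho> * omega_dir) = of_real (ln \<rho>) - \<i> * (3 * pi / 4)"
    proof -
      have "Ln omega_dir = - (\<i> * (3 * pi / 4))"
        unfolding omega_dir_def by (subst Ln_exp) (auto simp: field_simps)
      moreover have "omega_dir \<noteq> 0" by (simp add: omega_dir_def)
      ultimately show ?thesis using that by (simp add: Ln_times_of_real Ln_of_real)
    qed
    have sq: "exp (pi * \<i> * (of_real \<rho> * ?c)\<^sup>2) = exp (- (of_real pi * (of_real \<rho>)\<^sup>2))"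
      unfolding power_mult_distrib cis2 by (simp add: mult_ac)
    have den: "exp (pi * \<i> * (of_real \<rho> * ?c)) - exp (- pi * \<i> * (of_real \<rho> * ?c)) = - ((1 - (w \<rho>)\<^sup>2) / w \<rho>)"
      by (simp add: w_def exp_minus field_simps power2_eq_square)
    have nz: "?c \<noteq> 0" "of_real \<rho> * ?c \<noteq> 0" "omega_dir \<noteq> 0" using that by (auto simp: omega_dir_def)
    have wn: "w \<rho> \<noteq> 0" by (simp add: w_def)
    have p: "of_real \<rho> powr (- s) = exp (- s * of_real (ln \<rho>))" using that by (simp add: powr_def Ln_of_real)
    have "R_integrand s (of_real \<rho> * ?c) = exp (- s * (of_real (ln \<rho>) + \<i> * (pi / 4))) * exp (- (of_real pi * (of_real \<rho>)\<^sup>2)) * - (w \<rho> / (1 - (w \<rho>)\<^sup>2))"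
      unfolding R_integrand_def sq den using nz by (simp add: powr_def Ln1)
    also have "exp (- s * (of_real (ln \<rho>) + \<i> * (pi / 4))) = exp (- (\<i> * pi * s / 4)) * of_real \<rho> powr (- s)"
      unfolding p exp_add[symmetric] by (simp add: algebra_simps)
    finally have R1: "R_integrand s (of_real \<rho> * ?c) = - (exp (- (\<i> * pi * s / 4)) * G \<rho>)"
      by (simp add: G_def)
    have e: "exp (- (\<i> * pi * s / 4)) * ?c = exp (\<i> * pi * (1 - s) / 4)"
      unfolding cis_conv_exp exp_add[symmetric] by (simp add: field_simps)
    show "f (- \<rho>) = exp (\<i> * pi * (1 - s) / 4) * G \<rho>"
      using R1 unfolding f_def omega_dir_cis e[symmetric] by simp
    have "R_integrand s (of_real \<rho> * omega_dir) = exp (- s * (of_real (ln \<rho>) - \<i> * (3 * pi / 4))) * exp (- (of_real pi * (of_real \<rho>)\<^sup>2)) * (w \<rho> / (1 - (w \<rho>)\<^sup>2))"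
    proof -
      have "exp (pi * \<i> * (of_real \<rho> * omega_dir)) - exp (- pi * \<i> * (of_real \<rho> * omega_dir)) = (1 - (w \<rho>)\<^sup>2) / w \<rho>"
        using den unfolding omega_dir_cis by (simp add: algebra_simps)
      moreover have "exp (pi * \<i> * (of_real \<rho> * omega_dir)\<^sup>2) = exp (- (of_real pi * (of_real \<rho>)\<^sup>2))"
        using sq unfolding omega_dir_cis by simp
      moreover have "of_real \<rho> * omega_dir \<noteq> 0" using nz that by simp
      ultimately show ?thesis unfolding R_integrand_def by (simp add: powr_def Ln2)
    qed
    also have "exp (- s * (of_real (ln \<rho>) - \<i> * (3 * pi / 4))) = exp (pi * \<i> * s) * (exp (- (\<i> * pi * s / 4)) * of_real \<rho> powr (- s))"
      unfolding p exp_add[symmetric] by (simp add: field_simps)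
    finally have R2: "R_integrand s (of_real \<rho> * omega_dir) = exp (pi * \<i> * s) * (exp (- (\<i> * pi * s / 4)) * G \<rho>)"
      by (simp add: G_def)
    show "f \<rho> = - exp (pi * \<i> * s) * (exp (\<i> * pi * (1 - s) / 4) * G \<rho>)"
      unfolding f_def R2 e[symmetric] by (simp add: omega_dir_cis)
  qed
  define C where "C = exp (\<i> * pi * (1 - s) / 4)"
  have Cn: "C \<noteq> 0" by (simp add: C_def)
  have fneg_int: "integrable lborel (\<lambda>u. f (- u))"
    using lborel_integrable_real_affine[OF fint, of "-1" 0] by simp
  have Gint: "set_integrable lborel {0<..} G"
  proof -
    have "integrable lborel (\<lambda>u. inverse C * (indicat_real {0<..} u *\<^sub>R f (- u)))"
      by (intro integrable_mult_right integrable_mult_indicator fneg_int) simp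
    moreover have "(\<lambda>u. inverse C * (indicat_real {0<..} u *\<^sub>R f (- u))) = (\<lambda>u. indicat_real {0<..} u *\<^sub>R G u)"
      using Cn by (auto simp: fun_eq_iff indicator_def fneg C_def)
    ultimately show ?thesis by (simp add: set_integrable_def)
  qed
  have "riemann_R s = (1 - exp (pi * \<i> * s)) * C * (LINT \<rho>:{0<..}|lborel. G \<rho>)"
  proof -
    have f0: "f 0 = 0" by (simp add: f_def R_integrand_def)
    have i1: "set_integrable lborel {0<..} f" and i2: "set_integrable lborel {..<0} f"
      unfolding set_integrable_def by (intro integrable_mult_indicator fint; simp)+
    have "riemann_R s = (LINT u|lborel. indicat_real {0<..} u *\<^sub>R f u + indicat_real {..<0} u *\<^sub>R f u)"
      unfolding Rf by (rule Bochner_Integration.integral_cong) (auto simp: indicator_def f0 not_less)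
    also have "\<dots> = (LINT u:{0<..}|lborel. f u) + (LINT u:{..<0}|lborel. f u)"
      using i1 i2 unfolding set_lebesgue_integral_def set_integrable_def by (rule Bochner_Integration.integral_add)
    also have "(LINT u:{..<0}|lborel. f u) = (LINT u:{0<..}|lborel. f (- u))"
      by (subst set_integral_reflect) (simp add: greaterThan_def)
    also have "\<dots> = (LINT u:{0<..}|lborel. C * G u)"
      by (rule set_lebesgue_integral_cong) (auto simp: fneg C_def)
    also have "(LINT u:{0<..}|lborel. f u) = (LINT u:{0<..}|lborel. (- exp (pi * \<i> * s) * C) * G u)"
      by (rule set_lebesgue_integral_cong) (auto simp: fpos C_def)
    finally show ?thesis unfolding set_integral_mult_right by (simp add: algebra_simps)
  qed
  moreover have "(\<lambda>k. gauss_mellin s (node k)) sums (LINT \<rho>:{0<..}|lborel. G \<rho>)"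
  proof -
    have hw: "h k \<rho> = of_real \<rho> powr (- s) * exp (- (of_real pi * (of_real \<rho>)\<^sup>2)) * (w \<rho> * ((w \<rho>)\<^sup>2) ^ k)" for k \<rho>
    proof -
      have ic: "\<i> * cis (pi / 4) = - cis (- pi / 4)" by (simp add: complex_eq_iff cos_45 sin_45)
      have "- (2 * of_real pi * node k * of_real \<rho>) = of_nat (2 * k + 1) * (pi * \<i> * (of_real \<rho> * cis (pi / 4)))"
      proof -
        have "of_nat (2 * k + 1) * (pi * \<i> * (of_real \<rho> * cis (pi / 4))) = of_nat (2 * k + 1) * (of_real pi * of_real \<rho>) * (\<i> * cis (pi / 4))"
          by (simp only: mult_ac)
        then show ?thesis unfolding ic node_def by (simp add: algebra_simps)
      qed
      then have "exp (- (2 * of_real pi * node k * of_real \<rho>)) = w \<rho> * ((w \<rho>)\<^sup>2) ^ k"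
        by (simp only: exp_of_nat_mult w_def[symmetric]) (simp add: power_mult)
      then show ?thesis unfolding h_def diff_conv_add_uminus exp_add by (simp only: mult_ac)
    qed
    have part: "(\<Sum>k<n. h k \<rho>) = G \<rho> * (1 - ((w \<rho>)\<^sup>2) ^ n)" if "\<rho> > 0" for n \<rho>
    proof -
      have "(\<Sum>k<n. h k \<rho>) = of_real \<rho> powr (- s) * exp (- (of_real pi * (of_real \<rho>)\<^sup>2)) * w \<rho> * (\<Sum>k<n. ((w \<rho>)\<^sup>2) ^ k)"
        unfolding hw sum_distrib_left by (simp add: mult_ac)
      also have "(\<Sum>k<n. ((w \<rho>)\<^sup>2) ^ k) = (1 - ((w \<rho>)\<^sup>2) ^ n) / (1 - (w \<rho>)\<^sup>2)"
        using w2[OF that] by (simp add: geometric_sum field_simps)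
      finally show ?thesis by (simp add: G_def)
    qed
    have hG: "h k \<rho> = G \<rho> * ((w \<rho>)\<^sup>2) ^ k * (1 - (w \<rho>)\<^sup>2)" if "\<rho> > 0" for k \<rho>
      unfolding hw G_def using w2[OF that] by simp
    have wk: "cmod (((w \<rho>)\<^sup>2) ^ n) \<le> 1" if "\<rho> > 0" for \<rho> n
      using w1[OF that] by (simp add: norm_power power_le_one)
    have one_m: "cmod (1 - ((w \<rho>)\<^sup>2) ^ n) \<le> 2" if "\<rho> > 0" for \<rho> n
      using norm_triangle_ineq4[of 1 "((w \<rho>)\<^sup>2) ^ n"] wk[OF that, of n] by simp
    have hm: "(\<lambda>\<rho>. indicat_real {0<..} \<rho> *\<^sub>R h k \<rho>) \<in> borel_measurable lborel" for k
    proof -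
      have "(\<lambda>\<rho>. indicat_real {0<..} \<rho> *\<^sub>R h k \<rho>) \<in> borel_measurable borel"
        unfolding h_def
        by (intro borel_measurable_continuous_on_indicator continuous_intros) (auto simp: complex_nonpos_Reals_iff)
      then show ?thesis by simp
    qed
    have Wint: "integrable lborel (\<lambda>\<rho>. 2 * norm (indicat_real {0<..} \<rho> *\<^sub>R G \<rho>))"
      using Gint unfolding set_integrable_def by (intro integrable_mult_right integrable_norm)
    have hint: "integrable lborel (\<lambda>\<rho>. indicat_real {0<..} \<rho> *\<^sub>R h k \<rho>)" for k
    proof (rule Bochner_Integration.integrable_bound[OF Wint hm], rule AE_I2)
      fix \<rho> :: real
      show "norm (indicat_real {0<..} \<rho> *\<^sub>R h k \<rho>) \<le> norm (2 * norm (indicat_real {0<..} \<rho> *\<^sub>R G \<rho>))"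
      proof (cases "\<rho> > 0")
        case True
        have "cmod (h k \<rho>) \<le> cmod (G \<rho>) * 1 * 2"
          unfolding hG[OF True] norm_mult using wk[OF True] one_m[OF True, of 1] by (intro mult_mono) auto
        with True show ?thesis by simp
      qed simp
    qed
    have "(\<lambda>n. LINT \<rho>|lborel. indicat_real {0<..} \<rho> *\<^sub>R (\<Sum>k<n. h k \<rho>)) \<longlonglongrightarrow> (LINT \<rho>|lborel. indicat_real {0<..} \<rho> *\<^sub>R G \<rho>)"
    proof (rule integral_dominated_convergence[OF _ _ Wint])
      show "(\<lambda>\<rho>. indicat_real {0<..} \<rho> *\<^sub>R G \<rho>) \<in> borel_measurable lborel"
        using Gint unfolding set_integrable_def by simp
      show "(\<lambda>\<rho>. indicat_real {0<..} \<rho> *\<^sub>R (\<Sum>k<n. h k \<rho>)) \<in> borel_measurable lborel" for n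
        unfolding scaleR_sum_right by (intro borel_measurable_sum hm)
      show "AE \<rho> in lborel. (\<lambda>n. indicat_real {0<..} \<rho> *\<^sub>R (\<Sum>k<n. h k \<rho>)) \<longlonglongrightarrow> indicat_real {0<..} \<rho> *\<^sub>R G \<rho>"
      proof (rule AE_I2)
        fix \<rho> :: real
        show "(\<lambda>n. indicat_real {0<..} \<rho> *\<^sub>R (\<Sum>k<n. h k \<rho>)) \<longlonglongrightarrow> indicat_real {0<..} \<rho> *\<^sub>R G \<rho>"
        proof (cases "\<rho> > 0")
          case True
          have "cmod ((w \<rho>)\<^sup>2) < 1" using w1[OF True] by (simp add: norm_power power_less_one_iff)
          then have "(\<lambda>n. G \<rho> * (1 - ((w \<rho>)\<^sup>2) ^ n)) \<longlonglongrightarrow> G \<rho> * (1 - 0)"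
            by (intro tendsto_intros LIMSEQ_power_zero)
          then show ?thesis using True by (simp add: part)
        qed simp
      qed
      show "AE \<rho> in lborel. norm (indicat_real {0<..} \<rho> *\<^sub>R (\<Sum>k<n. h k \<rho>)) \<le> 2 * norm (indicat_real {0<..} \<rho> *\<^sub>R G \<rho>)" for n
      proof (rule AE_I2)
        fix \<rho> :: real
        show "norm (indicat_real {0<..} \<rho> *\<^sub>R (\<Sum>k<n. h k \<rho>)) \<le> 2 * norm (indicat_real {0<..} \<rho> *\<^sub>R G \<rho>)"
        proof (cases "\<rho> > 0")
          case True
          then show ?thesis using mult_left_mono[OF one_m[OF True, of n], of "cmod (G \<rho>)"]
            by (simp add: part norm_mult)
        qed simp
      qed
    qed
    moreover have "(LINT \<rho>|lborel. indicat_real {0<..} \<rho> *\<^sub>R (\<Sum>k<n. h k \<rho>)) = (\<Sum>k<n. gauss_mellin s (node k))" for n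
      unfolding scaleR_sum_right by (subst Bochner_Integration.integral_sum)
        (rule hint, simp add: gauss_mellin_def set_lebesgue_integral_def h_def)
    ultimately show ?thesis by (simp add: sums_def set_lebesgue_integral_def)
  qed
  ultimately show ?thesis unfolding C_def by blast
qed

text \<open>Completing the square produces the same constant for every \<open>k\<close> because \<open>k * (k + 1)\<close> is even.\<close>

lemma node_square_exp: "exp (of_real pi * (node k)\<^sup>2) = exp (- (\<i> * pi / 4))"
proof -
  have c: "(cis (- pi / 4))\<^sup>2 = - \<i>"
    by (simp add: complex_eq_iff power2_eq_square cos_45 sin_45)
  obtain n where n: "k * (k + 1) = 2 * n" using even_mult_iff[of k "k + 1"] by (metis dvdE even_plus_one_iff)
  have "(real k + 1 / 2)\<^sup>2 = real (k * (k + 1)) + 1 / 4" by (simp add: power2_eq_square field_simps)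
  also have "\<dots> = 2 * real n + 1 / 4" unfolding n by simp
  finally have e: "(real k + 1 / 2)\<^sup>2 = 2 * real n + 1 / 4" .
  have "of_real pi * (node k)\<^sup>2 = of_real pi * (of_real ((real k + 1 / 2)\<^sup>2) * - \<i>)"
    unfolding node_def power_mult_distrib c of_real_power ..
  also have "\<dots> = - (\<i> * pi / 4) + of_int (- int n) * (2 * of_real pi * \<i>)"
    unfolding e by (simp add: field_simps)
  finally have "of_real pi * (node k)\<^sup>2 = - (\<i> * pi / 4) + of_int (- int n) * (2 * of_real pi * \<i>)" .
  moreover have "exp (of_int (- int n) * (2 * of_real pi * \<i>)) = 1"
    using exp_eq_1[of "of_int (- int n) * (2 * of_real pi * \<i>)"] by (auto intro!: exI[of _ "- int n"])
  ultimately show ?thesis by (simp only: exp_add) simp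
qed

text \<open>\<open>gauss_mellin\<close> does not involve the line, so \<open>\<kappa> k\<close> is
  free for each k. The conversion factor \<open>c\<close> is the same for all k by
  \<open>node_square_exp\<close> and nonzero, so convergence carries over; \<open>chi_eq\<close>
  then collects the Gamma factors.\<close>

lemma riemann_R_eq_chi_bromwich:
  fixes s :: complex
  assumes s: "Re s \<le> -1" and t: "Im s \<noteq> 0" and \<kappa>: "\<And>k. \<kappa> k > 0"
  shows "\<exists>X. (\<lambda>k. bromwich s (node k) (\<kappa> k)) sums X \<and>
     riemann_R s = chi s * (- \<i>) * exp (\<i> * pi * s / 4) * X"
proof -
  obtain X where X: "(\<lambda>k. gauss_mellin s (node k)) sums X"
    and R: "riemann_R s = (1 - exp (pi * \<i> * s)) * exp (\<i> * pi * (1 - s) / 4) * X"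
    using riemann_R_sums_gauss_mellin[OF s] by blast
  define c where "c = exp (- (\<i> * pi / 4)) * Gamma (1 - s) * of_real (2 * pi) powr (s - 1)"
  have "1 - s \<notin> \<int>\<^sub>\<le>\<^sub>0" using t by (auto elim!: nonpos_Ints_cases simp: complex_eq_iff)
  then have "Gamma (1 - s) \<noteq> 0" by (simp add: Gamma_eq_zero_iff)
  then have c: "c \<noteq> 0" by (simp add: c_def)
  have "gauss_mellin s (node k) = c * bromwich s (node k) (\<kappa> k)" for k
    using gauss_mellin_eq_bromwich[of s "\<kappa> k" "node k"] s \<kappa>[of k] by (simp only: node_square_exp c_def)
  then have "(\<lambda>k. bromwich s (node k) (\<kappa> k)) = (\<lambda>k. inverse c * gauss_mellin s (node k))"
    using c by (auto simp: fun_eq_iff)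
  then have "(\<lambda>k. bromwich s (node k) (\<kappa> k)) sums (inverse c * X)"
    using sums_mult[OF X] by simp
  moreover have "riemann_R s = chi s * (- \<i>) * exp (\<i> * pi * s / 4) * (inverse c * X)"
  proof -
    have "exp (\<i> * pi * (1 - s) / 4) = exp (- (pi * \<i> * s / 2)) * exp (\<i> * pi * s / 4) / exp (- (\<i> * pi / 4))"
      unfolding exp_add[symmetric] exp_diff[symmetric] by (simp add: field_simps)
    moreover have "(1 - e) * (E2 * E4 / E3) * X = (P * \<Gamma> * \<i> * E2 * (1 - e)) * (- \<i>) * E4 * (inverse (E3 * \<Gamma> * P) * X)"
      if "E3 * \<Gamma> * P \<noteq> 0" for e E2 E3 E4 P \<Gamma> :: complex
      using that by (simp add: field_simps)
    ultimately show ?thesis using c unfolding R chi_eq[OF t] c_def by (simp only:)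
  qed
  ultimately show ?thesis by blast
qed

section \<open>Steepest descent\<close>

definition rot :: complex where
  "rot = cis (- pi / 4)"

lemma rot_eq: "rot = Complex (sqrt 2 / 2) (- (sqrt 2 / 2))"
  by (simp add: rot_def complex_eq_iff cos_45 sin_45)

lemma rot_square: "rot\<^sup>2 = - \<i>"
  by (simp add: rot_eq complex_eq_iff power2_eq_square)

lemma cmod_rot: "cmod rot = 1" by (simp add: rot_def)

lemma rot_nonzero: "rot \<noteq> 0" using cmod_rot by auto

lemma Re_rot: "Re (rot * p) = (Re p + Im p) * (sqrt 2 / 2)"
  by (simp add: rot_eq algebra_simps)

text \<open>Multiplication by \<open>rot\<close> turns the first quadrant into the cone |Im| <=
  Re.\<close>

lemma Re_rot_ge:
  assumes "0 \<le> Re p" "0 \<le> Im p"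
  shows "Re (rot * p) \<ge> cmod p * (sqrt 2 / 2)"
  unfolding Re_rot using cmod_le[of p] assms by (intro mult_right_mono) auto

lemma Ln_rot:
  assumes "0 < Re p" "0 \<le> Im p"
  shows "Ln (rot * p) = Ln p - \<i> * pi / 4"
proof -
  have "p \<noteq> 0" using assms by auto
  have Lr: "Ln rot = - (\<i> * pi / 4)"
    unfolding rot_def cis_conv_exp by (subst Ln_exp) (auto simp: field_simps)
  have "\<bar>Im (Ln p)\<bar> < pi / 2" using Re_Ln_pos_lt[of p] \<open>p \<noteq> 0\<close> assms by simp
  with Lr \<open>p \<noteq> 0\<close> rot_nonzero show ?thesis by (subst Ln_times_simple) auto
qed

text \<open>In the plane \<open>q = rot * y\<close> the substitution \<open>s - 1 = 2 \<pi> \<i> \<eta>\<^sup>2\<close> puts the saddle of the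
  \<open>m\<close>-free integrand at \<open>rot * \<eta>\<close>, and vertical lines are lines of steepest descent.\<close>

locale saddle =
  fixes \<eta> s :: complex
  assumes s_eq: "s = 1 + 2 * of_real pi * \<i> * \<eta>\<^sup>2"
    and Im_pos: "0 < Im \<eta>" and Im_le: "Im \<eta> \<le> Re \<eta>"
begin

definition phase :: "real \<Rightarrow> complex \<Rightarrow> complex" where
  "phase m q = (s - 1) * Ln q + of_real pi * q\<^sup>2 - 2 * of_real pi * (of_real m * rot) * q"

lemma s_minus_1: "s - 1 = - 2 * of_real pi * (rot * \<eta>)\<^sup>2"
  unfolding power_mult_distrib rot_square s_eq by simp

text \<open>Translation of \<open>r\<close> by Im q: the parametrisation of the line is centred at
  the point around which the phase will be expanded.\<close>

lemma bromwich_through: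
  assumes "0 < Re q"
  shows "bromwich s (of_real m * rot) (Re q) = (LINT r|lborel. exp (phase m (q + \<i> * of_real r)))"
proof -
  have "bromwich s (of_real m * rot) (Re q) = (LINT r|lborel. exp (phase m (of_real (Re q) + \<i> * of_real r)))"
    by (simp add: bromwich_def phase_def)
  also have "\<dots> = (LINT r|lborel. exp (phase m (of_real (Re q) + \<i> * of_real (Im q + 1 * r))))"
    by (subst lborel_integral_real_affine[of 1 _ "Im q"]) auto
  also have "(\<lambda>r. complex_of_real (Re q) + \<i> * of_real (Im q + 1 * r)) = (\<lambda>r. q + \<i> * of_real r)"
    by (simp add: complex_eq_iff fun_eq_iff)
  then have "(\<lambda>r. exp (phase m (complex_of_real (Re q) + \<i> * of_real (Im q + 1 * r)))) = (\<lambda>r. exp (phase m (q + \<i> * of_real r)))"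
    by (simp add: fun_eq_iff)
  finally show ?thesis .
qed

text \<open>On a vertical line the values \<open>1 / q\<close> run over a circle tangent to the imaginary axis at 0,
  while \<open>(rot * \<eta>)\<^sup>2 / (rot * p)\<close> lies in the cone \<open>\<bar>Im\<bar> \<le> Re\<close>. Hence the logarithm destroys at most half
  of the Gaussian decay.\<close>

lemma phase_quadratic_bound:
  fixes p :: complex and r :: real
  assumes p: "0 < Re p" "0 \<le> Im p" "cmod \<eta> \<le> cmod p"
    and quad: "0 \<le> Re (\<eta>\<^sup>2 * cnj p)" "0 \<le> Im (\<eta>\<^sup>2 * cnj p)"
  shows "Re ((s - 1) * (Ln (rot * p + \<i> * of_real r) - Ln (rot * p) - \<i> * of_real r / (rot * p))) - pi * r\<^sup>2
    \<le> - (3 / 2 * r\<^sup>2)"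
proof -
  define q where "q = rot * p"
  define \<kappa> where "\<kappa> = Re q"
  define c where "c = (rot * \<eta>)\<^sup>2 / q"
  have pn: "cmod p > 0" using p by auto
  have \<kappa>p: "\<kappa> \<ge> cmod p * (sqrt 2 / 2)" unfolding \<kappa>_def q_def using p by (intro Re_rot_ge) auto
  then have \<kappa>: "\<kappa> > 0" using pn by (smt (verit) mult_pos_pos half_gt_zero real_sqrt_gt_0_iff)
  have qn: "q \<noteq> 0" using \<kappa> by (auto simp: \<kappa>_def)
  have c_eq: "c = rot * (\<eta>\<^sup>2 * cnj p) / (cmod p)\<^sup>2"
  proof -
    have "c = rot * \<eta>\<^sup>2 / p" unfolding c_def q_def using rot_nonzero by (simp add: power2_eq_square)
    also have "\<dots> = rot * (\<eta>\<^sup>2 * cnj p) / (p * cnj p)" using pn by simp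
    finally show ?thesis unfolding complex_norm_square[symmetric] by (simp only: of_real_power)
  qed
  have c_cone: "\<bar>Im c\<bar> \<le> Re c"
  proof -
    define z where "z = \<eta>\<^sup>2 * cnj p"
    have "Re c = (Re z + Im z) * (sqrt 2 / 2) / (cmod p)\<^sup>2" "Im c = (Im z - Re z) * (sqrt 2 / 2) / (cmod p)\<^sup>2"
      unfolding c_eq z_def[symmetric] of_real_power[symmetric] Re_divide_of_real Im_divide_of_real
      by (simp_all add: rot_eq algebra_simps add_divide_distrib diff_divide_distrib)
    moreover have "\<bar>Im z - Re z\<bar> \<le> Re z + Im z" using quad by (auto simp: z_def)
    ultimately show ?thesis by (auto simp: abs_mult intro!: divide_right_mono mult_right_mono)
  qed
  have c_le: "Re c \<le> sqrt 2 * \<kappa>"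
  proof -
    have "Re c \<le> cmod c" by (rule complex_Re_le_cmod)
    also have "\<dots> = (cmod \<eta>)\<^sup>2 / cmod p" by (simp add: c_def q_def norm_divide norm_mult norm_power cmod_rot)
    also have "\<dots> \<le> (cmod p)\<^sup>2 / cmod p" using p by (intro divide_right_mono power_mono) auto
    also have "\<dots> = cmod p" using pn by (simp add: power2_eq_square)
    also have "\<dots> = sqrt 2 * (cmod p * (sqrt 2 / 2))" by simp
    also have "\<dots> \<le> sqrt 2 * \<kappa>" using \<kappa>p by (intro mult_left_mono) auto
    finally show ?thesis .
  qed
  \<comment> \<open>(\<kappa> - |Y|) / (\<kappa>^2 + Y^2) stays above - 1 / (4 \<kappa>) and Re c <=
    sqrt 2 \<kappa>, so the product stays above - sqrt 2 / 4. Any constant below 1 in place of 1/2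
    would still leave some decay.\<close>
  have key: "Re (c / (q + \<i> * of_real y)) \<ge> - (1 / 2)" for y
  proof -
    define Y where "Y = Im q + y"
    have qy: "q + \<i> * of_real y = Complex \<kappa> Y" by (simp add: complex_eq_iff \<kappa>_def Y_def)
    have pos: "\<kappa>\<^sup>2 + Y\<^sup>2 > 0" using \<kappa> by (simp add: pos_add_strict add_pos_nonneg)
    have "Re (c / Complex \<kappa> Y) = (Re c * \<kappa> + Im c * Y) / (\<kappa>\<^sup>2 + Y\<^sup>2)" by (simp add: Re_divide)
    also have "\<dots> \<ge> Re c * (\<kappa> - \<bar>Y\<bar>) / (\<kappa>\<^sup>2 + Y\<^sup>2)"
    proof (intro divide_right_mono)
      have "\<bar>Im c * Y\<bar> \<le> Re c * \<bar>Y\<bar>" unfolding abs_mult using c_cone by (intro mult_right_mono) auto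
      then show "Re c * (\<kappa> - \<bar>Y\<bar>) \<le> Re c * \<kappa> + Im c * Y" by (simp add: algebra_simps abs_le_iff)
    qed (use pos in simp)
    moreover have "Re c * ((\<kappa> - \<bar>Y\<bar>) / (\<kappa>\<^sup>2 + Y\<^sup>2)) \<ge> - (1 / 2)"
    proof -
      have "(\<kappa> - \<bar>Y\<bar>) / (\<kappa>\<^sup>2 + Y\<^sup>2) \<ge> - (1 / (4 * \<kappa>))"
      proof -
        have "0 \<le> (\<bar>Y\<bar> - 2 * \<kappa>)\<^sup>2 + \<kappa>\<^sup>2" by simp
        also have "\<dots> = 4 * \<kappa> * (\<kappa> - \<bar>Y\<bar>) + (\<kappa>\<^sup>2 + Y\<^sup>2)"
          by (simp add: power2_diff) (simp add: power2_eq_square algebra_simps)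
        finally have "- (\<kappa>\<^sup>2 + Y\<^sup>2) \<le> 4 * \<kappa> * (\<kappa> - \<bar>Y\<bar>)" by simp
        then show ?thesis using pos \<kappa> by (simp add: field_simps)
      qed
      then have "Re c * ((\<kappa> - \<bar>Y\<bar>) / (\<kappa>\<^sup>2 + Y\<^sup>2)) \<ge> Re c * (- (1 / (4 * \<kappa>)))"
        using c_cone by (intro mult_left_mono) auto
      moreover have "Re c * (1 / (4 * \<kappa>)) \<le> (sqrt 2 * \<kappa>) * (1 / (4 * \<kappa>))"
        using c_le \<kappa> by (intro mult_right_mono) auto
      moreover have "(sqrt 2 * \<kappa>) * (1 / (4 * \<kappa>)) \<le> 1 / 2"
        using \<kappa> sqrt2_less_2 by simp
      ultimately show ?thesis by simp
    qed
    ultimately show ?thesis unfolding qy by simp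
  qed
  \<comment> \<open>Comparing \<open>\<psi> 1\<close> with \<open>\<psi> 0 = 0\<close> integrates
    \<open>key\<close> along the line: the logarithm costs at most pi r^2 / 2 out of pi r^2, and 3/2
    is below the remaining pi / 2.\<close>
  define \<psi> where "\<psi> u = Re ((s - 1) * (Ln (q + of_real u * (\<i> * of_real r)) - Ln q - of_real u * (\<i> * of_real r) / q)) - pi * r\<^sup>2 * u\<^sup>2 / 2" for u
  have "\<psi> 1 \<le> \<psi> 0"
  proof (rule DERIV_nonpos_imp_nonincreasing[where f = \<psi> and a = 0 and b = 1])
    fix u :: real assume u: "0 \<le> u" "u \<le> 1"
    define Q where "Q = q + of_real u * (\<i> * of_real r)"
    have ReQ: "Re Q = \<kappa>" by (simp add: Q_def \<kappa>_def)
    then have Q: "Q \<notin> \<real>\<^sub>\<le>\<^sub>0" "Q \<noteq> 0" using \<kappa> by (auto simp: complex_nonpos_Reals_iff)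
    define D where "D = (s - 1) * ((\<i> * of_real r) / Q - (\<i> * of_real r) / q)"
    have "((\<lambda>z. (s - 1) * (Ln (q + z * (\<i> * of_real r)) - Ln q - z * (\<i> * of_real r) / q)) has_field_derivative D) (at (of_real u))"
      using Q qn unfolding D_def Q_def by (auto intro!: derivative_eq_intros simp: divide_inverse mult_ac)
    then have "((\<lambda>u. (s - 1) * (Ln (q + of_real u * (\<i> * of_real r)) - Ln q - of_real u * (\<i> * of_real r) / q)) has_vector_derivative D) (at u)"
      by (rule has_vector_derivative_real_field)
    then have "((\<lambda>u. Re ((s - 1) * (Ln (q + of_real u * (\<i> * of_real r)) - Ln q - of_real u * (\<i> * of_real r) / q))) has_field_derivative Re D) (at u)"
      by (rule has_field_derivative_Re)
    then have "(\<psi> has_field_derivative (Re D - pi * r\<^sup>2 * u)) (at u)"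
      unfolding \<psi>_def by (rule DERIV_diff) (auto intro!: derivative_eq_intros)
    moreover have "Re D - pi * r\<^sup>2 * u \<le> 0"
    proof -
      have "D = of_real (- 2 * pi * r\<^sup>2 * u) * (c / Q)"
      proof -
        have "(\<i> * of_real r) / Q - (\<i> * of_real r) / q = (\<i> * of_real r) * (q - Q) / (q * Q)"
          using Q qn by (simp add: field_simps)
        also have "q - Q = - (of_real u * (\<i> * of_real r))" by (simp add: Q_def)
        finally show ?thesis unfolding D_def s_minus_1 c_def by (simp add: power2_eq_square mult_ac)
      qed
      then have "Re D = (2 * pi * r\<^sup>2 * u) * (- Re (c / Q))"
        by (simp only: Re_complex_of_real complex.sel times_complex.sel Im_complex_of_real)
      also have "\<dots> \<le> (2 * pi * r\<^sup>2 * u) * (1 / 2)"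
        using key[of "u * r"] u by (intro mult_left_mono) (auto simp: Q_def mult_ac)
      finally show ?thesis by simp
    qed
    ultimately show "\<exists>y. (\<psi> has_real_derivative y) (at u) \<and> y \<le> 0" by blast
  qed simp
  moreover have "\<psi> 0 = 0" by (simp add: \<psi>_def)
  moreover have "3 / 2 * r\<^sup>2 \<le> pi / 2 * r\<^sup>2" using pi_gt3 by (intro mult_right_mono) auto
  ultimately show ?thesis by (simp add: \<psi>_def q_def)
qed

text \<open>Isolates the linear term, which vanishes on the line through the exact saddle and is
  merely bounded on the line through \<eta> + m / 2. The last bracket is what
  \<open>phase_quadratic_bound\<close> estimates.\<close>

lemma phase_taylor:
  assumes "q \<noteq> 0"
  shows "phase m (q + \<i> * of_real r) = phase m q + \<i> * of_real r * ((s - 1) / q + 2 * of_real pi * q - 2 * of_real pi * (of_real m * rot))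
    + ((s - 1) * (Ln (q + \<i> * of_real r) - Ln q - \<i> * of_real r / q) - of_real (pi * r\<^sup>2))"
  using assms by (simp add: phase_def power2_eq_square algebra_simps)

end

text \<open>Integrability of \<open>f\<close> comes out of that of \<open>g\<close> and of the
  majorant; with \<open>g = 0\<close> this is a plain bound.\<close>

lemma norm_lborel_integral_diff_le:
  fixes f g :: "real \<Rightarrow> complex"
  assumes f: "f \<in> borel_measurable lborel" and g: "integrable lborel g" and W: "integrable lborel W"
    and le: "\<And>r. cmod (f r - g r) \<le> W r"
  shows "cmod ((LINT r|lborel. f r) - (LINT r|lborel. g r)) \<le> (LINT r|lborel. W r)"
proof -
  have d: "integrable lborel (\<lambda>r. f r - g r)"
  proof (rule Bochner_Integration.integrable_bound[OF W])
    show "(\<lambda>r. f r - g r) \<in> borel_measurable lborel" using f g by measurable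
    show "AE r in lborel. norm (f r - g r) \<le> norm (W r)"
      using le by (intro AE_I2) (simp add: order_trans[OF _ abs_ge_self])
  qed
  have "integrable lborel (\<lambda>r. (f r - g r) + g r)" using d g by (rule Bochner_Integration.integrable_add)
  then have fi: "integrable lborel f" by simp
  have "(LINT r|lborel. f r) - (LINT r|lborel. g r) = (LINT r|lborel. f r - g r)"
    using Bochner_Integration.integral_diff[OF fi g] by simp
  also have "cmod \<dots> \<le> (LINT r|lborel. W r)"
    by (rule order_trans[OF integral_norm_bound integral_mono[OF integrable_norm[OF d] W]]) (use le in auto)
  finally show ?thesis .
qed

section \<open>Lines through the exact saddle: a bound decaying in \<open>m\<close>\<close>

context saddle begin

lemma measurable_exp_phase:
  assumes "0 < Re q"
  shows "(\<lambda>r. exp (phase m (q + \<i> * of_real r))) \<in> borel_measurable lborel"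
proof -
  have "continuous_on UNIV (\<lambda>r. exp (phase m (q + \<i> * of_real r)))"
    unfolding phase_def using assms
    by (intro continuous_intros) (auto simp: complex_nonpos_Reals_iff)
  then show ?thesis using borel_measurable_continuous_onI by simp
qed

text \<open>In the variable y = q / rot the phase is stationary where y^2 - m y - \<eta>^2 = 0. This
  is the root with positive real part; it starts at \<eta> for m = 0.\<close>

definition saddle_pt :: "real \<Rightarrow> complex" where
  "saddle_pt m = of_real (m / 2) + csqrt (of_real (m\<^sup>2 / 4) + \<eta>\<^sup>2)"

text \<open>Supplies the hypotheses of \<open>phase_quadratic_bound\<close> at the saddle. With S =
  a + b i and \<eta> = g + h i one has a b = g h, while a^2 - b^2 exceeds g^2 - h^2 by m^2 / 4.
  Together these force a >= g and b <= h, from which the inequalities are derived.\<close>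

lemma saddle_pt_props:
  assumes m: "m \<ge> 0"
  defines "S \<equiv> csqrt (of_real (m\<^sup>2 / 4) + \<eta>\<^sup>2)"
  shows "(saddle_pt m)\<^sup>2 = \<eta>\<^sup>2 + of_real m * saddle_pt m"
    and "0 < Re S" "0 < Im S" "Im S = Re \<eta> * Im \<eta> / Re S" "Re S \<le> m / 2 + cmod \<eta>"
    and "cmod \<eta> \<le> cmod (saddle_pt m)"
    and saddle_pt_quadrant: "0 < Re (saddle_pt m)" "0 < Im (saddle_pt m)"
    and "0 \<le> Re (\<eta>\<^sup>2 * cnj (saddle_pt m))" "0 \<le> Im (\<eta>\<^sup>2 * cnj (saddle_pt m))"
proof -
  define a b g h where "a = Re S" and "b = Im S" and "g = Re \<eta>" and "h = Im \<eta>"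
  have h: "0 < h" "h \<le> g" using Im_pos Im_le by (auto simp: g_def h_def)
  have S2: "S\<^sup>2 = of_real (m\<^sup>2 / 4) + \<eta>\<^sup>2" by (simp add: S_def)
  have ab: "a * b = g * h" and a2: "a\<^sup>2 - b\<^sup>2 = m\<^sup>2 / 4 + g\<^sup>2 - h\<^sup>2"
    using arg_cong[OF S2, of Im] arg_cong[OF S2, of Re] unfolding a_def b_def g_def h_def
    by (simp_all add: power2_eq_square mult.commute)
  have "a \<ge> 0" using csqrt_principal[of "of_real (m\<^sup>2 / 4) + \<eta>\<^sup>2"] unfolding a_def S_def by linarith
  moreover have "a * b > 0" unfolding ab using h by (intro mult_pos_pos) auto
  ultimately have a: "a > 0" and b: "b > 0" by (auto simp: zero_less_mult_iff)
  show "0 < Re S" "0 < Im S" using a b by (auto simp: a_def b_def)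
  show "Im S = Re \<eta> * Im \<eta> / Re S" using ab a unfolding a_def b_def g_def h_def by (simp add: field_simps)
  have "a * b * (a * b) = g * h * (g * h)" by (simp only: ab)
  then have sq: "a\<^sup>2 * b\<^sup>2 = g\<^sup>2 * h\<^sup>2" by (simp add: power2_eq_square mult_ac)
  have ga: "g \<le> a"
  proof (rule ccontr)
    assume "\<not> g \<le> a"
    then have lt: "a < g" by simp
    have "h < b"
    proof (rule ccontr)
      assume "\<not> h < b"
      then have "a * b \<le> a * h" using a by simp
      also have "\<dots> < g * h" using lt h by simp
      finally show False using ab by simp
    qed
    then have "h\<^sup>2 < b\<^sup>2" using h by (intro power_strict_mono) auto
    moreover have "a\<^sup>2 < g\<^sup>2" using lt a by (intro power_strict_mono) auto
    ultimately show False using a2 zero_le_power2[of m] by linarith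
  qed
  have bh: "b \<le> h"
  proof (rule ccontr)
    assume "\<not> b \<le> h"
    then have "g * h < g * b" using h by simp
    also have "\<dots> \<le> a * b" using ga b by simp
    finally show False using ab by simp
  qed
  have X: "g\<^sup>2 - h\<^sup>2 \<ge> 0" using h by (simp add: power_mono)
  have y: "saddle_pt m = of_real (m / 2) + S" by (simp add: saddle_pt_def S_def)
  show "0 < Re (saddle_pt m)" "0 < Im (saddle_pt m)" using a b m by (auto simp: y a_def b_def)
  show "(saddle_pt m)\<^sup>2 = \<eta>\<^sup>2 + of_real m * saddle_pt m"
  proof -
    have "(saddle_pt m)\<^sup>2 = S\<^sup>2 - of_real (m\<^sup>2 / 4) + of_real m * saddle_pt m"
      unfolding y by (simp add: power2_eq_square field_simps)
    then show ?thesis by (simp add: S2)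
  qed
  have "a\<^sup>2 = m\<^sup>2 / 4 + (g\<^sup>2 - h\<^sup>2) + b\<^sup>2" using a2 by simp
  also have "\<dots> \<le> m\<^sup>2 / 4 + (g\<^sup>2 + h\<^sup>2)"
  proof -
    have "b\<^sup>2 \<le> h\<^sup>2" using bh b by (intro power_mono) auto
    then show ?thesis using zero_le_power2[of h] by linarith
  qed
  also have "g\<^sup>2 + h\<^sup>2 = (cmod \<eta>)\<^sup>2" by (simp add: g_def h_def cmod_power2)
  also have "m\<^sup>2 / 4 + (cmod \<eta>)\<^sup>2 \<le> (m / 2 + cmod \<eta>)\<^sup>2" using m by (simp add: power2_sum power_divide)
  finally have "a\<^sup>2 \<le> (m / 2 + cmod \<eta>)\<^sup>2" .
  then have "a \<le> m / 2 + cmod \<eta>" by (rule power2_le_imp_le) (use m in auto)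
  then show "Re S \<le> m / 2 + cmod \<eta>" by (simp add: a_def)
  have "g\<^sup>2 + h\<^sup>2 \<le> a\<^sup>2 + b\<^sup>2"
  proof (rule power2_le_imp_le)
    have "(g\<^sup>2 + h\<^sup>2)\<^sup>2 = (g\<^sup>2 - h\<^sup>2)\<^sup>2 + 4 * (g\<^sup>2 * h\<^sup>2)" by (simp add: power2_eq_square algebra_simps)
    also have "\<dots> \<le> (m\<^sup>2 / 4 + (g\<^sup>2 - h\<^sup>2))\<^sup>2 + 4 * (g\<^sup>2 * h\<^sup>2)" using X by (intro add_right_mono power_mono) auto
    also have "\<dots> = (a\<^sup>2 - b\<^sup>2)\<^sup>2 + 4 * (a\<^sup>2 * b\<^sup>2)" unfolding sq a2 by (simp add: add_diff_eq)
    also have "\<dots> = (a\<^sup>2 + b\<^sup>2)\<^sup>2" by (simp add: power2_eq_square algebra_simps)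
    finally show "(g\<^sup>2 + h\<^sup>2)\<^sup>2 \<le> (a\<^sup>2 + b\<^sup>2)\<^sup>2" .
  qed simp
  also have "\<dots> \<le> (m / 2 + a)\<^sup>2 + b\<^sup>2" using m a by (intro add_right_mono power_mono) auto
  finally have "(cmod \<eta>)\<^sup>2 \<le> (cmod (saddle_pt m))\<^sup>2"
    unfolding y by (simp add: cmod_power2 g_def h_def a_def b_def)
  then show "cmod \<eta> \<le> cmod (saddle_pt m)" by (rule power2_le_imp_le) simp
  have Re_e: "Re (\<eta>\<^sup>2 * cnj (saddle_pt m)) = (g\<^sup>2 - h\<^sup>2) * (m / 2 + a) + 2 * g * h * b"
    and Im_e: "Im (\<eta>\<^sup>2 * cnj (saddle_pt m)) = 2 * g * h * (m / 2 + a) - (g\<^sup>2 - h\<^sup>2) * b"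
    unfolding y by (simp_all add: g_def h_def a_def b_def power2_eq_square algebra_simps diff_divide_distrib add_divide_distrib)
  show "0 \<le> Re (\<eta>\<^sup>2 * cnj (saddle_pt m))" unfolding Re_e using X m a b h
    by (intro add_nonneg_nonneg mult_nonneg_nonneg) auto
  have "(g\<^sup>2 - h\<^sup>2) * b \<le> g\<^sup>2 * h" using bh b X h by (intro mult_mono) auto
  also have "\<dots> \<le> 2 * g * h * (m / 2 + a)"
  proof -
    have "g * h * g \<le> 2 * g * h * (m / 2 + a)" using h m ga by (intro mult_mono) auto
    then show ?thesis by (simp add: power2_eq_square mult_ac)
  qed
  finally show "0 \<le> Im (\<eta>\<^sup>2 * cnj (saddle_pt m))" unfolding Im_e by simp
qed

lemma phase_rot:
  assumes "0 < Re p" "0 \<le> Im p"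
  shows "phase m (rot * p) = (s - 1) * Ln p - (s - 1) * (\<i> * pi / 4) - of_real pi * \<i> * p\<^sup>2 + 2 * of_real pi * \<i> * of_real m * p"
proof -
  have "2 * of_real pi * (of_real m * rot) * (rot * p) = 2 * of_real pi * of_real m * (rot\<^sup>2 * p)"
    by (simp only: power2_eq_square mult_ac)
  then have e: "2 * of_real pi * (of_real m * rot) * (rot * p) = - (2 * of_real pi * \<i> * of_real m * p)"
    unfolding rot_square by simp
  show ?thesis
    unfolding phase_def e Ln_rot[OF assms] power_mult_distrib rot_square by (simp add: algebra_simps)
qed

text \<open>The phase at its critical point has derivative \<open>2 \<pi> \<i> saddle_pt m\<close> with respect to \<open>m\<close>.\<close>

lemma Re_phase_saddle_pt_le:
  assumes m: "m \<ge> 0"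
  shows "Re (phase m (rot * saddle_pt m)) \<le> Re (phase 0 (rot * \<eta>)) - 2 * pi * Im (\<eta>\<^sup>2) * ln (1 + m / (2 * cmod \<eta>))"
proof -
  have \<eta>n: "cmod \<eta> > 0" "\<eta> \<noteq> 0" "Re \<eta> > 0" using Im_pos Im_le by auto
  have pos: "0 < Re (saddle_pt m)" "0 < Im (saddle_pt m)" if "m \<ge> 0" for m
    using saddle_pt_quadrant[OF that] by auto
  define k where "k = - ((s - 1) * (\<i> * pi / 4)) - of_real pi * \<i> * \<eta>\<^sup>2"
  \<comment> \<open>The saddle equation replaces y^2 by \<eta>^2 + m y, which leaves half of the
    term linear in y. \<open>V\<close> has a complex argument so that complex differentiation
    applies before restricting to the real axis.\<close>
  define V where "V z = (s - 1) * Ln (z / 2 + csqrt (z\<^sup>2 / 4 + \<eta>\<^sup>2)) + of_real pi * \<i> * z * (z / 2 + csqrt (z\<^sup>2 / 4 + \<eta>\<^sup>2))" for z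
  have VV: "V (of_real m) = (s - 1) * Ln (saddle_pt m) + of_real pi * \<i> * of_real m * saddle_pt m" for m :: real
    by (simp add: V_def saddle_pt_def)
  have ph: "phase m (rot * saddle_pt m) = V (of_real m) + k" if "m \<ge> 0" for m
    unfolding phase_rot[OF pos(1)[OF that] less_imp_le[OF pos(2)[OF that]]] VV
      saddle_pt_props(1)[OF that] k_def by (simp add: algebra_simps)
  have y0: "saddle_pt 0 = \<eta>" using \<eta>n csqrt_square[of \<eta>] by (simp add: saddle_pt_def)
  have ph0: "phase 0 (rot * \<eta>) = V (of_real 0) + k" using ph[of 0] by (simp add: y0)
  \<comment> \<open>The critical value falls at rate 2 pi Im S, where Im S = Re \<eta> Im \<eta> /
    Re S and Re S <= x / 2 + |\<eta>|. The logarithm is the primitive of the resulting lower bound,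
    so \<open>v\<close> decreases.\<close>
  define v where "v x = Re (V (of_real x)) + 2 * pi * Im (\<eta>\<^sup>2) * ln (1 + x / (2 * cmod \<eta>))" for x
  have "v m \<le> v 0"
  proof (rule DERIV_nonpos_imp_nonincreasing[where f = v and a = 0 and b = m])
    fix x assume x: "0 \<le> x" "x \<le> m"
    define S where "S = csqrt (of_real (x\<^sup>2 / 4) + \<eta>\<^sup>2)"
    note pr = saddle_pt_props[OF x(1), folded S_def]
    have yS: "saddle_pt x = of_real x / 2 + S" by (simp add: saddle_pt_def S_def)
    have Sn: "S \<noteq> 0" using pr(2) by auto
    have nonpos: "of_real (x\<^sup>2 / 4) + \<eta>\<^sup>2 \<notin> \<real>\<^sub>\<le>\<^sub>0"
    proof -
      have "Im (of_real (x\<^sup>2 / 4) + \<eta>\<^sup>2) > 0" using Im_pos \<eta>n by (simp add: power2_eq_square)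
      then show ?thesis by (auto simp: complex_nonpos_Reals_iff)
    qed
    have yn: "saddle_pt x \<notin> \<real>\<^sub>\<le>\<^sub>0" "saddle_pt x \<noteq> 0" using pos[OF x(1)] by (auto simp: complex_nonpos_Reals_iff)
    define y' where "y' = 1 / 2 + of_real x / (4 * S)"
    have dS: "((\<lambda>z. z / 2 + csqrt (z\<^sup>2 / 4 + \<eta>\<^sup>2)) has_field_derivative y') (at (of_real x))"
      unfolding y'_def S_def using nonpos Sn
      by (auto intro!: derivative_eq_intros simp: S_def field_simps)
    have Vd: "(V has_field_derivative ((s - 1) * (y' / saddle_pt x) + of_real pi * \<i> * (saddle_pt x + of_real x * y'))) (at (of_real x))"
    proof -
      have e: "of_real x / 2 + csqrt ((of_real x)\<^sup>2 / 4 + \<eta>\<^sup>2) = saddle_pt x" by (simp add: saddle_pt_def)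
      have dL: "((\<lambda>z. Ln (z / 2 + csqrt (z\<^sup>2 / 4 + \<eta>\<^sup>2))) has_field_derivative (inverse (saddle_pt x) * y')) (at (of_real x))"
        using DERIV_chain2[of Ln "inverse (saddle_pt x)" "\<lambda>z. z / 2 + csqrt (z\<^sup>2 / 4 + \<eta>\<^sup>2)" "of_real x" y' UNIV]
          has_field_derivative_Ln[OF yn(1)] dS e by simp
      show ?thesis unfolding V_def
        by (rule DERIV_cong[OF DERIV_add[OF DERIV_cmult[OF dL, of "s - 1"]
              DERIV_mult[OF DERIV_cmult[OF DERIV_ident, of "of_real pi * \<i>"] dS]]], unfold e)
           (simp add: divide_inverse algebra_simps)
    qed
    have y'y: "y' * (2 * S) = saddle_pt x" unfolding y'_def yS using Sn by (simp add: field_simps)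
    have "(s - 1) * (y' / saddle_pt x) + of_real pi * \<i> * (saddle_pt x + of_real x * y') = 2 * of_real pi * \<i> * saddle_pt x"
    proof -
      have "y' / saddle_pt x = 1 / (2 * S)" using y'y yn(2) Sn by (simp add: field_simps)
      moreover have "of_real x * y' = of_real x * saddle_pt x / (2 * S)" using y'y Sn by (simp add: field_simps)
      moreover have "s - 1 = 2 * of_real pi * \<i> * \<eta>\<^sup>2" by (simp add: s_eq)
      ultimately have "(s - 1) * (y' / saddle_pt x) + of_real pi * \<i> * (saddle_pt x + of_real x * y')
         = of_real pi * \<i> * ((2 * \<eta>\<^sup>2 + of_real x * saddle_pt x) / (2 * S) + saddle_pt x)"
        by (simp only:) (use Sn in \<open>simp add: field_simps\<close>)
      also have "2 * \<eta>\<^sup>2 + of_real x * saddle_pt x = saddle_pt x * (2 * S)"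
      proof -
        have e2: "\<eta>\<^sup>2 = (saddle_pt x)\<^sup>2 - of_real x * saddle_pt x" by (simp add: pr(1))
        have "2 * \<eta>\<^sup>2 + of_real x * saddle_pt x = saddle_pt x * (2 * saddle_pt x - of_real x)"
          unfolding e2 by (simp add: power2_eq_square algebra_simps)
        also have "2 * saddle_pt x - of_real x = 2 * S" by (simp add: yS)
        finally show ?thesis .
      qed
      finally show ?thesis using Sn by simp
    qed
    with Vd have "(V has_field_derivative (2 * of_real pi * \<i> * saddle_pt x)) (at (of_real x))" by simp
    then have "((\<lambda>x. Re (V (of_real x))) has_field_derivative Re (2 * of_real pi * \<i> * saddle_pt x)) (at x)"
      by (intro has_field_derivative_Re has_vector_derivative_real_field)
    then have vd: "(v has_field_derivative (Re (2 * of_real pi * \<i> * saddle_pt x) + 2 * pi * Im (\<eta>\<^sup>2) * (1 / (2 * cmod \<eta> + x)))) (at x)"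
    proof -
      assume A: "((\<lambda>x. Re (V (of_real x))) has_field_derivative Re (2 * of_real pi * \<i> * saddle_pt x)) (at x)"
      have "1 + x / (2 * cmod \<eta>) > 0" using x \<eta>n by (simp add: add_pos_nonneg)
      then have "((\<lambda>x. ln (1 + x / (2 * cmod \<eta>))) has_field_derivative (1 / (2 * cmod \<eta> + x))) (at x)"
        using \<eta>n x by (auto intro!: derivative_eq_intros simp: field_simps add_nonneg_pos)
      from DERIV_add[OF A DERIV_cmult[OF this, of "2 * pi * Im (\<eta>\<^sup>2)"]] show ?thesis unfolding v_def .
    qed
    have "Re (2 * of_real pi * \<i> * saddle_pt x) = - 2 * pi * Im S" by (simp add: yS)
    moreover have "Im S \<ge> Im (\<eta>\<^sup>2) * (1 / (2 * cmod \<eta> + x))"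
    proof -
      have "Re \<eta> * Im \<eta> / (x / 2 + cmod \<eta>) \<le> Re \<eta> * Im \<eta> / Re S"
        using pr(2,5) \<eta>n Im_pos by (intro divide_left_mono) (auto intro!: mult_pos_pos)
      moreover have "Re \<eta> * Im \<eta> / (x / 2 + cmod \<eta>) = Im (\<eta>\<^sup>2) * (1 / (2 * cmod \<eta> + x))"
        by (simp add: power2_eq_square) (use x \<eta>n in \<open>simp add: field_simps add_nonneg_eq_0_iff\<close>)
      ultimately show ?thesis by (simp only: pr(4))
    qed
    then have "2 * pi * (Im (\<eta>\<^sup>2) * (1 / (2 * cmod \<eta> + x))) \<le> 2 * pi * Im S" by (intro mult_left_mono) auto
    ultimately have "Re (2 * of_real pi * \<i> * saddle_pt x) + 2 * pi * Im (\<eta>\<^sup>2) * (1 / (2 * cmod \<eta> + x)) \<le> 0"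
      by (simp only: mult.assoc)
    with vd show "\<exists>y. (v has_real_derivative y) (at x) \<and> y \<le> 0" by blast
  qed (rule m)
  then show ?thesis unfolding ph[OF m] ph0 by (simp add: v_def)
qed

text \<open>On this line the linear term vanishes, so taking moduli inside costs only a fixed
  Gaussian integral. The exponent 2 pi Im (\<eta>^2) is 1 - Re s, which is large.\<close>

lemma bromwich_tail_bound:
  assumes m: "m \<ge> 0"
  shows "0 < Re (rot * saddle_pt m)"
    and "cmod (bromwich s (of_real m * rot) (Re (rot * saddle_pt m))) \<le>
      (LINT r|lborel. exp (- (3 / 2 * r\<^sup>2))) * (exp (Re (phase 0 (rot * \<eta>))) * (1 + m / (2 * cmod \<eta>)) powr (- (2 * pi * Im (\<eta>\<^sup>2))))"
proof -
  have \<eta>n: "cmod \<eta> > 0" using Im_pos by auto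
  let ?y = "saddle_pt m"
  have pos: "0 < Re ?y" "0 < Im ?y"
    using saddle_pt_quadrant[OF m] by auto
  have q: "0 < Re (rot * ?y)" unfolding Re_rot using pos by (intro mult_pos_pos) auto
  then show "0 < Re (rot * saddle_pt m)" .
  have qn: "rot * ?y \<noteq> 0" using q by auto
  have stat: "(s - 1) / (rot * ?y) + 2 * of_real pi * (rot * ?y) - 2 * of_real pi * (of_real m * rot) = 0"
  proof -
    have "(s - 1) = - 2 * of_real pi * (rot\<^sup>2 * (?y\<^sup>2 - of_real m * ?y))"
      unfolding s_minus_1 power_mult_distrib saddle_pt_props(1)[OF m] by simp
    then have "(s - 1) / (rot * ?y) = - 2 * of_real pi * (rot * (?y - of_real m))"
      using qn by (simp add: power2_eq_square field_simps)
    then show ?thesis by (simp add: algebra_simps)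
  qed
  define M where "M = exp (Re (phase m (rot * ?y)))"
  have W: "integrable lborel (\<lambda>r. M * exp (- (3 / 2 * r\<^sup>2)))"
    by (intro integrable_mult_right integrable_exp_neg_square) simp
  have "cmod ((LINT r|lborel. exp (phase m (rot * ?y + \<i> * of_real r))) - (LINT r::real|lborel. 0)) \<le> (LINT r|lborel. M * exp (- (3 / 2 * r\<^sup>2)))"
  proof (rule norm_lborel_integral_diff_le[OF measurable_exp_phase[OF q] _ W])
    fix r :: real
    have "Re (phase m (rot * ?y + \<i> * of_real r)) \<le> Re (phase m (rot * ?y)) - 3 / 2 * r\<^sup>2"
      using phase_quadratic_bound[OF pos(1) less_imp_le[OF pos(2)] saddle_pt_props(6,9,10)[OF m], of r]
      unfolding phase_taylor[OF qn] stat by simp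
    then show "cmod (exp (phase m (rot * ?y + \<i> * of_real r)) - 0) \<le> M * exp (- (3 / 2 * r\<^sup>2))"
      by (simp add: M_def flip: exp_add)
  qed simp
  then have "cmod (bromwich s (of_real m * rot) (Re (rot * ?y))) \<le> M * (LINT r|lborel. exp (- (3 / 2 * r\<^sup>2)))"
    unfolding bromwich_through[OF q] by simp
  also have "\<dots> \<le> (exp (Re (phase 0 (rot * \<eta>))) * (1 + m / (2 * cmod \<eta>)) powr (- (2 * pi * Im (\<eta>\<^sup>2)))) * (LINT r|lborel. exp (- (3 / 2 * r\<^sup>2)))"
  proof (intro mult_right_mono)
    have "M \<le> exp (Re (phase 0 (rot * \<eta>)) - 2 * pi * Im (\<eta>\<^sup>2) * ln (1 + m / (2 * cmod \<eta>)))"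
      unfolding M_def using Re_phase_saddle_pt_le[OF m] by simp
    also have "\<dots> = exp (Re (phase 0 (rot * \<eta>))) * (1 + m / (2 * cmod \<eta>)) powr (- (2 * pi * Im (\<eta>\<^sup>2)))"
      using \<eta>n m by (simp add: powr_def exp_diff exp_minus field_simps add_nonneg_eq_0_iff)
    finally show "M \<le> \<dots>" .
  qed simp
  finally show "cmod (bromwich s (of_real m * rot) (Re (rot * saddle_pt m))) \<le>
      (LINT r|lborel. exp (- (3 / 2 * r\<^sup>2))) * (exp (Re (phase 0 (rot * \<eta>))) * (1 + m / (2 * cmod \<eta>)) powr (- (2 * pi * Im (\<eta>\<^sup>2))))"
    by (simp add: mult_ac)
qed

end

section \<open>Lines through \<eta> + m / 2: the Gaussian main term\<close>

lemma norm_exp_minus_one_le: "cmod (exp w - 1) \<le> cmod w * (1 + exp (Re w))"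
proof -
  have "cmod (exp w - exp 0) \<le> (1 + exp (Re w)) * cmod (w - 0)"
  proof (rule field_differentiable_bound[where S = "closed_segment 0 w"])
    show "(exp has_field_derivative exp z) (at z within closed_segment 0 w)" for z :: complex
      by (rule DERIV_subset[OF DERIV_exp]) simp
    show "cmod (exp z) \<le> 1 + exp (Re w)" if "z \<in> closed_segment 0 w" for z
    proof -
      from that obtain u where u: "0 \<le> u" "u \<le> 1" "z = u *\<^sub>R w" by (auto simp: in_segment)
      have "Re z \<le> max 0 (Re w)"
      proof (cases "Re w \<ge> 0")
        case True
        then show ?thesis using u mult_right_mono[of u 1 "Re w"] by simp
      next
        case False
        then show ?thesis using u by (simp add: mult_nonneg_nonpos)
      qed
      then have "exp (Re z) \<le> exp (max 0 (Re w))" by simp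
      also have "\<dots> \<le> 1 + exp (Re w)" by (simp add: max_def)
      finally show ?thesis by simp
    qed
  qed auto
  then show ?thesis by (simp add: mult.commute)
qed

lemma integral_exp_neg_two_pi_square:
  "integrable lborel (\<lambda>r. complex_of_real (exp (- (2 * pi * r\<^sup>2))))"
  "(LINT r|lborel. complex_of_real (exp (- (2 * pi * r\<^sup>2)))) = 1 / sqrt 2"
proof -
  have e: "exp (of_real pi * (0 + \<i> * of_real (0 + sqrt 2 * r))\<^sup>2) = complex_of_real (exp (- (2 * pi * r\<^sup>2)))" for r
    by (simp add: power_mult_distrib mult_ac flip: exp_of_real of_real_mult of_real_power of_real_minus)
  show "integrable lborel (\<lambda>r. complex_of_real (exp (- (2 * pi * r\<^sup>2))))"
    using lborel_integrable_real_affine[OF integral_exp_pi_shifted_square(1)[of 0], of "sqrt 2" 0] unfolding e by simp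
  show "(LINT r|lborel. complex_of_real (exp (- (2 * pi * r\<^sup>2)))) = 1 / sqrt 2"
    using lborel_integral_real_affine[of "sqrt 2" "\<lambda>r. exp (of_real pi * (0 + \<i> * of_real r)\<^sup>2)" 0]
    unfolding e integral_exp_pi_shifted_square(2) by (simp add: scaleR_conv_of_real field_simps)
qed

text \<open>The mass of the majorant in \<open>bromwich_main_bound\<close>: 16 comes from the cubic
  remainder, 2 from adding two exponentials, and 52 from 2 + 10 R - 3/2 R^2 <= 52 - R^2, that is (R
  - 10)^2 >= 0.\<close>

definition cubic_error_const :: real where
  "cubic_error_const = (LINT r::real|lborel. 32 * exp 52 * exp (- (1 * r\<^sup>2)))"

context saddle begin

text \<open>Instead of the exact saddle the line passes through \<open>\<eta> + m / 2\<close>: expanding the phase around \<open>\<eta>\<close>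
  there leaves a pure Gaussian, and the cubic remainder is the only error.\<close>

lemma bromwich_main_bound:
  assumes m: "1 / 2 \<le> m" and mL: "m ^ 3 \<le> cmod \<eta>"
  shows "0 < Re (rot * (\<eta> + of_real (m / 2)))"
    and "cmod (bromwich s (of_real m * rot) (Re (rot * (\<eta> + of_real (m / 2)))) -
       exp (phase 0 (rot * \<eta>)) * exp (2 * of_real pi * \<i> * of_real m * \<eta>) * exp (\<i> * of_real (pi * m\<^sup>2 / 2)) / sqrt 2)
     \<le> exp (Re (phase 0 (rot * \<eta>))) * exp (- (2 * pi * m * Im \<eta>)) * (cubic_error_const * m ^ 3 / cmod \<eta>)"
proof -
  define L where "L = cmod \<eta>"
  have \<eta>n: "L > 0" "\<eta> \<noteq> 0" "Re \<eta> > 0" using Im_pos Im_le by (auto simp: L_def)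
  define p where "p = \<eta> + of_real (m / 2)"
  define \<epsilon> where "\<epsilon> = rot * \<eta>"
  define \<mu> where "\<mu> = of_real m * rot"
  define q where "q = rot * p"
  have q_eq: "q = \<epsilon> + \<mu> / 2" by (simp add: q_def p_def \<epsilon>_def \<mu>_def algebra_simps)
  have pp: "0 < Re p" "0 < Im p" using \<eta>n m Im_pos by (auto simp: p_def)
  have \<epsilon>L: "cmod \<epsilon> = L" by (simp add: \<epsilon>_def L_def norm_mult cmod_rot)
  have \<epsilon>n: "\<epsilon> \<noteq> 0" using \<epsilon>L \<eta>n by auto
  have q: "0 < Re q" unfolding q_def Re_rot using pp by (intro mult_pos_pos) auto
  then show "0 < Re (rot * (\<eta> + of_real (m / 2)))" by (simp add: q_def p_def)
  have qn: "q \<noteq> 0" using q by auto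
  have pL: "cmod \<eta> \<le> cmod p"
  proof -
    have "(Re \<eta>)\<^sup>2 \<le> (Re p)\<^sup>2" using \<eta>n m by (intro power_mono) (auto simp: p_def)
    then have "(cmod \<eta>)\<^sup>2 \<le> (cmod p)\<^sup>2" by (simp add: cmod_power2 p_def)
    then show ?thesis by (rule power2_le_imp_le) simp
  qed
  have quadrant: "0 \<le> Re (\<eta>\<^sup>2 * cnj p)" "0 \<le> Im (\<eta>\<^sup>2 * cnj p)"
  proof -
    have n: "\<eta>\<^sup>2 * cnj p = of_real (L\<^sup>2) * \<eta> + of_real (m / 2) * \<eta>\<^sup>2"
      unfolding L_def complex_norm_square by (simp add: p_def power2_eq_square algebra_simps)
    have "Im \<eta> * Im \<eta> \<le> Re \<eta> * Re \<eta>" using Im_le Im_pos by (intro mult_mono) auto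
    then have "0 \<le> Re (\<eta>\<^sup>2)" "0 \<le> Im (\<eta>\<^sup>2)" using \<eta>n Im_pos by (auto simp: power2_eq_square)
    then show "0 \<le> Re (\<eta>\<^sup>2 * cnj p)" "0 \<le> Im (\<eta>\<^sup>2 * cnj p)"
      unfolding n using \<eta>n Im_pos m by (auto simp del: power2_eq_square intro!: add_nonneg_nonneg mult_nonneg_nonneg)
  qed
  define w where "w r = (s - 1) * (Ln (q + \<i> * of_real r) - Ln \<epsilon> - (\<mu> / 2 + \<i> * of_real r) / \<epsilon> + (\<mu> / 2 + \<i> * of_real r)\<^sup>2 / (2 * \<epsilon>\<^sup>2))" for r :: real
  define A where "A = phase 0 \<epsilon> - 2 * of_real pi * \<mu> * \<epsilon> - of_real pi * \<mu>\<^sup>2 / 2"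
  have s1: "s - 1 = - 2 * of_real pi * \<epsilon>\<^sup>2" using s_minus_1 by (simp add: \<epsilon>_def)
  \<comment> \<open>With \<delta> the displacement from \<epsilon>, the logarithm contributes the
    same second-order term as pi q^2, so the quadratic part is 2 pi \<delta>^2 - 2 pi \<mu>
    \<delta>. Its vertex \<delta> = \<mu> / 2 is the origin of the offset m / 2; \<open>w r\<close>
    is the remainder of order three.\<close>
  have ph: "phase m (q + \<i> * of_real r) = A + of_real (- (2 * pi * r\<^sup>2)) + w r" for r
  proof -
    define \<delta> where "\<delta> = \<mu> / 2 + \<i> * of_real r"
    have qd: "q + \<i> * of_real r = \<epsilon> + \<delta>" by (simp add: q_eq \<delta>_def)
    have "w r = (s - 1) * (Ln (\<epsilon> + \<delta>) - Ln \<epsilon>) - (s - 1) * (\<delta> / \<epsilon>) + (s - 1) * (\<delta>\<^sup>2 / (2 * \<epsilon>\<^sup>2))"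
      unfolding w_def qd \<delta>_def[symmetric] by (simp add: algebra_simps)
    also have "(s - 1) * (\<delta> / \<epsilon>) = - 2 * of_real pi * \<epsilon> * \<delta>" unfolding s1 using \<epsilon>n by (simp add: power2_eq_square)
    also have "(s - 1) * (\<delta>\<^sup>2 / (2 * \<epsilon>\<^sup>2)) = - of_real pi * \<delta>\<^sup>2" unfolding s1 using \<epsilon>n by simp
    finally have w: "w r = (s - 1) * (Ln (\<epsilon> + \<delta>) - Ln \<epsilon>) + 2 * of_real pi * \<epsilon> * \<delta> - of_real pi * \<delta>\<^sup>2" by simp
    have r2: "of_real (- (2 * pi * r\<^sup>2)) = 2 * of_real pi * (\<delta> - \<mu> / 2)\<^sup>2"
      by (simp add: \<delta>_def power_mult_distrib)
    show ?thesis unfolding w r2 qd A_def phase_def \<mu>_def[symmetric]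
      by (simp add: power2_eq_square field_simps)
  qed
  have expA: "exp A = exp (phase 0 (rot * \<eta>)) * exp (2 * of_real pi * \<i> * of_real m * \<eta>) * exp (\<i> * of_real (pi * m\<^sup>2 / 2))"
  proof -
    have "\<mu> * \<epsilon> = of_real m * (rot\<^sup>2 * \<eta>)" by (simp add: \<mu>_def \<epsilon>_def power2_eq_square)
    then have 1: "\<mu> * \<epsilon> = - (\<i> * of_real m * \<eta>)" unfolding rot_square by simp
    have 2: "\<mu>\<^sup>2 = - (\<i> * of_real (m\<^sup>2))" unfolding \<mu>_def power_mult_distrib rot_square by simp
    have "A = phase 0 (rot * \<eta>) + 2 * of_real pi * \<i> * of_real m * \<eta> + \<i> * of_real (pi * m\<^sup>2 / 2)"
      unfolding A_def 2 mult.assoc[of _ \<mu> \<epsilon>] 1 \<epsilon>_def[symmetric] by (simp add: algebra_simps)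
    then show ?thesis by (simp only: exp_add)
  qed
  have wle: "cmod (w r) \<le> 16 * (m / 2 + \<bar>r\<bar>) ^ 3 / L" for r
  proof -
    define \<delta> where "\<delta> = \<mu> / 2 + \<i> * of_real r"
    have qd: "q + \<i> * of_real r = \<epsilon> + \<delta>" by (simp add: q_eq \<delta>_def)
    have dle: "cmod \<delta> \<le> m / 2 + \<bar>r\<bar>"
      unfolding \<delta>_def by (rule order_trans[OF norm_triangle_ineq]) (use m in \<open>simp add: \<mu>_def norm_mult norm_divide cmod_rot\<close>)
    have Re\<epsilon>: "Re \<epsilon> \<ge> L * (sqrt 2 / 2)" unfolding \<epsilon>_def L_def using Im_pos \<eta>n by (intro Re_rot_ge) auto
    have Re\<epsilon>u: "Re (\<epsilon> + of_real u * \<delta>) \<ge> L / 2" if "u \<ge> 0" for u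
    proof -
      have "Re \<delta> \<ge> 0" using m by (simp add: \<delta>_def \<mu>_def rot_eq)
      then have "Re (\<epsilon> + of_real u * \<delta>) \<ge> Re \<epsilon>" using that by simp
      moreover have "L * (sqrt 2 / 2) \<ge> L * (1 / 2)" using \<eta>n by (intro mult_left_mono) auto
      ultimately show ?thesis using Re\<epsilon> by simp
    qed
    \<comment> \<open>The derivative of this remainder collapses to z^2 \<delta>^3 / (\<epsilon>^2
      (\<epsilon> + z \<delta>)). As Re \<delta> >= 0, the segment keeps distance L / 2 from the
      branch point.\<close>
    define F where "F z = Ln (\<epsilon> + z * \<delta>) - Ln \<epsilon> - z * (\<delta> / \<epsilon>) + z\<^sup>2 * (\<delta>\<^sup>2 / (2 * \<epsilon>\<^sup>2))" for z
    have "cmod (F 1 - F 0) \<le> (cmod \<delta> ^ 3 / (L\<^sup>2 * (L / 2))) * cmod (1 - 0 :: complex)"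
    proof (rule field_differentiable_bound[where S = "closed_segment 0 1" and f' = "\<lambda>z. z\<^sup>2 * \<delta> ^ 3 / (\<epsilon>\<^sup>2 * (\<epsilon> + z * \<delta>))"])
      fix z :: complex assume z: "z \<in> closed_segment 0 1"
      then obtain u where u: "0 \<le> u" "u \<le> 1" "z = of_real u" by (auto simp: in_segment scaleR_conv_of_real)
      have Re: "Re (\<epsilon> + z * \<delta>) \<ge> L / 2" using Re\<epsilon>u[OF u(1)] u by simp
      then have rp: "Re (\<epsilon> + z * \<delta>) > 0" using \<eta>n by linarith
      have nn: "\<epsilon> + z * \<delta> \<notin> \<real>\<^sub>\<le>\<^sub>0" "\<epsilon> + z * \<delta> \<noteq> 0"
        using rp by (metis complex_nonpos_Reals_iff not_le, metis less_irrefl zero_complex.sel(1))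
      have dL: "((\<lambda>z. Ln (\<epsilon> + z * \<delta>)) has_field_derivative inverse (\<epsilon> + z * \<delta>) * \<delta>) (at z)"
        by (rule DERIV_chain2[where f = Ln and g = "\<lambda>z. \<epsilon> + z * \<delta>", OF has_field_derivative_Ln[OF nn(1)]]) (auto intro!: derivative_eq_intros)
      have d2: "((\<lambda>z. z * (\<delta> / \<epsilon>)) has_field_derivative \<delta> / \<epsilon>) (at z)"
        using DERIV_cmult_right[OF DERIV_ident, of "\<delta> / \<epsilon>"] by simp
      have d3: "((\<lambda>z. z\<^sup>2 * (\<delta>\<^sup>2 / (2 * \<epsilon>\<^sup>2))) has_field_derivative z * (\<delta>\<^sup>2 / \<epsilon>\<^sup>2)) (at z)"
        using DERIV_cmult_right[OF DERIV_power[OF DERIV_ident, of 2], of "\<delta>\<^sup>2 / (2 * \<epsilon>\<^sup>2)"] by simp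
      have "(F has_field_derivative (inverse (\<epsilon> + z * \<delta>) * \<delta> - 0 - \<delta> / \<epsilon> + z * (\<delta>\<^sup>2 / \<epsilon>\<^sup>2))) (at z)"
        unfolding F_def by (rule DERIV_add[OF DERIV_diff[OF DERIV_diff[OF dL DERIV_const] d2] d3])
      moreover have "inverse (\<epsilon> + z * \<delta>) * \<delta> - 0 - \<delta> / \<epsilon> + z * (\<delta>\<^sup>2 / \<epsilon>\<^sup>2) = z\<^sup>2 * \<delta> ^ 3 / (\<epsilon>\<^sup>2 * (\<epsilon> + z * \<delta>))"
        using nn \<epsilon>n by (simp add: divide_simps) (simp add: power2_eq_square power3_eq_cube algebra_simps)
      ultimately show "(F has_field_derivative (z\<^sup>2 * \<delta> ^ 3 / (\<epsilon>\<^sup>2 * (\<epsilon> + z * \<delta>)))) (at z within closed_segment 0 1)"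
        by (simp add: has_field_derivative_at_within)
      have "cmod (z\<^sup>2 * \<delta> ^ 3 / (\<epsilon>\<^sup>2 * (\<epsilon> + z * \<delta>))) = u\<^sup>2 * cmod \<delta> ^ 3 / (L\<^sup>2 * cmod (\<epsilon> + z * \<delta>))"
        using u by (simp add: norm_divide norm_mult norm_power \<epsilon>L)
      also have "\<dots> \<le> 1 * cmod \<delta> ^ 3 / (L\<^sup>2 * (L / 2))"
        using u \<eta>n order_trans[OF Re complex_Re_le_cmod]
        by (intro frac_le mult_mono mult_pos_pos) (auto simp: power_le_one)
      finally show "cmod (z\<^sup>2 * \<delta> ^ 3 / (\<epsilon>\<^sup>2 * (\<epsilon> + z * \<delta>))) \<le> cmod \<delta> ^ 3 / (L\<^sup>2 * (L / 2))" by simp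
    qed auto
    then have F1: "cmod (F 1) \<le> cmod \<delta> ^ 3 / (L\<^sup>2 * (L / 2))" by (simp add: F_def)
    have "w r = (s - 1) * F 1" unfolding w_def F_def qd \<delta>_def[symmetric] by simp
    then have "cmod (w r) = 2 * pi * L\<^sup>2 * cmod (F 1)" unfolding s1 by (simp add: norm_mult norm_power \<epsilon>L)
    also have "\<dots> \<le> 2 * pi * L\<^sup>2 * (cmod \<delta> ^ 3 / (L\<^sup>2 * (L / 2)))" using F1 by (intro mult_left_mono) auto
    also have "\<dots> = 4 * pi * cmod \<delta> ^ 3 / L" using \<eta>n by (simp add: field_simps power2_eq_square)
    also have "\<dots> \<le> 16 * (m / 2 + \<bar>r\<bar>) ^ 3 / L"
      using dle pi_less_4 \<eta>n by (intro divide_right_mono mult_mono power_mono) auto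
    finally show ?thesis .
  qed
  \<comment> \<open>Off the exact saddle a linear term survives. It equals - pi \<mu>^2 / (2 q), and
    m^2 <= 2 m^3 <= 2 L makes it bounded.\<close>
  define G' where "G' = (s - 1) / q + 2 * of_real pi * q - 2 * of_real pi * (of_real m * rot)"
  have G'le: "cmod G' \<le> 4"
  proof -
    have "q * q - \<mu> * q - \<epsilon>\<^sup>2 = - (\<mu>\<^sup>2 / 4)" unfolding q_eq by (simp add: power2_eq_square field_simps)
    then have "2 * of_real pi * (q * q - \<mu> * q - \<epsilon>\<^sup>2) / q = - (of_real pi * \<mu>\<^sup>2 / (2 * q))" by (simp only:) simp
    moreover have "G' = 2 * of_real pi * (q * q - \<mu> * q - \<epsilon>\<^sup>2) / q"
      unfolding G'_def s1 \<mu>_def[symmetric] using qn by (simp add: field_simps)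
    ultimately have "G' = - (of_real pi * \<mu>\<^sup>2 / (2 * q))" by simp
    then have "cmod G' = pi * m\<^sup>2 / (2 * cmod q)"
      using m by (simp add: norm_divide norm_mult norm_power \<mu>_def cmod_rot)
    also have "\<dots> \<le> 4 * (2 * L) / (2 * L)"
    proof (rule frac_le)
      have "(1 / 2) * m\<^sup>2 \<le> m * m\<^sup>2" using m by (intro mult_right_mono) auto
      also have "\<dots> \<le> L" using mL by (simp add: L_def power3_eq_cube power2_eq_square)
      finally have "m\<^sup>2 \<le> 2 * L" by simp
      then show "pi * m\<^sup>2 \<le> 4 * (2 * L)" using pi_less_4 by (intro mult_mono) auto
      show "2 * L \<le> 2 * cmod q" using pL by (simp add: q_def norm_mult cmod_rot L_def)
    qed (use pi_less_4 \<eta>n in auto)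
    finally show ?thesis using \<eta>n by simp
  qed
  have w0: "Re (w 0) \<le> 2"
  proof -
    have "Re (w 0) \<le> cmod (w 0)" by (rule complex_Re_le_cmod)
    also have "\<dots> \<le> 2 * (m ^ 3 / L)" using wle[of 0] by (simp add: power_divide)
    also have "\<dots> \<le> 2" using mL \<eta>n by (simp add: L_def divide_le_eq)
    finally show ?thesis .
  qed
  \<comment> \<open>The bound \<open>wle\<close> grows like |r|^3 and could not stand in an exponent
    against a Gaussian. The real part is therefore controlled by
    \<open>phase_quadratic_bound\<close>, which holds for all r.\<close>
  have Rew: "- (2 * pi * r\<^sup>2) + Re (w r) \<le> 2 + 4 * \<bar>r\<bar> - 3 / 2 * r\<^sup>2" for r
  proof -
    have "Re (phase m (q + \<i> * of_real r)) \<le> Re (phase m q) + Re (\<i> * of_real r * G') - 3 / 2 * r\<^sup>2"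
      using phase_quadratic_bound[OF pp(1) less_imp_le[OF pp(2)] pL quadrant, of r]
      unfolding phase_taylor[OF qn] G'_def[symmetric] q_def[symmetric] by simp
    also have "Re (\<i> * of_real r * G') \<le> cmod (\<i> * of_real r * G')" by (rule complex_Re_le_cmod)
    also have "cmod (\<i> * of_real r * G') \<le> 4 * \<bar>r\<bar>"
      using mult_left_mono[OF G'le, of "\<bar>r\<bar>"] by (simp add: norm_mult)
    also have "phase m q = A + w 0" using ph[of 0] by simp
    finally show ?thesis unfolding ph using w0 by simp
  qed
  have bound: "cmod (exp (phase m (q + \<i> * of_real r)) - exp A * of_real (exp (- (2 * pi * r\<^sup>2))))
     \<le> exp (Re A) * (m ^ 3 / L) * (32 * exp 52 * exp (- (1 * r\<^sup>2)))" for r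
  proof -
    define R where "R = \<bar>r\<bar>"
    have R0: "R \<ge> 0" "R\<^sup>2 = r\<^sup>2" by (auto simp: R_def)
    have "exp (phase m (q + \<i> * of_real r)) - exp A * of_real (exp (- (2 * pi * r\<^sup>2))) =
       exp A * of_real (exp (- (2 * pi * r\<^sup>2))) * (exp (w r) - 1)"
      unfolding ph exp_add exp_of_real by (simp add: algebra_simps)
    then have "cmod (exp (phase m (q + \<i> * of_real r)) - exp A * of_real (exp (- (2 * pi * r\<^sup>2)))) =
       exp (Re A) * (exp (- (2 * pi * r\<^sup>2)) * cmod (exp (w r) - 1))"
      by (simp only: norm_mult norm_of_real norm_exp_eq_Re) simp
    \<comment> \<open>Because \<open>norm_exp_minus_one_le\<close> keeps exp (Re w) instead of exp
      |w|, the cubic bound enters as a mere factor.\<close>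
    also have "\<dots> \<le> exp (Re A) * (exp (- (2 * pi * r\<^sup>2)) * (cmod (w r) * (1 + exp (Re (w r)))))"
      by (intro mult_left_mono norm_exp_minus_one_le) auto
    also have "\<dots> = exp (Re A) * (cmod (w r) * (exp (- (2 * pi * r\<^sup>2)) + exp (- (2 * pi * r\<^sup>2) + Re (w r))))"
      unfolding exp_add by (simp add: algebra_simps)
    also have "\<dots> \<le> exp (Re A) * ((16 * (m ^ 3 * exp (6 * R)) / L) * (exp (2 + 4 * R - 3 / 2 * R\<^sup>2) + exp (2 + 4 * R - 3 / 2 * R\<^sup>2)))"
    proof (intro mult_left_mono[OF mult_mono] add_mono)
      \<comment> \<open>Extracts m^3 from the cube and leaves exp (6 R) to the Gaussian; m >= 1/2
        enters as R <= 2 m R.\<close>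
      have "m / 2 + R \<le> m * exp (2 * R)"
      proof -
        have "m / 2 + R \<le> m * (1 / 2 + 2 * R)" using mult_right_mono[OF m, of "2 * R"] R0 by (simp add: algebra_simps)
        also have "\<dots> \<le> m * exp (2 * R)" using m exp_ge_add_one_self[of "2 * R"] by (intro mult_left_mono) linarith+
        finally show ?thesis .
      qed
      then have "(m / 2 + R) ^ 3 \<le> (m * exp (2 * R)) ^ 3" using m R0 by (intro power_mono) auto
      also have "\<dots> = m ^ 3 * exp (6 * R)" by (simp add: power_mult_distrib flip: exp_of_nat_mult)
      finally have "16 * (m / 2 + R) ^ 3 / L \<le> 16 * (m ^ 3 * exp (6 * R)) / L" using \<eta>n by (intro divide_right_mono) auto
      then show "cmod (w r) \<le> 16 * (m ^ 3 * exp (6 * R)) / L" using wle[of r] by (simp add: R_def)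
      have "3 / 2 * r\<^sup>2 \<le> 2 * pi * r\<^sup>2" using pi_gt3 by (intro mult_right_mono) auto
      then have "- (2 * pi * r\<^sup>2) \<le> 2 + 4 * R - 3 / 2 * R\<^sup>2" using R0 by simp
      then show "exp (- (2 * pi * r\<^sup>2)) \<le> exp (2 + 4 * R - 3 / 2 * R\<^sup>2)" by simp
      show "exp (- (2 * pi * r\<^sup>2) + Re (w r)) \<le> exp (2 + 4 * R - 3 / 2 * R\<^sup>2)" using Rew[of r] by (simp add: R_def)
    qed (use m \<eta>n in auto)
    also have "\<dots> = exp (Re A) * (m ^ 3 / L) * (32 * exp (2 + 10 * R - 3 / 2 * R\<^sup>2))"
    proof -
      have "exp (2 + 10 * R - 3 / 2 * R\<^sup>2) = exp (6 * R) * exp (2 + 4 * R - 3 / 2 * R\<^sup>2)" by (simp flip: exp_add)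
      then show ?thesis by (simp only:) simp
    qed
    also have "\<dots> \<le> exp (Re A) * (m ^ 3 / L) * (32 * exp (52 - R\<^sup>2))"
    proof (intro mult_left_mono)
      have "0 \<le> (R - 10)\<^sup>2" by simp
      then show "exp (2 + 10 * R - 3 / 2 * R\<^sup>2) \<le> exp (52 - R\<^sup>2)" by (simp add: power2_diff)
    qed (use m \<eta>n in auto)
    also have "exp (52 - R\<^sup>2) = exp 52 * exp (- (1 * r\<^sup>2))" by (simp add: R0 flip: exp_add)
    finally show ?thesis by simp
  qed
  have W: "integrable lborel (\<lambda>r. exp (Re A) * (m ^ 3 / L) * (32 * exp 52 * exp (- (1 * r\<^sup>2))))"
    by (intro integrable_mult_right integrable_exp_neg_square) simp
  have "cmod ((LINT r|lborel. exp (phase m (q + \<i> * of_real r))) - (LINT r|lborel. exp A * of_real (exp (- (2 * pi * r\<^sup>2)))))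
    \<le> (LINT r|lborel. exp (Re A) * (m ^ 3 / L) * (32 * exp 52 * exp (- (1 * r\<^sup>2))))"
    by (rule norm_lborel_integral_diff_le[OF measurable_exp_phase[OF q] _ W bound])
       (intro integrable_mult_right integral_exp_neg_two_pi_square)
  also have "\<dots> = exp (Re A) * (cubic_error_const * m ^ 3 / L)"
    unfolding integral_mult_right_zero cubic_error_const_def by simp
  also have "exp (Re A) = exp (Re (phase 0 (rot * \<eta>))) * exp (- (2 * pi * m * Im \<eta>))"
    using arg_cong[OF expA, of cmod] by (simp add: norm_mult)
  finally show "cmod (bromwich s (of_real m * rot) (Re (rot * (\<eta> + of_real (m / 2)))) -
       exp (phase 0 (rot * \<eta>)) * exp (2 * of_real pi * \<i> * of_real m * \<eta>) * exp (\<i> * of_real (pi * m\<^sup>2 / 2)) / sqrt 2)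
     \<le> exp (Re (phase 0 (rot * \<eta>))) * exp (- (2 * pi * m * Im \<eta>)) * (cubic_error_const * m ^ 3 / cmod \<eta>)"
    unfolding integral_mult_right_zero integral_exp_neg_two_pi_square bromwich_through[OF q, symmetric] expA
    by (simp add: q_def p_def L_def)
qed

end

section \<open>Summation of the error terms\<close>

lemma half_le_one_minus_inverse:
  fixes z :: real
  assumes "0 \<le> z" "z \<le> 1"
  shows "z / 2 \<le> 1 - 1 / (1 + z)"
proof -
  have "z * (1 + z) \<le> z * 2" using assms by (intro mult_left_mono) auto
  then show ?thesis using assms by (simp add: field_simps)
qed

lemma one_minus_exp_ge:
  fixes z :: real
  assumes "0 \<le> z" "z \<le> 1"
  shows "z / 2 \<le> 1 - exp (- z)"
proof -
  have "exp (- z) \<le> 1 / (1 + z)" using exp_ge_add_one_self[of z] assms by (simp add: exp_minus field_simps)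
  with half_le_one_minus_inverse[OF assms] show ?thesis by linarith
qed

lemma cube_le_exp:
  fixes a :: real
  assumes "a \<ge> 0"
  shows "a ^ 3 \<le> 27 * exp a"
proof -
  have "a / 3 \<le> exp (a / 3)" using exp_ge_add_one_self[of "a / 3"] by linarith
  then have "(a / 3) ^ 3 \<le> exp (a / 3) ^ 3" using assms by (intro power_mono) auto
  also have "\<dots> = exp a" by (simp flip: exp_of_nat_mult)
  finally show ?thesis by (simp add: power_divide)
qed

lemma cube_root_ge_8:
  fixes L :: real
  assumes "L \<ge> 512"
  shows "L powr (1 / 3) \<ge> 8" and "(L powr (1 / 3)) ^ 3 = L"
proof -
  show cube: "(L powr (1 / 3)) ^ 3 = L" using assms by (simp add: powr_power)
  show "L powr (1 / 3) \<ge> 8"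
  proof (rule power_le_imp_le_base[of _ 2])
    show "8 ^ Suc 2 \<le> (L powr (1 / 3)) ^ Suc 2" using assms cube by (simp add: numeral_3_eq_3[symmetric])
  qed simp
qed

text \<open>The switch m^3 <= L is m <= T. Below it half of the exponential decay absorbs the cube
  at the cost of Z^(-3). Above it k >= T / 2, so half of that decay is already below exp (- Y T).
  The factor exp (- pi Y) is kept exactly because the main term has it too; elsewhere the cap Z
  copes with unbounded Y.\<close>

lemma error_term_le:
  fixes L Y \<tau> C1 C2 :: real and k :: nat
  defines "m \<equiv> real k + 1 / 2" and "Z \<equiv> min 1 Y" and "T \<equiv> L powr (1 / 3)"
  assumes L: "L \<ge> 512" and Y: "Y > 0" and \<tau>: "\<tau> \<ge> 6 * L * Y" "\<tau> \<ge> 4" and C: "C1 \<ge> 0" "C2 \<ge> 0"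
  shows "(if m ^ 3 \<le> L then exp (- (2 * pi * m * Y)) * (C1 * m ^ 3 / L)
      else C2 * (1 + m / (2 * L)) powr (- \<tau>) + exp (- (2 * pi * m * Y)))
    \<le> exp (- (pi * Y)) * (27 * exp 4 * C1 / (L * Z ^ 3) + exp (- (Y * T))) * exp (- (pi * Z)) ^ k
      + 16 * C2 * L\<^sup>2 * exp (- (3 / 4 * Y * T)) * (1 / (real k + 1)\<^sup>2)"
proof -
  have Z: "0 < Z" "Z \<le> 1" "Z \<le> Y" using Y by (auto simp: Z_def)
  have T8: "T \<ge> 8" and T3: "T ^ 3 = L" unfolding T_def using cube_root_ge_8[OF L] by auto
  have m: "m \<ge> 1 / 2" "m > 0" "m \<le> real k + 1" by (auto simp: m_def)
  have e1: "exp (- (2 * pi * m * Y)) = exp (- (pi * Y)) * exp (- (2 * pi * Y * k))"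
    by (simp add: m_def algebra_simps flip: exp_add)
  have gk: "exp (- (pi * Z)) ^ k = exp (- (pi * Z * k))" by (simp add: mult_ac flip: exp_of_nat_mult)
  show ?thesis
  proof (cases "m ^ 3 \<le> L")
    case True
    have "m ^ 3 * exp (- (2 * pi * Y * k)) \<le> (27 * exp 4 / Z ^ 3) * exp (- (pi * Z * k))"
    proof -
      have "m ^ 3 \<le> (real k + 1) ^ 3" using m by (intro power_mono) auto
      also have "\<dots> = (pi * Z * (real k + 1)) ^ 3 / (pi * Z) ^ 3" using Z by (simp add: power_mult_distrib)
      also have "\<dots> \<le> (27 * exp (pi * Z * (real k + 1))) / Z ^ 3"
      proof (intro frac_le cube_le_exp)
        show "Z ^ 3 \<le> (pi * Z) ^ 3" using Z pi_gt3 by (intro power_mono) (auto simp: mult_le_cancel_right1)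
      qed (use Z in auto)
      also have "\<dots> \<le> (27 * exp (4 + pi * Z * k)) / Z ^ 3"
      proof -
        have "pi * Z \<le> 4 * 1" using Z pi_less_4 by (intro mult_mono) auto
        then show ?thesis using Z by (intro divide_right_mono) (auto simp: algebra_simps)
      qed
      finally have "m ^ 3 \<le> (27 * exp (4 + pi * Z * k)) / Z ^ 3" .
      moreover have "exp (- (2 * pi * Y * k)) \<le> exp (- (2 * pi * Z * k))"
        using Z by (auto intro!: mult_right_mono mult_left_mono)
      ultimately have "m ^ 3 * exp (- (2 * pi * Y * k)) \<le> (27 * exp (4 + pi * Z * k)) / Z ^ 3 * exp (- (2 * pi * Z * k))"
        using m Z by (intro mult_mono) auto
      also have "\<dots> = (27 * exp 4 / Z ^ 3) * (exp (pi * Z * k) * exp (- (2 * pi * Z * k)))" by (simp add: exp_add)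
      also have "exp (pi * Z * k) * exp (- (2 * pi * Z * k)) = exp (- (pi * Z * k))" by (simp flip: exp_add)
      finally show ?thesis .
    qed
    then have "(exp (- (pi * Y)) * C1 / L) * (m ^ 3 * exp (- (2 * pi * Y * k)))
        \<le> (exp (- (pi * Y)) * C1 / L) * ((27 * exp 4 / Z ^ 3) * exp (- (pi * Z * k)))"
      using C L by (intro mult_left_mono) auto
    moreover have "0 \<le> exp (- (pi * Y)) * exp (- (Y * T)) * exp (- (pi * Z * k))
       + 16 * C2 * L\<^sup>2 * exp (- (3 / 4 * Y * T)) * (1 / (real k + 1)\<^sup>2)" using C by simp
    ultimately show ?thesis using True unfolding gk e1 by (simp add: algebra_simps)
  next
    case False
    have mT: "m > T"
    proof (rule ccontr)
      assume "\<not> m > T"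
      then have "m ^ 3 \<le> T ^ 3" using m by (intro power_mono) auto
      with False T3 show False by simp
    qed
    then have kT: "real k \<ge> T / 2" using T8 by (simp add: m_def)
    have "exp (- (2 * pi * m * Y)) \<le> exp (- (pi * Y)) * exp (- (Y * T)) * exp (- (pi * Z * k))"
    proof -
      have "Y * T + pi * Z * k \<le> 2 * pi * Y * k"
      proof -
        have "Y * T \<le> Y * (pi * k)"
        proof (intro mult_left_mono)
          have "T \<le> 2 * real k" using kT by simp
          also have "\<dots> \<le> pi * k" using pi_gt3 by (intro mult_right_mono) auto
          finally show "T \<le> pi * k" .
        qed (use Y in auto)
        moreover have "pi * Z * k \<le> pi * Y * k" using Z by (intro mult_right_mono mult_left_mono) auto
        moreover have "2 * pi * Y * k = Y * (pi * k) + pi * Y * k" by simp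
        ultimately show ?thesis by linarith
      qed
      then show ?thesis unfolding e1 by (simp add: mult.assoc flip: exp_add)
    qed
    moreover have "C2 * (1 + m / (2 * L)) powr (- \<tau>) \<le> 16 * C2 * L\<^sup>2 * exp (- (3 / 4 * Y * T)) * (1 / (real k + 1)\<^sup>2)"
    proof -
      define x0 where "x0 = T / (2 * L)"
      have "T \<le> T * (T * T)" using T8 by (simp add: mult_le_cancel_left1 mult_ge1_I)
      then have TL: "T \<le> L" using T3 by (simp add: power3_eq_cube mult_ac)
      have x0: "0 < x0" "x0 \<le> 1" using T8 L TL by (auto simp: x0_def)
      define B where "B = 1 + m / (2 * L)"
      have B: "B \<ge> 1 + x0" "B > 1" using mT L m by (auto simp: B_def x0_def divide_right_mono)
      \<comment> \<open>Two of the \<tau> powers give summability in k. The remaining \<tau> - 2 >=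
        \<tau> / 2 act on ln B >= x0 / 2, and \<tau> >= 6 L Y makes the product at least 3/4 Y
        T.\<close>
      have "B powr (- \<tau>) = B powr (- (\<tau> - 2)) * B powr (- 2)" by (simp flip: powr_add)
      also have "B powr (- (\<tau> - 2)) \<le> exp (- (3 / 4 * Y * T))"
      proof -
        have "x0 / 2 \<le> ln B"
        proof -
          have "x0 / 2 \<le> 1 - 1 / (1 + x0)" using x0 by (intro half_le_one_minus_inverse) auto
          also have "\<dots> \<le> ln (1 + x0)"
            using ln_le_minus_one[of "1 / (1 + x0)"] x0 by (simp add: ln_div)
          also have "\<dots> \<le> ln B" using B x0 by simp
          finally show ?thesis .
        qed
        moreover have "\<tau> / 2 \<le> \<tau> - 2" using \<tau> by simp
        ultimately have "(\<tau> / 2) * (x0 / 2) \<le> (\<tau> - 2) * ln B" using \<tau> x0 by (intro mult_mono) auto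
        moreover have "3 / 4 * Y * T \<le> (\<tau> / 2) * (x0 / 2)"
        proof -
          have "6 * L * Y * (T / (8 * L)) \<le> \<tau> * (T / (8 * L))" using \<tau> T8 L by (intro mult_right_mono) auto
          then show ?thesis using L by (simp add: x0_def mult_ac)
        qed
        ultimately have "3 / 4 * Y * T \<le> (\<tau> - 2) * ln B" by linarith
        moreover have "B powr (- (\<tau> - 2)) = exp (- ((\<tau> - 2) * ln B))" using B by (auto simp: powr_def algebra_simps)
        ultimately show ?thesis by (simp only: exp_le_cancel_iff neg_le_iff_le)
      qed
      also have "B powr (- 2) \<le> 16 * L\<^sup>2 * (1 / (real k + 1)\<^sup>2)"
      proof -
        have "(real k + 1) / (4 * L) \<le> B"
        proof -
          have "(real k + 1) / (4 * L) \<le> (2 * m) / (4 * L)" using L by (intro divide_right_mono) (auto simp: m_def)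
          then show ?thesis using L by (simp add: B_def)
        qed
        then have "((real k + 1) / (4 * L))\<^sup>2 \<le> B\<^sup>2" using L by (intro power_mono) auto
        then have "1 / B\<^sup>2 \<le> 1 / ((real k + 1) / (4 * L))\<^sup>2" using L by (intro divide_left_mono) (use B in auto)
        moreover have "B powr (- 2) = 1 / B\<^sup>2" using B by (simp add: powr_minus inverse_eq_divide)
        ultimately show ?thesis by (simp add: power_divide power_mult_distrib)
      qed
      finally have "B powr (- \<tau>) \<le> exp (- (3 / 4 * Y * T)) * (16 * L\<^sup>2 * (1 / (real k + 1)\<^sup>2))"
        using B by (simp add: mult_mono')
      from mult_left_mono[OF this C(2)] show ?thesis unfolding B_def by (simp add: mult_ac)
    qed
    moreover have "0 \<le> exp (- (pi * Y)) * (27 * exp 4 * C1 / (L * Z ^ 3)) * exp (- (pi * Z * k))"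
      using C L Z by simp
    ultimately show ?thesis using False unfolding gk by (simp add: algebra_simps)
  qed
qed

text \<open>Relative to exp (- pi Y) the near errors sum to order 1 / (L Z^4), three powers of Z
  from the cube and one from the geometric series. The target has order Z, hence the condition L Z^5
  >= Q behind \<open>K\<close>. The far errors are exponentially small in Y T >= L^(2/15), where
  2/15 = 1/3 - 1/5. Each of three contributions is allotted Z / 18.\<close>

lemma error_series_le:
  fixes C1 C2 :: real
  assumes C: "C1 \<ge> 0" "C2 > 0"
  shows "\<exists>K\<ge>1. \<exists>L0\<ge>1. \<forall>L Y \<tau>. L \<ge> L0 \<and> Y \<ge> K * L powr (- 1 / 5) \<and> \<tau> \<ge> 6 * L * Y \<longrightarrow>
    (\<exists>b B. (\<forall>k. (let m = real k + 1 / 2 in if m ^ 3 \<le> L then exp (- (2 * pi * m * Y)) * (C1 * m ^ 3 / L)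
      else C2 * (1 + m / (2 * L)) powr (- \<tau>) + exp (- (2 * pi * m * Y))) \<le> b k) \<and>
      b sums B \<and> B \<le> exp (- (pi * Y)) * (1 - exp (- (2 * pi * Y))) / 3)"
proof -
  \<comment> \<open>972 = 27 * 2 * 18: the constant of \<open>cube_le_exp\<close>, the bound 2 / Z
    for the geometric series, and the share Z / 18. Below, 36 = 2 * 18 and 1152 = 64 * 18 arise
    likewise.\<close>
  define Q where "Q = 972 * exp 4 * C1"
  have Q: "Q \<ge> 0" using C by (simp add: Q_def)
  have ev1: "eventually (\<lambda>L::real. 36 * exp (- (L powr (2 / 15))) \<le> L powr (- 2 / 5)) at_top"
    by real_asymp
  have ev2: "eventually (\<lambda>L::real. 1152 * C2 * L\<^sup>2 * exp (- (L powr (2 / 15) / 4)) \<le> L powr (- 1 / 5)) at_top"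
    using C by real_asymp
  have "eventually (\<lambda>L. 36 * exp (- (L powr (2 / 15))) \<le> L powr (- 2 / 5) \<and>
      1152 * C2 * L\<^sup>2 * exp (- (L powr (2 / 15) / 4)) \<le> L powr (- 1 / 5) \<and> L \<ge> Q \<and> L \<ge> 512) at_top"
    using ev1 ev2 eventually_ge_at_top[of Q] eventually_ge_at_top[of 512] by eventually_elim auto
  then obtain L0 where L0: "\<And>L. L \<ge> L0 \<Longrightarrow> 36 * exp (- (L powr (2 / 15))) \<le> L powr (- 2 / 5) \<and>
      1152 * C2 * L\<^sup>2 * exp (- (L powr (2 / 15) / 4)) \<le> L powr (- 1 / 5) \<and> L \<ge> Q \<and> L \<ge> 512"
    by (auto simp: eventually_at_top_linorder)
  define K where "K = max 1 Q"
  have K: "K \<ge> 1" "K \<ge> Q" by (auto simp: K_def)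
  show ?thesis
  proof (rule exI[of _ K], intro conjI exI[of _ "max 1 L0"] allI impI)
    fix L Y \<tau> :: real
    assume "max 1 L0 \<le> L \<and> Y \<ge> K * L powr (- 1 / 5) \<and> \<tau> \<ge> 6 * L * Y"
    then have L: "L \<ge> L0" and YK: "Y \<ge> K * L powr (- 1 / 5)" and \<tau>: "\<tau> \<ge> 6 * L * Y" by auto
    note l = L0[OF L]
    have L512: "L \<ge> 512" and LQ: "L \<ge> Q" using l by auto
    define Z T where "Z = min 1 Y" and "T = L powr (1 / 3)"
    have Y1: "Y \<ge> L powr (- 1 / 5)"
      using YK mult_right_mono[OF K(1), of "L powr (- 1 / 5)"] by simp
    have Y0: "Y > 0" using Y1 L512 by (smt (verit) powr_gt_zero)
    have "L powr (- 1 / 5) \<le> L powr 0" using L512 by (intro powr_mono) auto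
    then have Z1: "Z \<ge> L powr (- 1 / 5)" using Y1 L512 by (simp add: Z_def)
    have Z: "0 < Z" "Z \<le> 1" "Z \<le> Y" using Y0 by (auto simp: Z_def)
    have YT: "Y * T \<ge> L powr (2 / 15)"
    proof -
      have "L powr (- 1 / 5) * L powr (1 / 3) \<le> Y * T" unfolding T_def using Y1 by (intro mult_right_mono) auto
      then show ?thesis by (simp flip: powr_add)
    qed
    have T8: "T \<ge> 8" unfolding T_def using cube_root_ge_8[OF L512] by auto
    have \<tau>4: "\<tau> \<ge> 4"
    proof -
      have "6 * L * L powr (- 1 / 5) \<le> 6 * L * Y" using Y1 L512 by (intro mult_left_mono) auto
      moreover have "L * L powr (- 1 / 5) = L powr (4 / 5)" using L512 powr_add[of L 1 "- 1 / 5"] by simp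
      moreover have "1 powr (4 / 5) \<le> L powr (4 / 5)" using L512 by (intro powr_mono2) auto
      ultimately show ?thesis using \<tau> by simp
    qed
    define g where "g = exp (- (pi * Z))"
    define D1 where "D1 = exp (- (pi * Y)) * (27 * exp 4 * C1 / (L * Z ^ 3) + exp (- (Y * T)))"
    define D2 where "D2 = 16 * C2 * L\<^sup>2 * exp (- (3 / 4 * Y * T))"
    define b where "b k = D1 * g ^ k + D2 * (1 / (real k + 1)\<^sup>2)" for k
    have g: "0 < g" "g < 1" using Z by (auto simp: g_def)
    have "(\<lambda>k. g ^ k) sums (1 / (1 - g))" using g by (intro geometric_sums) auto
    moreover have "(\<lambda>k. 1 / (real k + 1)\<^sup>2) sums (pi\<^sup>2 / 6)" using inverse_squares_sums by (simp add: add.commute)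
    ultimately have bs: "b sums (D1 * (1 / (1 - g)) + D2 * (pi\<^sup>2 / 6))"
      unfolding b_def by (intro sums_add sums_mult)
    have le: "\<forall>k. (let m = real k + 1 / 2 in if m ^ 3 \<le> L then exp (- (2 * pi * m * Y)) * (C1 * m ^ 3 / L)
      else C2 * (1 + m / (2 * L)) powr (- \<tau>) + exp (- (2 * pi * m * Y))) \<le> b k"
      using error_term_le[OF L512 Y0 \<tau> \<tau>4 C(1) less_imp_le[OF C(2)]]
      unfolding Let_def b_def D1_def D2_def g_def Z_def T_def by blast
    define P where "P = exp (- (pi * Y))"
    have P: "P > 0" by (simp add: P_def)
    have "Z / 2 \<le> 1 - exp (- Z)" using Z by (intro one_minus_exp_ge) auto
    also have "\<dots> \<le> 1 - g" using Z pi_gt3 by (simp add: g_def)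
    finally have g2: "1 / (1 - g) \<le> 2 / Z" using Z g by (simp add: field_simps)
    have v2: "Z / 2 \<le> 1 - exp (- (2 * pi * Y))"
    proof -
      have "Z * 1 \<le> Y * (2 * pi)" using Z pi_gt3 by (intro mult_mono) auto
      then have "exp (- (2 * pi * Y)) \<le> exp (- Z)" by (simp add: mult_ac)
      moreover have "Z / 2 \<le> 1 - exp (- Z)" using Z by (intro one_minus_exp_ge) auto
      ultimately show ?thesis by linarith
    qed
    have t1: "(27 * exp 4 * C1 / (L * Z ^ 3)) * (2 / Z) \<le> Z / 18"
    proof -
      \<comment> \<open>For Z = 1 this is the size of L. For Z = Y it is the fifth power of the
        lower bound on Y, with K^5 >= K >= Q.\<close>
      have "Q \<le> L * Z ^ 5"
      proof (cases "Y \<ge> 1")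
        case True then show ?thesis using LQ by (simp add: Z_def)
      next
        case False
        then have "Z = Y" by (simp add: Z_def)
        have pow: "(K * L powr (- 1 / 5)) ^ 5 \<le> Y ^ 5" using YK K by (intro power_mono) auto
        have eq: "(K * L powr (- 1 / 5)) ^ 5 = K ^ 5 / L" 
          using L512 by (simp add: power_mult_distrib powr_power powr_minus inverse_eq_divide power_divide)
        have "K ^ 5 \<le> L * Z ^ 5" using pow[unfolded eq] L512 \<open>Z = Y\<close> by (simp add: field_simps)
        moreover have "K ^ 1 \<le> K ^ 5" using K by (intro power_increasing) auto
        ultimately show ?thesis using K by simp
      qed
      then have "(54 * exp 4 * C1) * 18 \<le> L * Z ^ 5" by (simp add: Q_def)
      then show ?thesis using L512 Z by (simp add: field_simps eval_nat_numeral)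
    qed
    have t2: "exp (- (Y * T)) * (2 / Z) \<le> Z / 18"
    proof -
      have "36 * exp (- (Y * T)) \<le> 36 * exp (- (L powr (2 / 15)))" using YT by simp
      also have "\<dots> \<le> L powr (- 2 / 5)" using l by simp
      also have "\<dots> = (L powr (- 1 / 5))\<^sup>2" using L512 by (simp add: powr_power)
      also have "\<dots> \<le> Z\<^sup>2" using Z1 by (intro power_mono) auto
      finally show ?thesis using Z by (simp add: field_simps power2_eq_square)
    qed
    have t3: "D2 * (pi\<^sup>2 / 6) \<le> P * (Z / 18)"
    proof -
      have "pi\<^sup>2 \<le> 4\<^sup>2" using pi_less_4 by (intro power_mono) auto
      then have "D2 * (pi\<^sup>2 / 6) \<le> D2 * 4" using C by (intro mult_left_mono) (auto simp: D2_def)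
      also have "\<dots> = 64 * C2 * L\<^sup>2 * exp (- (3 / 4 * Y * T))" by (simp add: D2_def)
      also have "\<dots> \<le> 64 * C2 * L\<^sup>2 * (P * exp (- (L powr (2 / 15) / 4)))"
      proof (intro mult_left_mono)
        \<comment> \<open>Half of Y T pays for exp (- pi Y), since T / 2 >= 4; the other quarter
          supplies the decay.\<close>
        have "pi * Y \<le> (T / 2) * Y" using T8 pi_less_4 Y0 by (intro mult_right_mono) auto
        then have "pi * Y + L powr (2 / 15) / 4 \<le> 3 / 4 * Y * T" using YT by (simp add: algebra_simps)
        then show "exp (- (3 / 4 * Y * T)) \<le> P * exp (- (L powr (2 / 15) / 4))"
          unfolding P_def by (simp flip: exp_add)
      qed (use C in auto)
      also have "\<dots> = P * (1152 * C2 * L\<^sup>2 * exp (- (L powr (2 / 15) / 4)) / 18)" by simp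
      also have "\<dots> \<le> P * (Z / 18)" using l Z1 P by (intro mult_left_mono divide_right_mono) auto
      finally show ?thesis .
    qed
    have "D1 * (1 / (1 - g)) \<le> D1 * (2 / Z)"
      using g2 C L512 Z by (intro mult_left_mono) (auto simp: D1_def)
    also have "\<dots> = P * ((27 * exp 4 * C1 / (L * Z ^ 3)) * (2 / Z) + exp (- (Y * T)) * (2 / Z))"
      by (simp add: D1_def P_def algebra_simps)
    also have "\<dots> \<le> P * (Z / 18 + Z / 18)" using t1 t2 P by (intro mult_left_mono add_mono) auto
    finally have "D1 * (1 / (1 - g)) + D2 * (pi\<^sup>2 / 6) \<le> P * ((Z / 2) / 3)" using t3 by (simp add: algebra_simps)
    also have "\<dots> \<le> P * ((1 - exp (- (2 * pi * Y))) / 3)" using v2 P by (intro mult_left_mono divide_right_mono) auto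
    finally have "D1 * (1 / (1 - g)) + D2 * (pi\<^sup>2 / 6) \<le> exp (- (pi * Y)) * (1 - exp (- (2 * pi * Y))) / 3"
      by (simp add: P_def)
    with bs le show "\<exists>b B. (\<forall>k. (let m = real k + 1 / 2 in if m ^ 3 \<le> L then exp (- (2 * pi * m * Y)) * (C1 * m ^ 3 / L)
      else C2 * (1 + m / (2 * L)) powr (- \<tau>) + exp (- (2 * pi * m * Y))) \<le> b k) \<and>
      b sums B \<and> B \<le> exp (- (pi * Y)) * (1 - exp (- (2 * pi * Y))) / 3" by blast
  qed (use K in auto)
qed

section \<open>Comparison with the main term\<close>

text \<open>The coefficients satisfy d (k + 2) = - d k and d 1 = - d 0. With W = exp (i pi \<eta>),
  |W| < 1, shifting the series by two terms gives S (1 + W^4) = d 0 (1 - W^2).\<close>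

lemma quadratic_phase_series:
  assumes Y: "Im \<eta> > 0"
  shows "(\<lambda>k. exp (2 * of_real pi * \<i> * of_real (real k + 1 / 2) * \<eta>) * exp (\<i> * of_real (pi * (real k + 1 / 2)\<^sup>2 / 2)))
    sums (- \<i> * exp (\<i> * of_real (pi / 8)) * sin (of_real pi * \<eta>) / cos (2 * of_real pi * \<eta>))"
proof -
  define W where "W = exp (\<i> * of_real pi * \<eta>)"
  define d where "d k = exp (\<i> * of_real (pi * (real k + 1 / 2)\<^sup>2 / 2))" for k :: nat
  have W1: "cmod W < 1" using Y by (simp add: W_def)
  then have W2: "cmod (W\<^sup>2) < 1" by (simp add: norm_power power_less_one_iff)
  have Wn: "W \<noteq> 0" by (simp add: W_def)
  have W4: "1 + W ^ 4 \<noteq> 0"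
  proof
    assume "1 + W ^ 4 = 0"
    then have "W ^ 4 = - 1" by (simp add: add_eq_0_iff)
    then have "cmod (W ^ 4) = 1" by simp
    moreover have "cmod (W ^ 4) < 1" using W1 by (simp add: norm_power power_less_one_iff)
    ultimately show False by simp
  qed
  have dS: "d (k + 2) = - d k" for k
  proof -
    have "pi * (real (k + 2) + 1 / 2)\<^sup>2 / 2 = pi * (real k + 1 / 2)\<^sup>2 / 2 + (2 * real k + 3) * pi"
      by (simp add: power2_eq_square field_simps)
    then have "d (k + 2) = d k * exp (\<i> * of_real ((2 * real k + 3) * pi))"
      unfolding d_def by (simp only: of_real_add distrib_left exp_add)
    also have "exp (\<i> * of_real ((2 * real k + 3) * pi)) = cis (real (2 * k + 3) * pi)" by (simp add: cis_conv_exp)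
    also have "\<dots> = cis pi ^ (2 * k + 3)" by (rule Complex.DeMoivre[symmetric])
    finally show ?thesis by (simp add: power_add power_mult)
  qed
  have d0: "d 0 = exp (\<i> * of_real (pi / 8))" by (simp add: d_def power2_eq_square)
  have d1: "d 1 = - d 0"
  proof -
    have "pi * (real 1 + 1 / 2)\<^sup>2 / 2 = pi * (real 0 + 1 / 2)\<^sup>2 / 2 + pi" by (simp add: power2_eq_square field_simps)
    then have "d 1 = d 0 * exp (\<i> * of_real pi)" unfolding d_def by (simp only: of_real_add distrib_left exp_add)
    then show ?thesis by simp
  qed
  have nd: "cmod (d k) = 1" for k by (simp add: d_def)
  have "summable (\<lambda>k. d k * (W\<^sup>2) ^ k)"
    by (rule summable_comparison_test'[of "\<lambda>k. cmod (W\<^sup>2) ^ k" 0])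
       (use W2 in \<open>auto simp: norm_mult nd norm_power intro: summable_geometric\<close>)
  then obtain S where S: "(\<lambda>k. d k * (W\<^sup>2) ^ k) sums S" by (auto simp: summable_def)
  have "(\<lambda>k. d (k + 2) * (W\<^sup>2) ^ (k + 2)) sums (S - (\<Sum>k<2. d k * (W\<^sup>2) ^ k))"
    by (rule sums_split_initial_segment[OF S])
  moreover have "(\<lambda>k. d (k + 2) * (W\<^sup>2) ^ (k + 2)) = (\<lambda>k. (- (W ^ 4)) * (d k * (W\<^sup>2) ^ k))"
    unfolding dS by (simp add: fun_eq_iff power_add eval_nat_numeral)
  moreover have "(\<lambda>k. (- (W ^ 4)) * (d k * (W\<^sup>2) ^ k)) sums ((- (W ^ 4)) * S)" by (rule sums_mult[OF S])
  ultimately have "S - (\<Sum>k<2. d k * (W\<^sup>2) ^ k) = (- (W ^ 4)) * S" using sums_unique2 by metis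
  then have "S * (1 + W ^ 4) = d 0 * (1 - W\<^sup>2)"
    using d1 by (simp add: eval_nat_numeral algebra_simps)
  then have Seq: "S = d 0 * (1 - W\<^sup>2) / (1 + W ^ 4)" using W4 by (simp add: field_simps)
  have "(\<lambda>k. W * (d k * (W\<^sup>2) ^ k)) sums (W * S)" by (rule sums_mult[OF S])
  moreover have "W * (d k * (W\<^sup>2) ^ k) = exp (2 * of_real pi * \<i> * of_real (real k + 1 / 2) * \<eta>) * exp (\<i> * of_real (pi * (real k + 1 / 2)\<^sup>2 / 2))" for k
  proof -
    have "W * (W\<^sup>2) ^ k = W ^ (2 * k + 1)" by (simp add: power_mult)
    also have "\<dots> = exp (of_nat (2 * k + 1) * (\<i> * of_real pi * \<eta>))" unfolding W_def by (simp only: exp_of_nat_mult)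
    also have "of_nat (2 * k + 1) * (\<i> * of_real pi * \<eta>) = 2 * of_real pi * \<i> * of_real (real k + 1 / 2) * \<eta>"
      by (simp add: field_simps)
    finally show ?thesis by (simp add: d_def mult_ac)
  qed
  moreover have "W * S = - \<i> * exp (\<i> * of_real (pi / 8)) * sin (of_real pi * \<eta>) / cos (2 * of_real pi * \<eta>)"
  proof -
    have sn: "sin (of_real pi * \<eta>) = \<i> * (1 - W\<^sup>2) / (2 * W)"
      unfolding sin_exp_eq W_def using Wn by (simp add: exp_minus field_simps power2_eq_square)
    have W2e: "W\<^sup>2 = exp (\<i> * (2 * of_real pi * \<eta>))" unfolding W_def by (simp add: power2_eq_square mult_ac flip: exp_add)
    have cs: "cos (2 * of_real pi * \<eta>) = (1 + W ^ 4) / (2 * W\<^sup>2)"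
    proof -
      have "W ^ 4 = W\<^sup>2 * W\<^sup>2" by (simp add: eval_nat_numeral)
      then show ?thesis unfolding cos_exp_eq W2e by (simp add: exp_minus field_simps)
    qed
    have "W * (c * a / B) = - \<i> * c * (\<i> * a / (2 * W)) / (B / (2 * W\<^sup>2))" if "B \<noteq> 0" for a B c
      using Wn that by (simp add: power2_eq_square mult_ac)
    from this[OF W4] show ?thesis unfolding sn cs Seq d0 .
  qed
  ultimately show ?thesis by simp
qed

text \<open>Numerator and denominator are bounded separately, by sinh (pi Im \<eta>) from below and
  exp (2 pi Im \<eta>) from above. Nothing about Re \<eta> enters, so closeness to real zeros of
  sine or cosine does no harm.\<close>

lemma cmod_sin_div_cos_ge:
  assumes Y: "Im \<eta> > 0"
  shows "exp (- (pi * Im \<eta>)) * (1 - exp (- (2 * pi * Im \<eta>))) / 2 \<le> cmod (sin (of_real pi * \<eta>) / cos (2 * of_real pi * \<eta>))"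
proof -
  define y where "y = Im \<eta>"
  have y: "y > 0" using Y by (simp add: y_def)
  have sn: "sinh (pi * y) \<le> cmod (sin (of_real pi * \<eta>))"
  proof (rule power2_le_imp_le)
    show "(sinh (pi * y))\<^sup>2 \<le> (cmod (sin (of_real pi * \<eta>)))\<^sup>2" unfolding cmod_sin_squared by (simp add: y_def)
  qed simp
  have cn: "cos (2 * of_real pi * \<eta>) \<noteq> 0"
  proof
    assume "cos (2 * of_real pi * \<eta>) = 0"
    then have "norm (cos (2 * of_real pi * \<eta>)) ^ 2 = 0" by simp
    then have "(exp (2 * pi * y) - inverse (exp (2 * pi * y)))\<^sup>2 = 0"
      unfolding norm_cos_squared by (simp add: y_def add_nonneg_eq_0_iff)
    then have "exp (2 * pi * y) = exp (- (2 * pi * y))" by (simp add: exp_minus)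
    then show False using y by simp
  qed
  have cs: "cmod (cos (2 * of_real pi * \<eta>)) \<le> exp (2 * pi * y)"
  proof -
    have "cmod (cos (2 * of_real pi * \<eta>)) \<le> (cmod (exp (\<i> * (2 * of_real pi * \<eta>))) + cmod (exp (- (\<i> * (2 * of_real pi * \<eta>))))) / 2"
      unfolding cos_exp_eq norm_divide norm_numeral by (intro divide_right_mono norm_triangle_ineq) simp
    also have "\<dots> = (exp (- (2 * pi * y)) + exp (2 * pi * y)) / 2" by (simp add: y_def)
    also have "exp (- (2 * pi * y)) \<le> exp (2 * pi * y)" using y by simp
    finally show ?thesis by simp
  qed
  have "exp (- (pi * y)) * (1 - exp (- (2 * pi * y))) / 2 = sinh (pi * y) / exp (2 * pi * y)"
  proof -
    define E where "E = exp (pi * y)"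
    have "E > 0" by (simp add: E_def)
    moreover have "exp (2 * pi * y) = E * E" by (simp add: E_def flip: exp_add)
    ultimately show ?thesis unfolding sinh_def exp_minus E_def[symmetric] by (simp add: field_simps)
  qed
  also have "\<dots> \<le> cmod (sin (of_real pi * \<eta>)) / cmod (cos (2 * of_real pi * \<eta>))"
    using sn cs cn y by (intro frac_le) auto
  finally show "exp (- (pi * Im \<eta>)) * (1 - exp (- (2 * pi * Im \<eta>))) / 2 \<le> cmod (sin (of_real pi * \<eta>) / cos (2 * of_real pi * \<eta>))"
    by (simp add: norm_divide y_def)
qed

text \<open>(s - 1) / (2 pi i) = (t + i (1 - \<sigma>)) / (2 pi) lies in the open first quadrant.
  Its principal root falls into the prescribed window of arguments, the other one lies in the third
  quadrant, which the window misses; this resolves the definite description.\<close>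

lemma eta_quadrant:
  assumes \<sigma>: "\<sigma> < 1" and t: "t > 0"
  defines "s \<equiv> Complex \<sigma> t"
  shows "(eta s)\<^sup>2 = Complex t (1 - \<sigma>) / of_real (2 * pi)" "0 < Re (eta s)" "0 < Im (eta s)" "Im (eta s) \<le> Re (eta s)"
proof -
  define z where "z = Complex t (1 - \<sigma>) / of_real (2 * pi)"
  have z: "Re z > 0" "Im z > 0" using \<sigma> t by (auto simp: z_def Re_divide_of_real Im_divide_of_real simp del: of_real_mult)
  have ze: "(s - 1) / (2 * pi * \<i>) = z"
    by (simp add: z_def s_def complex_eq_iff Re_divide Im_divide power2_eq_square diff_divide_distrib)
  define w where "w = csqrt z"
  have w2: "w\<^sup>2 = z" by (simp add: w_def)
  have "Re w \<ge> 0" using csqrt_principal[of z] unfolding w_def by linarith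
  moreover have "Re w * Im w * 2 = Im z" using arg_cong[OF w2, of Im] by (simp add: power2_eq_square mult_ac)
  ultimately have w: "Re w > 0" "Im w > 0" using z by (smt (verit) zero_less_mult_iff)+
  have "(Re w)\<^sup>2 - (Im w)\<^sup>2 = Re z" using arg_cong[OF w2, of Re] by (simp add: power2_eq_square)
  then have "(Im w)\<^sup>2 \<le> (Re w)\<^sup>2" using z by simp
  then have w': "Im w \<le> Re w" by (rule power2_le_imp_le) (use w in simp)
  have wn: "w \<noteq> 0" using w by auto
  have "eta s = w"
    unfolding eta_def ze
  proof (rule the_equality)
    have "0 < Arg w" "Arg w < pi / 2"
      using Im_Ln_pos_lt[OF wn] Re_Ln_pos_lt[OF wn] w wn by (auto simp: Arg_eq_Im_Ln)
    then show "w\<^sup>2 = z \<and> - pi / 4 < Arg w \<and> Arg w < 3 * pi / 4" using w2 by auto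
  next
    fix x assume x: "x\<^sup>2 = z \<and> - pi / 4 < Arg x \<and> Arg x < 3 * pi / 4"
    then have "x\<^sup>2 = w\<^sup>2" using w2 by simp
    then have "x = w \<or> x = - w" by (simp add: power2_eq_iff)
    \<comment> \<open>Im (- w) < 0 excludes a positive argument, and an argument in (- pi / 4, 0]
      would force a positive real part.\<close>
    moreover have "x \<noteq> - w"
    proof
      assume xw: "x = - w"
      then have xn: "x \<noteq> 0" using wn by simp
      have "\<not> (0 < Arg x)" using xw w Im_Ln_pos_lt[OF xn] Im_Ln_le_pi[OF xn] Im_Ln_eq_pi[OF xn] xn
        by (auto simp: Arg_eq_Im_Ln less_le)
      then have "\<bar>Im (Ln x)\<bar> < pi / 2" using x xn by (auto simp: Arg_eq_Im_Ln)
      then have "0 < Re x" using Re_Ln_pos_lt[OF xn] by simp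
      then show False using xw w by simp
    qed
    ultimately show "x = w" by blast
  qed
  then show "(eta s)\<^sup>2 = Complex t (1 - \<sigma>) / of_real (2 * pi)" "0 < Re (eta s)" "0 < Im (eta s)" "Im (eta s) \<le> Re (eta s)"
    using w w' w2 by (auto simp: z_def)
qed

context saddle begin

text \<open>Termwise comparison: near terms by \<open>bromwich_main_bound\<close>, far terms by
  estimating the integral and the Gaussian value separately, both being small there. Each
  \<open>\<kappa> k\<close> is the line of the estimate applied to that term.\<close>

lemma bromwich_series_near_main:
  fixes b :: "nat \<Rightarrow> real"
  defines "\<Lambda> \<equiv> exp (phase 0 (rot * \<eta>))"
  defines "C2 \<equiv> 1 + (LINT r::real|lborel. exp (- (3 / 2 * r\<^sup>2)))"
  assumes b: "\<And>k. (let m = real k + 1 / 2 in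
       if m ^ 3 \<le> cmod \<eta> then exp (- (2 * pi * m * Im \<eta>)) * (cubic_error_const * m ^ 3 / cmod \<eta>)
       else C2 * (1 + m / (2 * cmod \<eta>)) powr (- (2 * pi * Im (\<eta>\<^sup>2))) + exp (- (2 * pi * m * Im \<eta>))) \<le> b k"
    and B: "b sums B" "B \<le> exp (- (pi * Im \<eta>)) * (1 - exp (- (2 * pi * Im \<eta>))) / 3"
  shows "\<exists>\<kappa>. (\<forall>k. 0 < \<kappa> k) \<and> (\<forall>X. (\<lambda>k. bromwich s (node k) (\<kappa> k)) sums X \<longrightarrow>
     (\<exists>U. cmod U < 1 \<and> X = \<Lambda> / sqrt 2 * (- \<i> * exp (\<i> * of_real (pi / 8)) * sin (of_real pi * \<eta>) / cos (2 * of_real pi * \<eta>)) * (1 + U)))"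
proof -
  define m where "m k = real k + 1 / 2" for k :: nat
  define \<kappa> where "\<kappa> k = (if m k ^ 3 \<le> cmod \<eta> then Re (rot * (\<eta> + of_real (m k / 2))) else Re (rot * saddle_pt (m k)))" for k
  define T where "T k = \<Lambda> / sqrt 2 * (exp (2 * of_real pi * \<i> * of_real (m k) * \<eta>) * exp (\<i> * of_real (pi * (m k)\<^sup>2 / 2)))" for k
  define M where "M = \<Lambda> / sqrt 2 * (- \<i> * exp (\<i> * of_real (pi / 8)) * sin (of_real pi * \<eta>) / cos (2 * of_real pi * \<eta>))"
  have m: "m k \<ge> 1 / 2" "m k \<ge> 0" for k by (auto simp: m_def)
  have n\<Lambda>: "cmod \<Lambda> = exp (Re (phase 0 (rot * \<eta>)))" by (simp add: \<Lambda>_def)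
  have \<Lambda>pos: "cmod \<Lambda> > 0" by (simp add: \<Lambda>_def)
  have node: "node k = of_real (m k) * rot" for k by (simp add: node_def rot_def m_def)
  have \<kappa>: "0 < \<kappa> k" for k
    using bromwich_main_bound(1)[OF m(1)[of k]] bromwich_tail_bound(1)[OF m(2)[of k]] by (auto simp: \<kappa>_def)
  have T: "T sums M" unfolding T_def M_def m_def by (intro sums_mult quadratic_phase_series Im_pos)
  have diff: "cmod (bromwich s (node k) (\<kappa> k) - T k) \<le> cmod \<Lambda> * b k" for k
  proof (cases "m k ^ 3 \<le> cmod \<eta>")
    case True
    have "cmod (bromwich s (node k) (\<kappa> k) - T k) \<le> cmod \<Lambda> * (exp (- (2 * pi * m k * Im \<eta>)) * (cubic_error_const * m k ^ 3 / cmod \<eta>))"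
      using bromwich_main_bound(2)[OF m(1) True] True unfolding node n\<Lambda> T_def \<Lambda>_def[symmetric] \<kappa>_def
      by (simp add: mult_ac)
    also have "\<dots> \<le> cmod \<Lambda> * b k" using b[of k] True by (intro mult_left_mono) (auto simp: m_def Let_def)
    finally show ?thesis .
  next
    case False
    have "cmod (bromwich s (node k) (\<kappa> k) - T k) \<le> cmod (bromwich s (node k) (\<kappa> k)) + cmod (T k)" by (rule norm_triangle_ineq4)
    also have "cmod (bromwich s (node k) (\<kappa> k)) \<le> cmod \<Lambda> * (C2 * (1 + m k / (2 * cmod \<eta>)) powr (- (2 * pi * Im (\<eta>\<^sup>2))))"
    proof -
      have "cmod (bromwich s (node k) (\<kappa> k)) \<le> (C2 - 1) * (cmod \<Lambda> * (1 + m k / (2 * cmod \<eta>)) powr (- (2 * pi * Im (\<eta>\<^sup>2))))"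
        using bromwich_tail_bound(2)[OF m(2)[of k]] False unfolding node n\<Lambda> C2_def \<kappa>_def by simp
      also have "\<dots> \<le> C2 * (cmod \<Lambda> * (1 + m k / (2 * cmod \<eta>)) powr (- (2 * pi * Im (\<eta>\<^sup>2))))"
        by (intro mult_right_mono) auto
      finally show ?thesis by (simp add: mult_ac)
    qed
    also have "cmod (T k) \<le> cmod \<Lambda> * exp (- (2 * pi * m k * Im \<eta>))"
    proof -
      have "cmod (T k) = cmod \<Lambda> / sqrt 2 * exp (- (2 * pi * m k * Im \<eta>))"
        by (simp add: T_def norm_mult norm_divide)
      also have "\<dots> \<le> cmod \<Lambda> / 1 * exp (- (2 * pi * m k * Im \<eta>))"
        by (intro mult_right_mono divide_left_mono) auto
      finally show ?thesis by simp
    qed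
    also have "cmod \<Lambda> * (C2 * (1 + m k / (2 * cmod \<eta>)) powr (- (2 * pi * Im (\<eta>\<^sup>2)))) + cmod \<Lambda> * exp (- (2 * pi * m k * Im \<eta>)) \<le> cmod \<Lambda> * b k"
      unfolding distrib_left[symmetric] using b[of k] False by (intro mult_left_mono) (auto simp: m_def Let_def)
    finally show ?thesis by simp
  qed
  define P where "P = exp (- (pi * Im \<eta>)) * (1 - exp (- (2 * pi * Im \<eta>)))"
  have P: "P > 0" using Im_pos by (simp add: P_def)
  have "\<exists>U. cmod U < 1 \<and> X = M * (1 + U)" if X: "(\<lambda>k. bromwich s (node k) (\<kappa> k)) sums X" for X
  proof -
    have s1: "(\<lambda>k. bromwich s (node k) (\<kappa> k) - T k) sums (X - M)" by (rule sums_diff[OF X T])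
    have s2: "(\<lambda>k. cmod \<Lambda> * b k) sums (cmod \<Lambda> * B)" by (rule sums_mult[OF B(1)])
    have "cmod (X - M) \<le> cmod \<Lambda> * B"
      using norm_suminf_le[OF diff sums_summable[OF s2]] sums_unique[OF s1] sums_unique[OF s2] by simp
    also have "\<dots> \<le> cmod \<Lambda> * (P / 3)" using B(2) by (intro mult_left_mono) (auto simp: P_def)
    \<comment> \<open>The factor 1 / sqrt 2 is the Gaussian integral and 1/2 comes from
      \<open>cmod_sin_div_cos_ge\<close>. That 1/3 < 1 / (2 sqrt 2) is the margin behind |U| <
      1.\<close>
    also have "\<dots> < cmod \<Lambda> * (P / (2 * sqrt 2))"
    proof (intro mult_strict_left_mono divide_strict_left_mono \<Lambda>pos P)
      have "sqrt 2 < 3 / 2" by (rule real_less_lsqrt) (auto simp: power2_eq_square)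
      then show "2 * sqrt 2 < 3" by simp
    qed auto
    also have "\<dots> = cmod \<Lambda> / sqrt 2 * (P / 2)" by simp
    also have "\<dots> \<le> cmod \<Lambda> / sqrt 2 * cmod (sin (of_real pi * \<eta>) / cos (2 * of_real pi * \<eta>))"
      using cmod_sin_div_cos_ge[OF Im_pos] by (intro mult_left_mono) (auto simp: P_def)
    also have "\<dots> = cmod M" by (simp add: M_def norm_mult norm_divide)
    finally have lt: "cmod (X - M) < cmod M" .
    then have "cmod M > 0" by (rule le_less_trans[OF norm_ge_zero])
    then have Mn: "M \<noteq> 0" by auto
    have "cmod ((X - M) / M) < 1" using lt Mn by (simp add: norm_divide)
    moreover have "X = M * (1 + (X - M) / M)" using Mn by (simp add: field_simps)
    ultimately show ?thesis by blast
  qed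
  then show ?thesis unfolding M_def[symmetric] using \<kappa> by blast
qed

end

section \<open>The region in \<sigma> and t\<close>

theorem mainTheorem9:
  shows "\<exists>A::real. A > 0 \<and> (\<exists>t0::real. t0 > 0 \<and>
    (\<forall>\<sigma> t::real. t > t0 \<and> 1 - \<sigma> \<ge> A * t powr (2/5) * ln t \<longrightarrow>
      (let s = Complex \<sigma> t in
        \<exists>U::complex. cmod U < 1 \<and>
          riemann_R s = - chi s * eta s powr (s - 1) * exp (- pi * \<i> * (eta s)\<^sup>2) *
            (sqrt 2 * exp (3 * pi * \<i> / 8) * sin (pi * eta s)) / (2 * cos (2 * pi * eta s)) *
            (1 + U))))"
proof -
  \<comment> \<open>The added 1 makes \<open>C2\<close> positive, as \<open>error_series_le\<close>
    demands, without evaluating the integral.\<close>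
  define C2 where "C2 = 1 + (LINT r::real|lborel. exp (- (3 / 2 * r\<^sup>2)))"
  have "cubic_error_const \<ge> 0" unfolding cubic_error_const_def by (intro integral_nonneg_AE AE_I2) simp
  moreover have "(LINT r::real|lborel. exp (- (3 / 2 * r\<^sup>2))) \<ge> (0::real)" by (intro integral_nonneg_AE AE_I2) simp
  then have "C2 > 0" unfolding C2_def by linarith
  ultimately obtain K L0 where KL: "K \<ge> 1" "L0 \<ge> 1" and main: "\<And>L Y \<tau>. L \<ge> L0 \<Longrightarrow> Y \<ge> K * L powr (- 1 / 5) \<Longrightarrow> \<tau> \<ge> 6 * L * Y \<Longrightarrow>
    (\<exists>b B. (\<forall>k. (let m = real k + 1 / 2 in if m ^ 3 \<le> L then exp (- (2 * pi * m * Y)) * (cubic_error_const * m ^ 3 / L)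
      else C2 * (1 + m / (2 * L)) powr (- \<tau>) + exp (- (2 * pi * m * Y))) \<le> b k) \<and>
      b sums B \<and> B \<le> exp (- (pi * Y)) * (1 - exp (- (2 * pi * Y))) / 3)"
    using error_series_le[of cubic_error_const C2] by metis
  \<comment> \<open>The conditions collected in \<open>t1\<close> serve, in order,
    \<open>Re s \<le> -1\<close>, the case \<tau> > t, the case \<tau> <= t, and |\<eta>| >=
    L0.\<close>
  have "eventually (\<lambda>t::real. t powr (2 / 5) * ln t \<ge> 2) at_top" by real_asymp
  moreover have "eventually (\<lambda>t::real. t powr (3 / 5) \<ge> 4 * pi * K) at_top" using KL by real_asymp
  moreover have "eventually (\<lambda>t::real. ln t \<ge> 4 * pi * K) at_top" by real_asymp
  ultimately have "eventually (\<lambda>t. t powr (2 / 5) * ln t \<ge> 2 \<and> t powr (3 / 5) \<ge> 4 * pi * K \<and> ln t \<ge> 4 * pi * K \<and> t \<ge> 2 * pi * L0\<^sup>2) at_top"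
    using eventually_ge_at_top[of "2 * pi * L0\<^sup>2"] by eventually_elim auto
  then obtain t1 where t1: "\<And>t. t \<ge> t1 \<Longrightarrow> t powr (2 / 5) * ln t \<ge> 2 \<and> t powr (3 / 5) \<ge> 4 * pi * K \<and> ln t \<ge> 4 * pi * K \<and> t \<ge> 2 * pi * L0\<^sup>2"
    by (auto simp: eventually_at_top_linorder)
  have goal: "\<exists>U::complex. cmod U < 1 \<and>
          riemann_R (Complex \<sigma> t) = - chi (Complex \<sigma> t) * eta (Complex \<sigma> t) powr (Complex \<sigma> t - 1) * exp (- pi * \<i> * (eta (Complex \<sigma> t))\<^sup>2) *
            (sqrt 2 * exp (3 * pi * \<i> / 8) * sin (pi * eta (Complex \<sigma> t))) / (2 * cos (2 * pi * eta (Complex \<sigma> t))) *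
            (1 + U)" if t: "t > max 1 t1" and \<sigma>: "1 - \<sigma> \<ge> t powr (2 / 5) * ln t" for \<sigma> t :: real
  proof -
    define s where "s = Complex \<sigma> t"
    define \<tau> where "\<tau> = 1 - \<sigma>"
    define \<eta> where "\<eta> = eta s"
    define L where "L = cmod \<eta>"
    note tt = t1[of t]
    have t_pos: "t > 1" and tt1: "t powr (2 / 5) * ln t \<ge> 2" and tt2: "t powr (3 / 5) \<ge> 4 * pi * K"
      and tt3: "ln t \<ge> 4 * pi * K" and tt4: "t \<ge> 2 * pi * L0\<^sup>2" using t tt by auto
    have \<tau>2: "\<tau> \<ge> 2" "\<sigma> < 1" using \<sigma> tt1 by (auto simp: \<tau>_def)
    note e = eta_quadrant[of \<sigma> t, folded s_def, folded \<eta>_def]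
    have e1: "\<eta>\<^sup>2 = Complex t \<tau> / of_real (2 * pi)" and e2: "0 < Re \<eta>" "0 < Im \<eta>" "Im \<eta> \<le> Re \<eta>"
      using e \<tau>2 t_pos by (auto simp: \<tau>_def)
    interpret saddle \<eta> s
    proof
      show "s = 1 + 2 * of_real pi * \<i> * \<eta>\<^sup>2" unfolding e1 by (simp add: complex_eq_iff s_def \<tau>_def Re_divide Im_divide power2_eq_square)
    qed (use e2 in auto)
    have Im2: "2 * pi * Im (\<eta>\<^sup>2) = \<tau>" unfolding e1 by (simp add: Im_divide power2_eq_square)
    have L2: "L\<^sup>2 = cmod (Complex t \<tau>) / (2 * pi)"
      using arg_cong[OF e1, of cmod] by (simp add: L_def norm_power norm_divide)
    have Lpos: "L > 0" using e2 by (auto simp: L_def)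
    have "t \<le> cmod (Complex t \<tau>)" using abs_Re_le_cmod[of "Complex t \<tau>"] by simp
    then have "L0\<^sup>2 \<le> L\<^sup>2" unfolding L2 using tt4 by (simp add: field_simps)
    then have LL0: "L \<ge> L0" by (rule power2_le_imp_le) (use Lpos in simp)
    have reL: "L / 2 \<le> Re \<eta>" using cmod_le[of \<eta>] e2 by (simp add: L_def)
    have \<tau>eq: "\<tau> = 4 * pi * (Re \<eta> * Im \<eta>)" using Im2 by (simp add: power2_eq_square mult_ac)
    have c1: "\<tau> \<ge> 6 * L * Im \<eta>"
    proof -
      have "3 * (L / 2 * Im \<eta>) \<le> pi * (Re \<eta> * Im \<eta>)" using reL e2 pi_gt3 Lpos by (intro mult_mono) auto
      then show ?thesis unfolding \<tau>eq by (simp add: mult_ac)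
    qed
    \<comment> \<open>|\<eta>|^2 is at most max t \<tau>. If \<tau> <= t, the factor ln t in the
      hypothesis gives the claim; otherwise \<tau> is by itself at least 4 pi K
      \<tau>^(2/5).\<close>
    have \<tau>L: "4 * pi * K * L powr (4 / 5) \<le> \<tau>"
    proof -
      define x where "x = max t \<tau>"
      have xp: "x > 1" using t_pos by (simp add: x_def)
      have "cmod (Complex t \<tau>) \<le> \<bar>t\<bar> + \<bar>\<tau>\<bar>" using cmod_le[of "Complex t \<tau>"] by simp
      also have "\<dots> \<le> 2 * x" using t_pos \<tau>2 by (simp add: x_def)
      also have "\<dots> \<le> (2 * pi) * x" using pi_gt3 xp by simp
      finally have "L\<^sup>2 \<le> x" unfolding L2 by (simp add: field_simps)
      then have "(L\<^sup>2) powr (2 / 5) \<le> x powr (2 / 5)" by (intro powr_mono2) auto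
      moreover have "(L\<^sup>2) powr (2 / 5) = L powr (4 / 5)"
        using Lpos powr_powr[of L 2 "2 / 5"] by simp
      ultimately have "4 * pi * K * L powr (4 / 5) \<le> 4 * pi * K * x powr (2 / 5)" using KL by (intro mult_left_mono) auto
      also have "\<dots> \<le> \<tau>"
      proof (cases "\<tau> \<le> t")
        case True
        then have "x = t" by (simp add: x_def)
        have "4 * pi * K * t powr (2 / 5) \<le> ln t * t powr (2 / 5)" using tt3 by (intro mult_right_mono) auto
        also have "\<dots> \<le> \<tau>" using \<sigma> by (simp add: \<tau>_def mult.commute)
        finally show ?thesis using \<open>x = t\<close> by simp
      next
        case False
        then have "x = \<tau>" by (simp add: x_def)
        have "4 * pi * K * \<tau> powr (2 / 5) \<le> \<tau> powr (3 / 5) * \<tau> powr (2 / 5)"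
          using False t_pos by (intro mult_right_mono order_trans[OF tt2] powr_mono2) auto
        also have "\<dots> = \<tau>" using \<tau>2 by (simp flip: powr_add)
        finally show ?thesis using \<open>x = \<tau>\<close> by simp
      qed
      finally show ?thesis .
    qed
    have c2: "Im \<eta> \<ge> K * L powr (- 1 / 5)"
    proof -
      have "Re \<eta> \<le> L" unfolding L_def by (rule complex_Re_le_cmod)
      then have "4 * pi * (Re \<eta> * Im \<eta>) \<le> 4 * pi * (L * Im \<eta>)" using e2 by (intro mult_left_mono mult_right_mono) auto
      with \<tau>L have "4 * pi * (K * L powr (4 / 5)) \<le> 4 * pi * (L * Im \<eta>)" unfolding \<tau>eq by simp
      then have "K * L powr (4 / 5) \<le> L * Im \<eta>" by simp
      moreover have "L powr (4 / 5) = L * L powr (- 1 / 5)" using Lpos powr_add[of L 1 "- 1 / 5"] by simp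
      ultimately have "L * (K * L powr (- 1 / 5)) \<le> L * Im \<eta>" by (simp add: mult_ac)
      then show ?thesis using Lpos by simp
    qed
    obtain b B where b: "\<And>k. (let m = real k + 1 / 2 in if m ^ 3 \<le> L then exp (- (2 * pi * m * Im \<eta>)) * (cubic_error_const * m ^ 3 / L)
      else C2 * (1 + m / (2 * L)) powr (- \<tau>) + exp (- (2 * pi * m * Im \<eta>))) \<le> b k"
      "b sums B" "B \<le> exp (- (pi * Im \<eta>)) * (1 - exp (- (2 * pi * Im \<eta>))) / 3"
      using main[OF LL0 c2 c1] by blast
    obtain \<kappa> where \<kappa>: "\<And>k. 0 < \<kappa> k" and X: "\<And>X. (\<lambda>k. bromwich s (node k) (\<kappa> k)) sums X \<Longrightarrow>
     (\<exists>U. cmod U < 1 \<and> X = exp (phase 0 (rot * \<eta>)) / sqrt 2 * (- \<i> * exp (\<i> * of_real (pi / 8)) * sin (of_real pi * \<eta>) / cos (2 * of_real pi * \<eta>)) * (1 + U))"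
      using bromwich_series_near_main[of b B, unfolded Im2, folded L_def C2_def, OF b] by blast
    have "Re s \<le> -1" "Im s \<noteq> 0" using \<tau>2 t_pos by (auto simp: s_def \<tau>_def)
    from riemann_R_eq_chi_bromwich[where \<kappa> = \<kappa>, OF this \<kappa>] obtain X0 where X0: "(\<lambda>k. bromwich s (node k) (\<kappa> k)) sums X0"
      and RX: "riemann_R s = chi s * (- \<i>) * exp (\<i> * pi * s / 4) * X0" by blast
    from X[OF X0] obtain U where U: "cmod U < 1"
      and XU: "X0 = exp (phase 0 (rot * \<eta>)) / sqrt 2 * (- \<i> * exp (\<i> * of_real (pi / 8)) * sin (of_real pi * \<eta>) / cos (2 * of_real pi * \<eta>)) * (1 + U)"
      by blast
    have R: "riemann_R s = chi s * (- \<i>) * exp (\<i> * pi * s / 4) *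
         (exp (phase 0 (rot * \<eta>)) / sqrt 2 * (- \<i> * exp (\<i> * of_real (pi / 8)) * sin (of_real pi * \<eta>) / cos (2 * of_real pi * \<eta>)) * (1 + U))"
      by (simp only: RX XU)
    have \<eta>n: "\<eta> \<noteq> 0" using e2 by auto
    \<comment> \<open>The phases i pi s / 4 and - i pi (s - 1) / 4 leave i pi / 4, which with i pi /
      8 makes 3 pi i / 8.\<close>
    have ex: "exp (\<i> * pi * s / 4) * exp (phase 0 (rot * \<eta>)) * exp (\<i> * of_real (pi / 8)) =
        \<eta> powr (s - 1) * exp (- pi * \<i> * \<eta>\<^sup>2) * exp (3 * pi * \<i> / 8)"
    proof -
      have "phase 0 (rot * \<eta>) = (s - 1) * Ln \<eta> - (s - 1) * (\<i> * pi / 4) - of_real pi * \<i> * \<eta>\<^sup>2"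
        using phase_rot[of \<eta> 0] e2 by simp
      moreover have "\<i> * pi * s / 4 + ((s - 1) * Ln \<eta> - (s - 1) * (\<i> * pi / 4) - of_real pi * \<i> * \<eta>\<^sup>2) + \<i> * of_real (pi / 8)
          = (s - 1) * Ln \<eta> + (- pi * \<i> * \<eta>\<^sup>2) + 3 * pi * \<i> / 8"
        by (simp add: field_simps)
      moreover have "\<eta> powr (s - 1) = exp ((s - 1) * Ln \<eta>)" using \<eta>n by (simp add: powr_def)
      ultimately show ?thesis by (simp only: exp_add[symmetric])
    qed
    have sq: "1 / complex_of_real (sqrt 2) = sqrt 2 / 2"
      using arg_cong[of "1 / sqrt 2" "sqrt 2 / 2" complex_of_real] by (simp add: real_div_sqrt field_simps)
    have "riemann_R s = - chi s * (exp (\<i> * pi * s / 4) * exp (phase 0 (rot * \<eta>)) * exp (\<i> * of_real (pi / 8))) * (1 / complex_of_real (sqrt 2)) * sin (pi * \<eta>) / cos (2 * pi * \<eta>) * (1 + U)"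
      unfolding R by (simp add: mult_ac)
    also have "\<dots> = - chi s * \<eta> powr (s - 1) * exp (- pi * \<i> * \<eta>\<^sup>2) *
            (sqrt 2 * exp (3 * pi * \<i> / 8) * sin (pi * \<eta>)) / (2 * cos (2 * pi * \<eta>)) * (1 + U)"
      unfolding ex sq by simp
    finally show ?thesis using U unfolding s_def[symmetric] \<eta>_def[symmetric] by blast
  qed
  show ?thesis
  \<comment> \<open>A = 1 suffices since ln t eventually exceeds the constant 4 pi K.\<close>
  proof (rule exI[of _ 1], intro conjI exI[of _ "max 1 t1"] allI impI, goal_cases)
    case (3 \<sigma> t)
    then show ?case unfolding Let_def by (intro goal) auto
  qed auto
qed

end
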